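(* Let $n\ge 1$, let $V:\mathbb{R}^n\to\mathbb{R}\cup\{\infty\}$ be a convex, radially symmetric function and let $q:\mathbb{R}^n\to\mathbb{R}$ be a bounded, radially symmetric function such that $e^{-V(x)}\,dx$ and $e^{-V(x)-q(x)}\,dx$ both belong to $\mathcal{P}(\mathbb{R}^n)$. Then the optimal transport $T$ that takes $e^{-V(x)}\,dx$ to $e^{-V(x)-q(x)}\,dx$ is Lipschitz and satisfies $$e^{-\|q^+\|_{L^\infty(\mathbb{R}^n)}-\|q^-\|_{L^\infty(\mathbb{R}^n)}}\,\mathrm{Id}\le\nabla T(x)\le e^{\|q^+\|_{L^\infty(\mathbb{R}^n)}+\|q^-\|_{L^\infty(\mathbb{R}^n)}}\,\mathrm{Id}\qquad\text{for a.e. }x\in\mathbb{R}^n,$$ where the inequalities are between symmetric matrices (in the sense of quadratic forms).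
   Context: $\mathcal{P}(\mathbb{R}^n)$ is the set of Borel probability measures on $\mathbb{R}^n$; $e^{-\infty}=0$; $q$ is understood to be measurable; $q^+=\max\{q,0\}$ and $q^-=\max\{-q,0\}$. A function $f$ on $\mathbb{R}^n$ is radially symmetric if $f(x)$ depends only on $|x|$. For $\mu,\nu\in\mathcal{P}(\mathbb{R}^n)$ with finite second moments and $\mu$ absolutely continuous, the optimal transport taking $\mu$ to $\nu$ is the $\mu$-a.e. unique minimizer of $\int|x-T(x)|^2\,d\mu(x)$ among Borel maps $T:\mathbb{R}^n\to\mathbb{R}^n$ with $T_\#\mu=\nu$; equivalently, the $\mu$-a.e. unique map with $T_\#\mu=\nu$ of the form $T=\nabla\phi$ with $\phi$ convex. Since $T$ is only unique up to sets of $e^{-V(x)}\,dx$-measure zero, the conclusion is understood for a suitable representative $T:\mathbb{R}^n\to\mathbb{R}^n$ of the optimal transport. *)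

theory Defs
  imports "HOL-Probability.Probability"
begin

definition radially_symmetric :: "('a::real_normed_vector \<Rightarrow> 'b) \<Rightarrow> bool" where
  "radially_symmetric f \<longleftrightarrow> (\<forall>x y. norm x = norm y \<longrightarrow> f x = f y)"

text \<open>Functions with values in \<open>\<real> \<union> {\<infinity>}\<close> are rendered as \<open>ereal\<close>-valued functions that omit
  \<open>-\<infinity>\<close>; this is why \<open>convex_on\<close>, which is restricted to real values, is not used.\<close>

definition convex_ereal :: "('a::real_vector \<Rightarrow> ereal) \<Rightarrow> bool" where
  "convex_ereal V \<longleftrightarrow> (\<forall>x. V x \<noteq> -\<infinity>) \<and>
     (\<forall>x y. \<forall>t\<in>{0<..<1}. V ((1 - t) *\<^sub>R x + t *\<^sub>R y) \<le> ereal (1 - t) * V x + ereal t * V y)"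

definition exp_ereal :: "ereal \<Rightarrow> ennreal" where
  "exp_ereal a = (if a = \<infinity> then \<infinity> else if a = -\<infinity> then 0 else ennreal (exp (real_of_ereal a)))"

text \<open>The Borel measure \<open>f(x) dx\<close>. Lebesgue measurable densities are allowed, so the density is
  taken with respect to the completed measure \<open>lebesgue\<close> and the result is then restricted to the
  Borel sets (as an image measure under the identity map).\<close>

definition borel_density :: "('a::euclidean_space \<Rightarrow> ennreal) \<Rightarrow> 'a measure" where
  "borel_density f = distr (density lebesgue f) borel (\<lambda>x. x)"

definition Linf_norm :: "('a::euclidean_space \<Rightarrow> real) \<Rightarrow> real" where
  "Linf_norm f = real_of_ereal (esssup lebesgue (\<lambda>x. ereal \<bar>f x\<bar>))"

definition transport_map :: "'a::euclidean_space measure \<Rightarrow> 'a measure \<Rightarrow> ('a \<Rightarrow> 'a) \<Rightarrow> bool" where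
  "transport_map \<mu> \<nu> T \<longleftrightarrow> T \<in> borel_measurable borel \<and> distr \<mu> borel T = \<nu>"

definition transport_cost :: "'a::euclidean_space measure \<Rightarrow> ('a \<Rightarrow> 'a) \<Rightarrow> ennreal" where
  "transport_cost \<mu> T = (\<integral>\<^sup>+x. ennreal ((norm (x - T x))\<^sup>2) \<partial>\<mu>)"

definition optimal_map :: "'a::euclidean_space measure \<Rightarrow> 'a measure \<Rightarrow> ('a \<Rightarrow> 'a) \<Rightarrow> bool" where
  "optimal_map \<mu> \<nu> T \<longleftrightarrow> transport_map \<mu> \<nu> T \<and>
     (\<forall>S. transport_map \<mu> \<nu> S \<longrightarrow> transport_cost \<mu> T \<le> transport_cost \<mu> S)"

text \<open>\<open>T\<close> is a representative of \<^emph>\<open>the\<close> optimal transport: a minimizer, and the only one up to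
  \<open>\<mu>\<close>-null sets.\<close>

definition the_optimal_transport :: "'a::euclidean_space measure \<Rightarrow> 'a measure \<Rightarrow> ('a \<Rightarrow> 'a) \<Rightarrow> bool" where
  "the_optimal_transport \<mu> \<nu> T \<longleftrightarrow> optimal_map \<mu> \<nu> T \<and>
     (\<forall>S. optimal_map \<mu> \<nu> S \<longrightarrow> (AE x in \<mu>. S x = T x))"

text \<open>Order on symmetric matrices in the sense of quadratic forms; symmetry of both sides is part
  of the relation.\<close>

definition loewner_le :: "real^'n^'n \<Rightarrow> real^'n^'n \<Rightarrow> bool" where
  "loewner_le A B \<longleftrightarrow> transpose A = A \<and> transpose B = B \<and> (\<forall>v. v \<bullet> (A *v v) \<le> v \<bullet> (B *v v))"

end

theory Submission
  imports Defs
begin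

text \<open>
  Why the theorem holds. Write \<open>V x = v |x|\<close>, and let \<open>F r\<close> and \<open>G r\<close> be the masses that \<open>e\<^sup>-\<^sup>V dx\<close> and
  \<open>e\<^sup>-\<^sup>V\<^sup>-\<^sup>q dx\<close> give to the ball of radius \<open>r\<close>. In polar coordinates a radial measure is the product of the
  law of \<open>|x|\<close> and the uniform law of the direction, so the map \<open>T x = s |x| x/|x|\<close> with \<open>G (s r) = F r\<close>
  transports one measure to the other (\<open>radial_pushforward\<close>). This \<open>T\<close> is the gradient of the convex
  function \<open>\<Phi> |x|\<close> with \<open>\<Phi>' = s\<close>, and Young's inequality for \<open>\<Phi>\<close> and its Legendre conjugate, whose equality
  case is the graph of \<open>T\<close>, shows that \<open>T\<close> is the unique optimal map (\<open>the_optimal_transport_T\<close>).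

  The Jacobian of \<open>T\<close> has the eigenvalues \<open>s' r\<close> (radial direction) and \<open>s r / r\<close> (tangential directions).
  Since \<open>s 0 = 0\<close>, both lie in \<open>[c, C]\<close> as soon as all difference quotients of \<open>s\<close> do. With
  \<open>f r = n \<omega> r\<^sup>n\<^sup>-\<^sup>1 e\<^sup>-\<^sup>v\<^sup>(\<^sup>r\<^sup>)\<close>, which is log-concave, \<open>F' = f\<close> and formally \<open>G' = f e\<^sup>-\<^sup>q\<close>, so that
  \<open>s' r = e\<^sup>q f r / f (s r)\<close>. Log-concavity of \<open>f\<close> makes \<open>F\<close> and \<open>1 - F\<close> log-concave; hence \<open>f r / f (s r)\<close>
  lies between \<open>F r / F (s r)\<close> and \<open>(1 - F r) / (1 - F (s r))\<close>. By the choice of \<open>s\<close> these two numbers are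
  the ratios \<open>G / F\<close> and \<open>(1 - G) / (1 - F)\<close> at \<open>s r\<close>, and both are between \<open>exp (- \<parallel>q\<^sup>+\<parallel>)\<close> and
  \<open>exp \<parallel>q\<^sup>-\<parallel>\<close> because \<open>e\<^sup>-\<^sup>q\<close> is (\<open>density_ratio\<close>). The factor \<open>e\<^sup>q\<close> completes the exponent to
  \<open>\<parallel>q\<^sup>+\<parallel> + \<parallel>q\<^sup>-\<parallel>\<close> on either side.

  Since \<open>q\<close> is merely measurable, \<open>G\<close> need not be differentiable. The derivative of \<open>s\<close> is therefore
  replaced by a bound on difference quotients near each point, which passes to all intervals
  (\<open>profile_upper\<close>, \<open>profile_lower\<close>), and the existence of \<open>s'\<close> almost everywhere comes from Vitali's covering
  theorem (\<open>bilipschitz_differentiable_ae\<close>).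
\<close>

section \<open>One-dimensional monotone transport from a log-concave density\<close>

text \<open>The one-dimensional problem. \<open>I\<close> is an open interval \<open>(0, R)\<close> with \<open>R \<le> \<infinity>\<close>; \<open>F\<close> and \<open>G\<close> are distribution
  functions living on it, \<open>F\<close> with density \<open>f\<close>. Log-concavity of \<open>f\<close> is stated as a four-point inequality
  because it is applied to translates of \<open>f\<close>. The increments of \<open>G\<close> are comparable with those of \<open>F\<close>, which is
  all that is known of a measurable perturbation of the density.\<close>

locale transport_profile =
  fixes I :: "real set" and f F G :: "real \<Rightarrow> real" and l u :: real
  assumes I_open: "open I" and I_pos: "r \<in> I \<Longrightarrow> 0 < r"
    and I_down: "d \<in> I \<Longrightarrow> 0 < r \<Longrightarrow> r \<le> d \<Longrightarrow> r \<in> I"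
    and f_pos: "r \<in> I \<Longrightarrow> 0 < f r"
    and f_cont: "continuous_on I f"
    and f_log_concave: "0 < a \<Longrightarrow> a \<le> x \<Longrightarrow> a \<le> y \<Longrightarrow> a + d = x + y \<Longrightarrow> d \<in> I \<Longrightarrow> f a * f d \<le> f x * f y"
    and F_deriv: "r \<in> I \<Longrightarrow> (F has_real_derivative f r) (at r)"
    and F_range: "r \<in> I \<Longrightarrow> 0 \<le> F r \<and> F r \<le> 1"
    and F_bot: "0 < e \<Longrightarrow> \<exists>r\<in>I. F r < e" and F_top: "0 < e \<Longrightarrow> \<exists>r\<in>I. 1 - e < F r"
    and G_range: "r \<in> I \<Longrightarrow> 0 \<le> G r \<and> G r \<le> 1"
    and G_bot: "0 < e \<Longrightarrow> \<exists>r\<in>I. G r < e" and G_top: "0 < e \<Longrightarrow> \<exists>r\<in>I. 1 - e < G r"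
    and l_pos: "0 < l"
    and G_ge: "a \<in> I \<Longrightarrow> b \<in> I \<Longrightarrow> a \<le> b \<Longrightarrow> l * (F b - F a) \<le> G b - G a"
    and G_le: "a \<in> I \<Longrightarrow> b \<in> I \<Longrightarrow> a \<le> b \<Longrightarrow> G b - G a \<le> u * (F b - F a)"
begin

lemma F_mvt:
  assumes "a \<in> I" "b \<in> I" "a < b"
  obtains z where "a < z" "z < b" "z \<in> I" "F b - F a = f z * (b - a)"
proof -
  have *: "x \<in> I" if "a \<le> x" "x \<le> b" for x
    using I_down[of b x] I_pos[of a] assms that by auto
  obtain z where "a < z" "z < b" "F b - F a = (b - a) * f z"
    using MVT2[of a b F f] F_deriv * assms(3) by blast
  then show thesis using that * by (auto simp: mult.commute)
qed

lemma F_strict: "a \<in> I \<Longrightarrow> b \<in> I \<Longrightarrow> a < b \<Longrightarrow> F a < F b"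
  using F_mvt[of a b] f_pos by (metis diff_gt_0_iff_gt mult_pos_pos)

lemma F_mono: "a \<in> I \<Longrightarrow> b \<in> I \<Longrightarrow> a \<le> b \<Longrightarrow> F a \<le> F b"
  using F_strict[of a b] by (cases "a = b") auto

lemma G_strict: "a \<in> I \<Longrightarrow> b \<in> I \<Longrightarrow> a < b \<Longrightarrow> G a < G b"
  using G_ge[of a b] F_strict[of a b] l_pos
  by (smt (verit) mult_pos_pos)

lemma G_mono: "a \<in> I \<Longrightarrow> b \<in> I \<Longrightarrow> a \<le> b \<Longrightarrow> G a \<le> G b"
  using G_strict[of a b] by (cases "a = b") auto

lemma F_bot_below: assumes "0 < e" "b \<in> I" obtains a where "a \<in> I" "a < b" "F a < e"
proof -
  obtain r where r: "r \<in> I" "F r < e" using F_bot assms by blast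
  have "min r (b/2) \<in> I" using I_down[of r "min r (b/2)"] I_pos r assms by auto
  moreover have "F (min r (b/2)) < e" using F_mono[OF calculation r(1)] r(2) by auto
  moreover have "min r (b/2) < b" using I_pos[OF assms(2)] by auto
  ultimately show thesis using that by blast
qed

lemma I_succ: assumes "b \<in> I" obtains c where "c \<in> I" "b < c"
proof -
  obtain e where "0 < e" "ball b e \<subseteq> I" using I_open assms openE by blast
  then have "b + e/2 \<in> I" by (intro subsetD[OF \<open>ball b e \<subseteq> I\<close>]) (auto simp: dist_real_def)
  then show thesis using that[of "b + e/2"] \<open>0 < e\<close> by auto
qed

lemma F_top_above: assumes "0 < e" "b \<in> I" obtains a where "a \<in> I" "b < a" "1 - e < F a"
proof -
  obtain r where r: "r \<in> I" "1 - e < F r" using F_top assms by blast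
  obtain c where c: "c \<in> I" "b < c" using I_succ assms by blast
  show thesis
  proof (cases "r \<le> c")
    case True then show thesis using that[OF c] F_mono[OF r(1) c(1)] r by auto
  next
    case False then show thesis using that[OF r(1)] r c by auto
  qed
qed

lemma G_bot_below: assumes "0 < e" "b \<in> I" obtains a where "a \<in> I" "a < b" "G a < e"
proof -
  obtain r where r: "r \<in> I" "G r < e" using G_bot assms by blast
  have "min r (b/2) \<in> I" using I_down[of r "min r (b/2)"] I_pos r assms by auto
  moreover have "G (min r (b/2)) < e" using G_mono[OF calculation r(1)] r(2) by auto
  moreover have "min r (b/2) < b" using I_pos[OF assms(2)] by auto
  ultimately show thesis using that by blast
qed

lemma G_top_above: assumes "0 < e" "b \<in> I" obtains a where "a \<in> I" "b < a" "1 - e < G a"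
proof -
  obtain r where r: "r \<in> I" "1 - e < G r" using G_top assms by blast
  obtain c where c: "c \<in> I" "b < c" using I_succ assms by blast
  show thesis
  proof (cases "r \<le> c")
    case True then show thesis using that[OF c] G_mono[OF r(1) c(1)] r by auto
  next
    case False then show thesis using that[OF r(1)] r c by auto
  qed
qed

lemma F_interior: assumes "r \<in> I" shows "0 < F r" "F r < 1"
proof -
  obtain a where "a \<in> I" "a < r" using F_bot_below[of 1 r] assms by auto
  then show "0 < F r" using F_strict[of a r] F_range[of a] assms by auto
  obtain c where "c \<in> I" "r < c" using I_succ assms by blast
  then show "F r < 1" using F_strict[of r c] F_range[of c] assms by auto
qed

lemma G_interior: assumes "r \<in> I" shows "0 < G r" "G r < 1"
proof -
  obtain a where "a \<in> I" "a < r" using F_bot_below[of 1 r] assms by auto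
  then show "0 < G r" using G_strict[of a r] G_range[of a] assms by auto
  obtain c where "c \<in> I" "r < c" using I_succ assms by blast
  then show "G r < 1" using G_strict[of r c] G_range[of c] assms by auto
qed

lemma I_nonempty: "I \<noteq> {}" using F_bot[of 1] by auto

lemma u_pos: "0 < u"
proof -
  obtain b where b: "b \<in> I" using I_nonempty by auto
  obtain c where c: "c \<in> I" "b < c" using I_succ b by blast
  have "0 < u * (F c - F b)" using G_strict[OF b c] G_le[of b c] b c by auto
  then show ?thesis using F_strict[OF b c] by (simp add: zero_less_mult_iff)
qed

text \<open>The comparison of increments passes to the two tails: let the other end point tend to the
  boundary of \<open>I\<close>.\<close>

lemma G_F_head: assumes "r \<in> I" shows "l * F r \<le> G r" "G r \<le> u * F r"
proof -
  show "l * F r \<le> G r"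
  proof (rule field_le_epsilon)
    fix e :: real assume "0 < e"
    then obtain a where a: "a \<in> I" "a < r" "F a < e / l"
      using F_bot_below[of "e / l" r] assms l_pos by auto
    have "l * F a < e" using a(3) l_pos by (simp add: field_simps)
    then show "l * F r \<le> G r + e"
      using G_ge[of a r] G_range[of a] a assms by (simp add: algebra_simps)
  qed
  show "G r \<le> u * F r"
  proof (rule field_le_epsilon)
    fix e :: real assume "0 < e"
    then obtain a where a: "a \<in> I" "a < r" "G a < e"
      using G_bot_below[of e r] assms by auto
    have "0 \<le> u * F a" using F_range[OF a(1)] u_pos by simp
    then show "G r \<le> u * F r + e"
      using G_le[of a r] a assms by (simp add: algebra_simps)
  qed
qed

lemma G_F_tail: assumes "r \<in> I" shows "l * (1 - F r) \<le> 1 - G r" "1 - G r \<le> u * (1 - F r)"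
proof -
  show "l * (1 - F r) \<le> 1 - G r"
  proof (rule field_le_epsilon)
    fix e :: real assume "0 < e"
    then obtain a where a: "a \<in> I" "r < a" "1 - e / l < F a"
      using F_top_above[of "e / l" r] assms l_pos by auto
    have "l * (1 - F a) < e" using a(3) l_pos by (simp add: field_simps)
    then show "l * (1 - F r) \<le> 1 - G r + e"
      using G_ge[of r a] G_range[of a] a assms by (simp add: algebra_simps)
  qed
  show "1 - G r \<le> u * (1 - F r)"
  proof (rule field_le_epsilon)
    fix e :: real assume "0 < e"
    then obtain a where a: "a \<in> I" "r < a" "1 - e < G a"
      using G_top_above[of e r] assms by auto
    have "u * F a \<le> u" using F_range[OF a(1)] u_pos by simp
    then show "1 - G r \<le> u * (1 - F r) + e"
      using G_le[of r a] a assms by (simp add: algebra_simps)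
  qed
qed

text \<open>Log-concavity of \<open>F\<close> in the form that \<open>f / F\<close> decreases. The function
  \<open>x \<mapsto> f s F (x + (r - s)) - f r F x\<close> increases up to \<open>x = s\<close> by the four-point inequality and is almost
  nonnegative near \<open>0\<close>.\<close>

lemma F_log_concave:
  assumes s: "s \<in> I" and r: "r \<in> I" and "s \<le> r"
  shows "f r * F s \<le> f s * F r"
proof (rule field_le_epsilon)
  fix e :: real assume "0 < e"
  then obtain h where h: "h \<in> I" "h < s" "F h < e / f r"
    using F_bot_below[of "e / f r" s] s f_pos[OF r] by auto
  define D where "D = (\<lambda>x. f s * F (x + (r - s)) - f r * F x)"
  have "D h \<le> D s"
  proof (rule DERIV_nonneg_imp_nondecreasing[where f=D])
    show "h \<le> s" using h by simp
    fix x assume x: "h \<le> x" "x \<le> s"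
    have xI: "x \<in> I" "x + (r - s) \<in> I"
      using I_down[OF r, of x] I_down[OF r, of "x + (r - s)"] I_pos[OF h(1)] x \<open>s \<le> r\<close> by auto
    have shifted: "((\<lambda>x. F (x + (r - s))) has_real_derivative f (x + (r - s))) (at x)"
      using F_deriv[OF xI(2)] by (simp add: DERIV_shift)
    have "(D has_real_derivative f s * f (x + (r - s)) - f r * f x) (at x)"
      unfolding D_def
      by (intro DERIV_diff DERIV_cmult shifted F_deriv[OF xI(1)])
    moreover have "f x * f r \<le> f s * f (x + (r - s))"
      using f_log_concave[of x s "x + (r - s)" r] I_pos[OF xI(1)] x r \<open>s \<le> r\<close> by auto
    ultimately show "\<exists>y. (D has_real_derivative y) (at x) \<and> y \<ge> 0" by (auto simp: mult.commute)
  qed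
  moreover have "h + (r - s) \<in> I" using I_down[OF r, of "h + (r - s)"] I_pos[OF h(1)] h \<open>s \<le> r\<close> by auto
  then have "0 \<le> f s * F (h + (r - s))" using F_range f_pos[OF s] by simp
  moreover have "f r * F h \<le> e" using h(3) f_pos[OF r] by (simp add: field_simps)
  ultimately show "f r * F s \<le> f s * F r + e" by (simp add: D_def)
qed

text \<open>Log-concavity of \<open>1 - F\<close>, by the same argument run from \<open>r\<close> towards the right end of \<open>I\<close>.\<close>

lemma F_tail_log_concave:
  assumes s: "s \<in> I" and r: "r \<in> I" and "s \<le> r"
  shows "f s * (1 - F r) \<le> f r * (1 - F s)"
proof (rule field_le_epsilon)
  fix e :: real assume "0 < e"
  then obtain b where b: "b \<in> I" "r < b" "1 - e / f s < F b"
    using F_top_above[of "e / f s" r] r f_pos[OF s] by auto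
  define D where "D = (\<lambda>x. f s * F x - f r * F (x - (r - s)))"
  have "D b \<le> D r"
  proof (rule DERIV_nonpos_imp_nonincreasing[where f=D])
    show "r \<le> b" using b by simp
    fix x assume x: "r \<le> x" "x \<le> b"
    have xI: "x \<in> I" "x - (r - s) \<in> I"
      using I_down[OF b(1), of x] I_down[OF b(1), of "x - (r - s)"] I_pos[OF s] x \<open>s \<le> r\<close> by auto
    have shifted: "((\<lambda>x. F (x - (r - s))) has_real_derivative f (x - (r - s))) (at x)"
      using F_deriv[OF xI(2)] DERIV_shift[of F "f (x - (r - s))" x "s - r"] by (simp add: algebra_simps)
    have "(D has_real_derivative f s * f x - f r * f (x - (r - s))) (at x)"
      unfolding D_def
      by (intro DERIV_diff DERIV_cmult shifted F_deriv[OF xI(1)])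
    moreover have "f s * f x \<le> f r * f (x - (r - s))"
      using f_log_concave[of s r "x - (r - s)" x] I_pos[OF s] x xI \<open>s \<le> r\<close> by auto
    ultimately show "\<exists>y. (D has_real_derivative y) (at x) \<and> y \<le> 0" by force
  qed
  moreover have "b - (r - s) \<in> I" using I_down[OF b(1), of "b - (r - s)"] I_pos[OF s] b \<open>s \<le> r\<close> by auto
  then have "f r * F (b - (r - s)) \<le> f r" using F_range f_pos[OF r] by simp
  moreover have "f s * (1 - F b) \<le> e" using b(3) f_pos[OF s] by (simp add: field_simps)
  ultimately show "f s * (1 - F r) \<le> f r * (1 - F s) + e" by (simp add: D_def algebra_simps)
qed

text \<open>The heart of the estimate. Whether \<open>t \<le> r\<close> or \<open>r \<le> t\<close>, one of the two log-concavity statements bounds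
  \<open>f r / f t\<close> from above and the other one from below, and the hypothesis \<open>G t = F r\<close> turns the bounding
  ratios into ratios of \<open>G\<close> and \<open>F\<close> at the same point \<open>t\<close>.\<close>

lemma density_ratio:
  assumes r: "r \<in> I" and t: "t \<in> I" and eq: "G t = F r"
  shows "l * f t \<le> f r" "f r \<le> u * f t"
proof -
  note int = F_interior[OF t] F_interior[OF r] f_pos[OF r] f_pos[OF t]
  have "l * f t \<le> f r \<and> f r \<le> u * f t"
  proof (cases "t \<le> r")
    case True
    have "f r * F t \<le> f t * G t" using F_log_concave[OF t r True] eq by simp
    also have "\<dots> \<le> f t * (u * F t)" using G_F_head(2)[OF t] int by simp
    finally have "f r * F t \<le> (u * f t) * F t" by (simp add: ac_simps)
    moreover have "f t * (l * (1 - F t)) \<le> f t * (1 - G t)" using G_F_tail(1)[OF t] int by simp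
    then have "(l * f t) * (1 - F t) \<le> f r * (1 - F t)"
      using F_tail_log_concave[OF t r True] eq by (simp add: ac_simps)
    ultimately show ?thesis using int by simp
  next
    case False then have le: "r \<le> t" by simp
    have "f t * (l * F t) \<le> f t * G t" using G_F_head(1)[OF t] int by simp
    then have "(l * f t) * F t \<le> f r * F t" using F_log_concave[OF r t le] eq by (simp add: ac_simps)
    moreover have "f r * (1 - F t) \<le> f t * (1 - G t)" using F_tail_log_concave[OF r t le] eq by simp
    moreover have "f t * (1 - G t) \<le> f t * (u * (1 - F t))" using G_F_tail(2)[OF t] int by simp
    ultimately show ?thesis using int
      by (smt (verit) mult.assoc mult.commute mult_right_le_imp_le)
  qed
  then show "l * f t \<le> f r" "f r \<le> u * f t" by auto
qed

lemma F_cont: "continuous_on I F"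
  using DERIV_isCont[OF F_deriv] by (intro continuous_at_imp_continuous_on) auto

lemma I_segment: "a \<in> I \<Longrightarrow> b \<in> I \<Longrightarrow> {a..b} \<subseteq> I"
  using I_down[of b] I_pos[of a] by force

lemma G_F_dist: assumes "a \<in> I" "b \<in> I" shows "\<bar>G b - G a\<bar> \<le> u * \<bar>F b - F a\<bar>"
proof (cases "a \<le> b")
  case True
  then show ?thesis using G_le[OF assms True] G_mono[OF assms True] F_mono[OF assms True] by simp
next
  case False then have le: "b \<le> a" by simp
  show ?thesis using G_le[OF assms(2,1) le] G_mono[OF assms(2,1) le] F_mono[OF assms(2,1) le] by simp
qed

lemma G_cont: "continuous_on I G"
  unfolding continuous_on
proof
  fix x assume x: "x \<in> I"
  have "((\<lambda>y. F y - F x) \<longlongrightarrow> 0) (at x within I)"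
    using F_cont x by (simp add: continuous_on LIM_zero_iff)
  then have null: "((\<lambda>y. u * \<bar>F y - F x\<bar>) \<longlongrightarrow> 0) (at x within I)"
    by (intro tendsto_mult_right_zero tendsto_rabs_zero)
  have "\<forall>\<^sub>F y in at x within I. norm (G y - G x) \<le> u * \<bar>F y - F x\<bar>"
    using G_F_dist[OF x] by (auto simp: eventually_at_filter)
  then have "((\<lambda>y. G y - G x) \<longlongrightarrow> 0) (at x within I)"
    using null by (rule Lim_null_comparison)
  then show "(G \<longlongrightarrow> G x) (at x within I)" by (simp add: LIM_zero_iff)
qed

lemma G_hits: assumes "0 < y" "y < 1" obtains t where "t \<in> I" "G t = y"
proof -
  obtain b where b: "b \<in> I" "1 - (1 - y) < G b" using G_top[of "1 - y"] assms by auto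
  obtain a where a: "a \<in> I" "a < b" "G a < y" using G_bot_below[OF assms(1) b(1)] by auto
  obtain t where "a \<le> t" "t \<le> b" "G t = y"
    using IVT'[of G a y b] a b continuous_on_subset[OF G_cont I_segment[OF a(1) b(1)]] by auto
  then show thesis using that I_segment[OF a(1) b(1)] by auto
qed

lemma F_hits: assumes "0 < y" "y < 1" obtains t where "t \<in> I" "F t = y"
proof -
  obtain b where b: "b \<in> I" "1 - (1 - y) < F b" using F_top[of "1 - y"] assms by auto
  obtain a where a: "a \<in> I" "a < b" "F a < y" using F_bot_below[OF assms(1) b(1)] by auto
  obtain t where "a \<le> t" "t \<le> b" "F t = y"
    using IVT'[of F a y b] a b continuous_on_subset[OF F_cont I_segment[OF a(1) b(1)]] by auto
  then show thesis using that I_segment[OF a(1) b(1)] by auto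
qed

definition profile :: "real \<Rightarrow> real" where "profile r = inv_into I G (F r)"

lemma profile: assumes "r \<in> I" shows "profile r \<in> I" "G (profile r) = F r"
proof -
  obtain t where "t \<in> I" "G t = F r" using G_hits[OF F_interior[OF assms]] by metis
  then have "F r \<in> G ` I" by force
  then show "profile r \<in> I" "G (profile r) = F r"
    unfolding profile_def by (auto intro: inv_into_into f_inv_into_f)
qed

lemma profile_onto: assumes "t \<in> I" obtains r where "r \<in> I" "profile r = t"
proof -
  obtain r where r: "r \<in> I" "F r = G t" using F_hits[OF G_interior[OF assms]] by metis
  then have "profile r = t"
    using profile[OF r(1)] G_strict[of t "profile r"] G_strict[of "profile r" t] assms
    by (cases t "profile r" rule: linorder_cases) auto
  then show thesis using that r by auto
qed

lemma profile_strict: assumes "a \<in> I" "b \<in> I" "a < b" shows "profile a < profile b"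
proof (rule ccontr)
  assume "\<not> ?thesis"
  then have "G (profile b) \<le> G (profile a)"
    using G_mono[OF profile(1)[OF assms(2)] profile(1)[OF assms(1)]] by simp
  then show False using F_strict[OF assms] profile(2) assms by simp
qed

lemma profile_mono: "a \<in> I \<Longrightarrow> b \<in> I \<Longrightarrow> a \<le> b \<Longrightarrow> profile a \<le> profile b"
  using profile_strict[of a b] by (cases "a = b") auto

text \<open>Continuity of the profile, from monotonicity and surjectivity.\<close>

lemma profile_near:
  assumes x: "x \<in> I" and "0 < e"
  obtains d where "0 < d" "ball x d \<subseteq> I" "\<And>y. \<bar>y - x\<bar> < d \<Longrightarrow> \<bar>profile y - profile x\<bar> < e"
proof -
  define t where "t = profile x"
  have t: "t \<in> I" using profile x t_def by auto
  obtain e' where e': "0 < e'" "ball t e' \<subseteq> I" using I_open t openE by blast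
  define h where "h = min e e' / 2"
  have h: "0 < h" "h < e" "h < e'" using e' \<open>0 < e\<close> by (auto simp: h_def)
  have "t - h \<in> I" "t + h \<in> I" using e'(2) h by (auto simp: subset_iff dist_real_def)
  then obtain a b where ab: "a \<in> I" "profile a = t - h" "b \<in> I" "profile b = t + h"
    using profile_onto by metis
  have "a < x" "x < b"
    using profile_mono[of x a] profile_mono[of b x] ab x h t_def by (smt (verit))+
  define d where "d = min (x - a) (b - x)"
  have near: "y \<in> I \<and> \<bar>profile y - t\<bar> < e" if "\<bar>y - x\<bar> < d" for y
  proof -
    have "a < y" "y < b" using that by (auto simp: d_def)
    then have "y \<in> I" using I_segment[OF ab(1,3)] by auto
    then show ?thesis using profile_strict[of a y] profile_strict[of y b] ab \<open>a < y\<close> \<open>y < b\<close> h by auto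
  qed
  show thesis
    by (rule that[of d]) (use near \<open>a < x\<close> \<open>x < b\<close> in \<open>auto simp: d_def t_def dist_real_def abs_minus_commute\<close>)
qed

lemma f_near:
  assumes "x \<in> I" "f x \<in> U" "open U"
  obtains d where "0 < d" "\<And>y. \<bar>y - x\<bar> < d \<Longrightarrow> f y \<in> U"
proof -
  have "isCont f x" using f_cont I_open assms(1) continuous_on_eq_continuous_at by blast
  then have "\<forall>\<^sub>F y in nhds x. f y \<in> U"
    using assms by (simp add: continuous_at topological_tendstoD tendsto_at_iff_tendsto_nhds)
  then show thesis using that unfolding eventually_nhds_metric by (auto simp: dist_real_def)
qed

text \<open>Near \<open>x\<close> the mean value theorem expresses the increments of \<open>F\<close> through values of \<open>f\<close> close to
  \<open>f x\<close> and \<open>f (profile x)\<close>; the strict inequality at \<open>x\<close> leaves room for the error, and a number \<open>y\<close>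
  strictly between the two sides separates them on a whole neighbourhood.\<close>

lemma profile_slope_le_near:
  assumes "0 \<le> k" and x: "x \<in> I"
    and uniform: "k * l * f (profile x) > f x"
  obtains d where "0 < d" "\<And>a b. a \<le> x \<Longrightarrow> x \<le> b \<Longrightarrow> b - a < d \<Longrightarrow> profile b - profile a \<le> k * (b - a)"
proof -
  note t = profile(1)[OF x]
  obtain y where y: "f x < y" "y < k * l * f (profile x)" using uniform dense by blast
  have y0: "0 < y" using f_pos[OF x] y by simp
  have k0: "0 < k" using y y0 f_pos[OF t] l_pos assms(1)
    by (metis mult_zero_left order.strict_trans less_eq_real_def less_asym)
  obtain d1 where d1: "0 < d1" "\<And>z. \<bar>z - x\<bar> < d1 \<Longrightarrow> f z < y"
    using f_near[of x "{..<y}"] x y by auto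
  obtain d2 where d2: "0 < d2" "\<And>z. \<bar>z - profile x\<bar> < d2 \<Longrightarrow> y / (k * l) < f z"
    using f_near[of "profile x" "{y / (k * l)<..}"] t y k0 l_pos
    by (auto simp: divide_less_eq ac_simps)
  obtain d3 where d3: "0 < d3" "ball x d3 \<subseteq> I" "\<And>z. \<bar>z - x\<bar> < d3 \<Longrightarrow> \<bar>profile z - profile x\<bar> < d2"
    using profile_near[OF x d2(1)] by blast
  have "profile b - profile a \<le> k * (b - a)" if ab: "a \<le> x" "x \<le> b" "b - a < min d1 d3" for a b
  proof (cases "a = b")
    case False
    then have "a < b" using ab by auto
    have I: "a \<in> I" "b \<in> I" using d3(2) ab by (auto simp: subset_iff dist_real_def)
    obtain z where z: "a < z" "z < b" "F b - F a = f z * (b - a)" using F_mvt[OF I \<open>a < b\<close>] by metis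
    obtain w where w: "profile a < w" "w < profile b" "w \<in> I"
        "F (profile b) - F (profile a) = f w * (profile b - profile a)"
      using F_mvt[OF profile(1)[OF I(1)] profile(1)[OF I(2)] profile_strict[OF I \<open>a < b\<close>]] by metis
    have "f z < y" using d1 z ab by auto
    have "\<bar>w - profile x\<bar> < d2"
      using d3(3)[of a] d3(3)[of b] w ab by auto
    then have fw: "y < k * l * f w" using d2(2)[of w] k0 l_pos by (simp add: field_simps)
    have "l * (f w * (profile b - profile a)) \<le> f z * (b - a)"
      using G_ge[OF profile(1)[OF I(1)] profile(1)[OF I(2)]] w z profile[OF I(1)] profile[OF I(2)] by auto
    also have "\<dots> \<le> y * (b - a)" using \<open>f z < y\<close> \<open>a < b\<close> by (intro mult_right_mono) auto
    finally have "k * (l * (f w * (profile b - profile a))) \<le> k * (y * (b - a))"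
      using k0 by (intro mult_left_mono) auto
    moreover have "y * (profile b - profile a) \<le> (k * l * f w) * (profile b - profile a)"
      using fw profile_strict[OF I \<open>a < b\<close>] by (intro mult_right_mono) auto
    ultimately have "y * (profile b - profile a) \<le> y * (k * (b - a))" by (simp add: ac_simps)
    then show ?thesis using y0 by simp
  qed simp
  then show thesis using that[of "min d1 d3"] d1 d3 by auto
qed

text \<open>The same with the roles of the two densities exchanged.\<close>

lemma profile_slope_ge_near:
  assumes "0 < k" and x: "x \<in> I"
    and uniform: "k * u * f (profile x) < f x"
  obtains d where "0 < d" "\<And>a b. a \<le> x \<Longrightarrow> x \<le> b \<Longrightarrow> b - a < d \<Longrightarrow> k * (b - a) \<le> profile b - profile a"
proof -
  note t = profile(1)[OF x]
  obtain y where y: "y < f x" "k * u * f (profile x) < y" using uniform dense by blast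
  have y0: "0 < y" using y f_pos[OF t] u_pos \<open>0 < k\<close> by (smt (verit) mult_pos_pos)
  obtain d1 where d1: "0 < d1" "\<And>z. \<bar>z - x\<bar> < d1 \<Longrightarrow> y < f z"
    using f_near[of x "{y<..}"] x y by auto
  obtain d2 where d2: "0 < d2" "\<And>z. \<bar>z - profile x\<bar> < d2 \<Longrightarrow> f z < y / (k * u)"
    using f_near[of "profile x" "{..<y / (k * u)}"] t y \<open>0 < k\<close> u_pos
    by (auto simp: less_divide_eq ac_simps)
  obtain d3 where d3: "0 < d3" "ball x d3 \<subseteq> I" "\<And>z. \<bar>z - x\<bar> < d3 \<Longrightarrow> \<bar>profile z - profile x\<bar> < d2"
    using profile_near[OF x d2(1)] by blast
  have "k * (b - a) \<le> profile b - profile a" if ab: "a \<le> x" "x \<le> b" "b - a < min d1 d3" for a b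
  proof (cases "a = b")
    case False
    then have "a < b" using ab by auto
    have I: "a \<in> I" "b \<in> I" using d3(2) ab by (auto simp: subset_iff dist_real_def)
    obtain z where z: "a < z" "z < b" "F b - F a = f z * (b - a)" using F_mvt[OF I \<open>a < b\<close>] by metis
    obtain w where w: "profile a < w" "w < profile b" "w \<in> I"
        "F (profile b) - F (profile a) = f w * (profile b - profile a)"
      using F_mvt[OF profile(1)[OF I(1)] profile(1)[OF I(2)] profile_strict[OF I \<open>a < b\<close>]] by metis
    have "y < f z" using d1 z ab by auto
    have "\<bar>w - profile x\<bar> < d2"
      using d3(3)[of a] d3(3)[of b] w ab by auto
    then have fw: "k * u * f w < y" using d2(2)[of w] \<open>0 < k\<close> u_pos by (simp add: field_simps)
    have "y * (b - a) \<le> f z * (b - a)" using \<open>y < f z\<close> \<open>a < b\<close> by (intro mult_right_mono) auto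
    also have "\<dots> \<le> u * (f w * (profile b - profile a))"
      using G_le[OF profile(1)[OF I(1)] profile(1)[OF I(2)]] w z profile[OF I(1)] profile[OF I(2)] by auto
    finally have "k * (y * (b - a)) \<le> k * (u * (f w * (profile b - profile a)))"
      using \<open>0 < k\<close> by (intro mult_left_mono) auto
    moreover have "(k * u * f w) * (profile b - profile a) \<le> y * (profile b - profile a)"
      using fw profile_strict[OF I \<open>a < b\<close>] by (intro mult_right_mono) auto
    ultimately have "y * (k * (b - a)) \<le> y * (profile b - profile a)" by (simp add: ac_simps)
    then show ?thesis using y0 by simp
  qed simp
  then show thesis using that[of "min d1 d3"] d1 d3 by auto
qed

text \<open>Local slope bounds are additive over adjacent intervals, so they hold globally. The strict inequality
  required by the local lemma costs an arbitrarily small increase of the constant.\<close>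

lemma profile_upper:
  assumes I: "a \<in> I" "b \<in> I" and "a \<le> b"
  shows "profile b - profile a \<le> (u / l) * (b - a)"
proof -
  have *: "profile b - profile a \<le> k * (b - a)" if k: "u / l < k" for k
  proof -
    have k0: "0 \<le> k" using k u_pos l_pos by (smt (verit) divide_pos_pos)
    have "a \<le> a' \<and> a' \<le> b' \<and> b' \<le> b \<longrightarrow> profile b' - profile a' \<le> k * (b' - a')"
      if "a' = a" "b' = b" for a' b'
      unfolding that using \<open>a \<le> b\<close>
    proof (induction rule: Bolzano)
      case (trans a' b' c') then show ?case by (auto simp: algebra_simps)
    next
      case (local x)
      then have x: "x \<in> I" using I_segment[OF I] by auto
      have "u * f (profile x) < k * l * f (profile x)"
        using k l_pos f_pos[OF profile(1)[OF x]] by (simp add: field_simps)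
      then have "f x < k * l * f (profile x)"
        using density_ratio(2)[OF x profile[OF x]] by simp
      then obtain d where "0 < d" "\<And>a b. a \<le> x \<Longrightarrow> x \<le> b \<Longrightarrow> b - a < d \<Longrightarrow> profile b - profile a \<le> k * (b - a)"
        using profile_slope_le_near[OF k0 x] by blast
      then show ?case by (intro exI[of _ d]) auto
    qed
    then show ?thesis using \<open>a \<le> b\<close> by auto
  qed
  show ?thesis
  proof (rule field_le_epsilon)
    fix e :: real assume "0 < e"
    define k where "k = u / l + e / (b - a + 1)"
    have "u / l < k" using \<open>0 < e\<close> \<open>a \<le> b\<close> by (simp add: k_def)
    have "profile b - profile a \<le> k * (b - a)" using *[OF \<open>u / l < k\<close>] .
    also have "\<dots> = (u / l) * (b - a) + e * ((b - a) / (b - a + 1))" by (simp add: k_def algebra_simps)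
    also have "\<dots> \<le> (u / l) * (b - a) + e * 1"
      using \<open>0 < e\<close> \<open>a \<le> b\<close> by (intro add_left_mono mult_left_mono) (auto simp: divide_le_eq)
    finally show "profile b - profile a \<le> (u / l) * (b - a) + e" by simp
  qed
qed

lemma profile_lower:
  assumes I: "a \<in> I" "b \<in> I" and "a \<le> b"
  shows "(l / u) * (b - a) \<le> profile b - profile a"
proof -
  have *: "k * (b - a) \<le> profile b - profile a" if k: "0 < k" "k < l / u" for k
  proof -
    have "a \<le> a' \<and> a' \<le> b' \<and> b' \<le> b \<longrightarrow> k * (b' - a') \<le> profile b' - profile a'"
      if "a' = a" "b' = b" for a' b'
      unfolding that using \<open>a \<le> b\<close>
    proof (induction rule: Bolzano)
      case (trans a' b' c') then show ?case by (auto simp: algebra_simps)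
    next
      case (local x)
      then have x: "x \<in> I" using I_segment[OF I] by auto
      have "k * u * f (profile x) < l * f (profile x)"
        using k u_pos f_pos[OF profile(1)[OF x]] by (simp add: field_simps)
      then have "k * u * f (profile x) < f x"
        using density_ratio(1)[OF x profile[OF x]] by simp
      then obtain d where "0 < d" "\<And>a b. a \<le> x \<Longrightarrow> x \<le> b \<Longrightarrow> b - a < d \<Longrightarrow> k * (b - a) \<le> profile b - profile a"
        using profile_slope_ge_near[OF k(1) x] by blast
      then show ?case by (intro exI[of _ d]) auto
    qed
    then show ?thesis using \<open>a \<le> b\<close> by auto
  qed
  have c: "0 < l / u" using l_pos u_pos by simp
  show ?thesis
  proof (cases "a = b")
    case False
    then have "a < b" using \<open>a \<le> b\<close> by simp
    have "l / u \<le> (profile b - profile a) / (b - a)"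
    proof (rule dense_le_bounded[OF c])
      fix k assume "0 < k" "k < l / u"
      then show "k \<le> (profile b - profile a) / (b - a)" using *[of k] \<open>a < b\<close> by (simp add: le_divide_eq)
    qed
    then show ?thesis using \<open>a < b\<close> by (simp add: le_divide_eq)
  qed simp
qed

end

section \<open>Almost everywhere differentiability of bi-Lipschitz functions\<close>

text \<open>If every point of \<open>E\<close> has arbitrarily short intervals around it that \<open>s\<close> stretches by at most \<open>\<alpha>\<close>, a
  Vitali cover by such intervals inside an open neighbourhood of \<open>E\<close> shows that \<open>s\<close> stretches the measure of \<open>E\<close>
  by at most \<open>\<alpha>\<close>; the part missed by the cover is negligible and stays so under a Lipschitz map. Outer
  measure avoids any question about measurability of \<open>E\<close>.\<close>

lemma outer_measure_image_le:
  fixes s :: "real \<Rightarrow> real"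
  assumes mono: "\<And>a b. a < b \<Longrightarrow> s a < s b"
    and lip: "\<And>a b. a \<le> b \<Longrightarrow> s b - s a \<le> L * (b - a)"
    and "0 \<le> \<alpha>"
    and fine: "\<And>x d. x \<in> E \<Longrightarrow> 0 < d \<Longrightarrow>
        \<exists>a b. a < b \<and> a \<le> x \<and> x \<le> b \<and> b - a < d \<and> s b - s a \<le> \<alpha> * (b - a)"
  shows "outer_measure_of lebesgue (s ` E) \<le> ennreal \<alpha> * outer_measure_of lebesgue E"
proof -
  have mono': "a \<le> b \<Longrightarrow> s a \<le> s b" for a b using mono[of a b] by (cases "a = b") auto
  have on_open: "outer_measure_of lebesgue (s ` E) \<le> ennreal \<alpha> * emeasure lebesgue U"
    if U: "open U" "E \<subseteq> U" for U
  proof -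
    define K where "K = {(c, r). 0 < r \<and> cball c r \<subseteq> U \<and> s (c + r) - s (c - r) \<le> \<alpha> * (2 * r)}"
    have "\<exists>i. i \<in> K \<and> x \<in> cball (fst i) (snd i) \<and> snd i < d" if "x \<in> E" "0 < d" for x d
    proof -
      obtain e where e: "0 < e" "ball x e \<subseteq> U" using U \<open>x \<in> E\<close> openE by blast
      obtain a b where ab: "a < b" "a \<le> x" "x \<le> b" "b - a < min d e" "s b - s a \<le> \<alpha> * (b - a)"
        using fine[of x "min d e"] \<open>x \<in> E\<close> \<open>0 < d\<close> e by auto
      define m h where "m = (a + b) / 2" and "h = (b - a) / 2"
      have mh: "m - h = a" "m + h = b" by (simp_all add: m_def h_def field_simps)
      then have "cball m h = {a..b}" by (simp add: cball_eq_atLeastAtMost)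
      moreover have "{a..b} \<subseteq> U" using e(2) ab by (force simp: dist_real_def subset_iff)
      moreover have "2 * h = b - a" by (simp add: h_def)
      ultimately have "(m, h) \<in> K" using ab unfolding K_def by (simp add: mh)
      then show ?thesis using ab mh \<open>cball m h = {a..b}\<close> \<open>2 * h = b - a\<close>
        by (intro exI[of _ "(m, h)"]) auto
    qed
    then obtain C where C: "countable C" "C \<subseteq> K"
        "pairwise (\<lambda>i j. disjnt (cball (fst i) (snd i)) (cball (fst j) (snd j))) C"
        "negligible (E - (\<Union>i\<in>C. cball (fst i) (snd i)))"
      by (rule Vitali_covering_theorem_cballs[of K snd E fst, rotated]) (auto simp: K_def)
    define N where "N = E - (\<Union>i\<in>C. cball (fst i) (snd i))"
    define J where "J = (\<lambda>i. {s (fst i - snd i)..s (fst i + snd i)})"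
    have "negligible (s ` N)"
    proof (rule negligible_locally_Lipschitz_image)
      show "negligible N" using C(4) by (simp add: N_def)
      show "\<exists>T B. open T \<and> x \<in> T \<and> (\<forall>y\<in>N \<inter> T. norm (s y - s x) \<le> B * norm (y - x))" for x
      proof (intro exI[of _ UNIV] exI[of _ L] conjI ballI)
        fix y show "norm (s y - s x) \<le> L * norm (y - x)"
          using lip[of x y] lip[of y x] mono'[of x y] mono'[of y x] by (cases "x \<le> y") auto
      qed auto
    qed simp
    then have null: "s ` N \<in> null_sets lebesgue" by (simp add: negligible_iff_null_sets)
    have disj: "disjoint_family_on J C"
      unfolding disjoint_family_on_def
    proof (intro ballI impI)
      fix i j assume ij: "i \<in> C" "j \<in> C" "i \<noteq> j"
      have pos: "0 < snd i" "0 < snd j" using ij C(2) by (auto simp: K_def)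
      have "disjnt (cball (fst i) (snd i)) (cball (fst j) (snd j))"
        using C(3) ij unfolding pairwise_def by blast
      then have "{fst i - snd i..fst i + snd i} \<inter> {fst j - snd j..fst j + snd j} = {}"
        by (simp add: disjnt_def cball_eq_atLeastAtMost)
      then have "fst i + snd i < fst j - snd j \<or> fst j + snd j < fst i - snd i"
        using pos by (auto simp: Int_atLeastAtMost) 
      then show "J i \<inter> J j = {}" using mono by (fastforce simp: J_def)
    qed
    have disjc: "disjoint_family_on (\<lambda>i. cball (fst i) (snd i)) C"
      using C(3) by (auto simp: pairwise_def disjnt_def disjoint_family_on_def)
    have "s ` E \<subseteq> (\<Union>i\<in>C. J i) \<union> s ` N"
      by (force simp: N_def J_def cball_eq_atLeastAtMost intro!: mono')
    then have "outer_measure_of lebesgue (s ` E) \<le> outer_measure_of lebesgue ((\<Union>i\<in>C. J i) \<union> s ` N)"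
      by (rule outer_measure_of_mono)
    also have "\<dots> = emeasure lebesgue ((\<Union>i\<in>C. J i) \<union> s ` N)"
      using null C(1) by (intro outer_measure_of_eq sets.Un sets.countable_UN') (auto simp: J_def)
    also have "\<dots> = emeasure lebesgue (\<Union>i\<in>C. J i)"
      using null C(1) by (intro emeasure_Un_null_set sets.countable_UN') (auto simp: J_def)
    also have "\<dots> = (\<integral>\<^sup>+i. emeasure lebesgue (J i) \<partial>count_space C)"
      using C(1) disj by (intro emeasure_UN_countable) (auto simp: J_def)
    also have "\<dots> \<le> (\<integral>\<^sup>+i. ennreal \<alpha> * emeasure lebesgue (cball (fst i) (snd i)) \<partial>count_space C)"
    proof (rule nn_integral_mono)
      fix i assume "i \<in> space (count_space C)"
      then have i: "i \<in> K" using C by auto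
      then have "0 < snd i" "s (fst i + snd i) - s (fst i - snd i) \<le> \<alpha> * (2 * snd i)" by (auto simp: K_def)
      then show "emeasure lebesgue (J i) \<le> ennreal \<alpha> * emeasure lebesgue (cball (fst i) (snd i))"
        using mono'[of "fst i - snd i" "fst i + snd i"] \<open>0 \<le> \<alpha>\<close>
        by (simp add: J_def cball_eq_atLeastAtMost ennreal_mult[symmetric])
    qed
    also have "\<dots> = ennreal \<alpha> * emeasure lebesgue (\<Union>i\<in>C. cball (fst i) (snd i))"
      using C(1) disjc by (subst emeasure_UN_countable) (auto intro!: nn_integral_cmult)
    also have "\<dots> \<le> ennreal \<alpha> * emeasure lebesgue U"
      using C(2) U by (intro mult_left_mono emeasure_mono) (fastforce simp: K_def)+
    finally show ?thesis .
  qed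
  obtain A where A: "A \<in> sets lebesgue" "E \<subseteq> A" "outer_measure_of lebesgue E = emeasure lebesgue A"
    using outer_measure_of_attain[of E lebesgue] by auto
  have "outer_measure_of lebesgue (s ` E) \<le> ennreal \<alpha> * emeasure lebesgue A"
  proof (rule ennreal_le_epsilon)
    fix e :: real assume "0 < e"
    define e' where "e' = e / (\<alpha> + 1)"
    have e': "0 < e'" "\<alpha> * e' \<le> e" using \<open>0 < e\<close> \<open>0 \<le> \<alpha>\<close> by (auto simp: e'_def field_simps)
    obtain U where U: "open U" "A \<subseteq> U" "emeasure lebesgue (U - A) < ennreal e'"
      using sets_lebesgue_outer_open[OF A(1) e'(1)] by metis
    have "emeasure lebesgue U \<le> emeasure lebesgue A + emeasure lebesgue (U - A)"
    proof -
      have "emeasure lebesgue U \<le> emeasure lebesgue (A \<union> (U - A))"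
        using A U by (intro emeasure_mono) auto
      also have "\<dots> \<le> emeasure lebesgue A + emeasure lebesgue (U - A)"
        using A U by (intro emeasure_subadditive) auto
      finally show ?thesis .
    qed
    also have "\<dots> \<le> emeasure lebesgue A + ennreal e'" using U by (intro add_left_mono) auto
    finally have "ennreal \<alpha> * emeasure lebesgue U \<le> ennreal \<alpha> * (emeasure lebesgue A + ennreal e')"
      by (rule mult_left_mono) simp
    also have "\<dots> = ennreal \<alpha> * emeasure lebesgue A + ennreal (\<alpha> * e')"
      using \<open>0 \<le> \<alpha>\<close> e' by (simp add: distrib_left ennreal_mult)
    also have "\<dots> \<le> ennreal \<alpha> * emeasure lebesgue A + ennreal e"
      using e' by (intro add_left_mono ennreal_leI)
    finally show "outer_measure_of lebesgue (s ` E) \<le> ennreal \<alpha> * emeasure lebesgue A + ennreal e"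
      using on_open[of U] U A by (meson order.trans)
  qed
  then show ?thesis by (simp add: A(3))
qed

text \<open>Apply the previous lemma to \<open>s\<close> on \<open>E\<close> with \<open>\<alpha>\<close> and to the inverse of \<open>s\<close> on \<open>s ` E\<close> with \<open>1 / \<beta>\<close>. Together
  they give \<open>|E| \<le> (\<alpha> / \<beta>) |E|\<close>, and \<open>|E|\<close> is finite.\<close>

lemma oscillating_slopes_negligible:
  fixes s :: "real \<Rightarrow> real"
  assumes bij: "bij s" and "0 < c"
    and low: "\<And>a b. a \<le> b \<Longrightarrow> c * (b - a) \<le> s b - s a"
    and up: "\<And>a b. a \<le> b \<Longrightarrow> s b - s a \<le> C * (b - a)"
    and \<alpha>\<beta>: "0 < \<alpha>" "\<alpha> < \<beta>" and bdd: "bounded E"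
    and below: "\<And>x d. x \<in> E \<Longrightarrow> 0 < d \<Longrightarrow>
        \<exists>a b. a < b \<and> a \<le> x \<and> x \<le> b \<and> b - a < d \<and> s b - s a \<le> \<alpha> * (b - a)"
    and above: "\<And>x d. x \<in> E \<Longrightarrow> 0 < d \<Longrightarrow>
        \<exists>a b. a < b \<and> a \<le> x \<and> x \<le> b \<and> b - a < d \<and> \<beta> * (b - a) \<le> s b - s a"
  shows "negligible E"
proof -
  have strict: "s a < s b" if "a < b" for a b
    using low[of a b] that \<open>0 < c\<close> by (smt (verit) mult_pos_pos)
  define t where "t = inv s"
  have ts: "t (s x) = x" "s (t y) = y" for x y
    using bij by (auto simp: t_def bij_def surj_f_inv_f)
  have t_strict: "t a < t b" if "a < b" for a b
  proof (rule ccontr)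
    assume "\<not> t a < t b"
    then have "s (t b) \<le> s (t a)" using strict[of "t b" "t a"] by (cases "t b = t a") auto
    then show False using that ts by simp
  qed
  have C: "0 < C" using up[of 0 1] strict[of 0 1] by auto
  have 1: "outer_measure_of lebesgue (s ` E) \<le> ennreal \<alpha> * outer_measure_of lebesgue E"
    using strict up below \<alpha>\<beta> by (intro outer_measure_image_le[of s C]) auto
  have 2: "outer_measure_of lebesgue (t ` s ` E) \<le> ennreal (1 / \<beta>) * outer_measure_of lebesgue (s ` E)"
  proof (rule outer_measure_image_le[of t "1 / c"])
    fix a b :: real assume "a \<le> b"
    then have "t a \<le> t b" using t_strict[of a b] by (cases "a = b") auto
    then show "t b - t a \<le> 1 / c * (b - a)"
      using low[of "t a" "t b"] ts \<open>0 < c\<close> by (simp add: field_simps)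
  next
    fix y d assume "y \<in> s ` E" "0 < (d::real)"
    then obtain x where x: "x \<in> E" "y = s x" by auto
    moreover have "0 < d / C" using C \<open>0 < d\<close> by simp
    ultimately obtain a b where ab: "a < b" "a \<le> x" "x \<le> b" "b - a < d / C" "\<beta> * (b - a) \<le> s b - s a"
      using above[of x "d / C"] by blast
    have "s b - s a < d" using up[of a b] ab C by (simp add: field_simps)
    moreover have "t (s b) - t (s a) \<le> 1 / \<beta> * (s b - s a)" using ab \<alpha>\<beta> ts by (simp add: field_simps)
    moreover have "s a \<le> y" "y \<le> s b"
      using strict[of a x] strict[of x b] x ab by (auto simp: le_less)
    ultimately show "\<exists>a b. a < b \<and> a \<le> y \<and> y \<le> b \<and> b - a < d \<and> t b - t a \<le> 1 / \<beta> * (b - a)"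
      using strict[OF ab(1)] by (intro exI[of _ "s a"] exI[of _ "s b"] conjI)
  qed (use t_strict \<alpha>\<beta> in auto)
  have tsE: "t ` s ` E = E" by (simp add: image_image ts)
  define M where "M = outer_measure_of lebesgue E"
  have M_le: "M \<le> ennreal (1 / \<beta>) * (ennreal \<alpha> * M)"
    unfolding M_def by (rule order.trans[OF 2[unfolded tsE] mult_left_mono[OF 1]]) simp
  have "M < \<infinity>"
  proof -
    obtain k where "\<forall>x\<in>E. norm x \<le> k" using bdd by (auto simp: bounded_iff)
    then have "E \<subseteq> cball 0 k" by auto
    then have "M \<le> emeasure lebesgue (cball (0::real) k)"
      using outer_measure_of_mono[of E "cball 0 k" lebesgue] by (simp add: M_def)
    also have "\<dots> < \<infinity>" using emeasure_bounded_finite[of "cball (0::real) k"] by simp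
    finally show ?thesis .
  qed
  then have "M = 0"
  proof (cases M)
    case (real m)
    have "ennreal (1 / \<beta> * (\<alpha> * m)) = ennreal (1 / \<beta>) * ennreal (\<alpha> * m)"
      using real \<alpha>\<beta> by (intro ennreal_mult) auto
    also have "ennreal (\<alpha> * m) = ennreal \<alpha> * ennreal m"
      using real \<alpha>\<beta> by (intro ennreal_mult) auto
    finally have "ennreal m \<le> ennreal (1 / \<beta> * (\<alpha> * m))"
      using M_le real(2) by (simp only:)
    moreover have nn: "0 \<le> 1 / \<beta> * (\<alpha> * m)" using real \<alpha>\<beta> by simp
    ultimately have "m \<le> 1 / \<beta> * (\<alpha> * m)" unfolding ennreal_le_iff[OF nn] by simp
    then have "m * (\<beta> - \<alpha>) \<le> 0" using \<alpha>\<beta> by (simp add: field_simps)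
    then show ?thesis using real \<alpha>\<beta> by (simp add: mult_le_0_iff)
  qed auto
  then obtain A where "A \<in> sets lebesgue" "E \<subseteq> A" "emeasure lebesgue A = 0"
    using outer_measure_of_attain[of E lebesgue] by (auto simp: M_def)
  then show ?thesis by (meson negligible_iff_null_sets negligible_subset null_setsI)
qed

text \<open>Where the derivative does not exist, the lower and upper limits of the difference quotient are separated
  by two rationals, which places the point in one of countably many sets of oscillating slopes.\<close>

lemma bilipschitz_differentiable_ae:
  fixes s :: "real \<Rightarrow> real"
  assumes bij: "bij s" and "0 < c"
    and low: "\<And>a b. a \<le> b \<Longrightarrow> c * (b - a) \<le> s b - s a"
    and up: "\<And>a b. a \<le> b \<Longrightarrow> s b - s a \<le> C * (b - a)"
  shows "negligible {x. \<not> s differentiable (at x)}"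
proof -
  define Q where "Q = (\<lambda>x h. (s (x + h) - s x) / h)"
  have Q_bd: "c \<le> Q x h" "Q x h \<le> C" if "h \<noteq> 0" for x h
    using low[of x "x + h"] up[of x "x + h"] low[of "x + h" x] up[of "x + h" x] that
    by (cases "0 < h"; simp add: Q_def field_simps)+
  define E where "E = (\<lambda>\<alpha> \<beta> (k::nat). {x. \<bar>x\<bar> \<le> real k \<and> (\<exists>\<^sub>F h in at 0. Q x h < \<alpha>) \<and> (\<exists>\<^sub>F h in at 0. \<beta> < Q x h)})"
  have interval: "\<exists>a b. a < b \<and> a \<le> x \<and> x \<le> b \<and> b - a < d \<and> s b - s a = Q x h * (b - a)"
    if "h \<noteq> 0" "\<bar>h\<bar> < d" for x h d
  proof (cases "0 < h")
    case True then show ?thesis using that by (intro exI[of _ x] exI[of _ "x + h"]) (auto simp: Q_def)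
  next
    case False then show ?thesis using that
      by (intro exI[of _ "x + h"] exI[of _ x]) (auto simp: Q_def field_simps)
  qed
  have small: "\<exists>h. h \<noteq> 0 \<and> \<bar>h\<bar> < d \<and> P h" if "\<exists>\<^sub>F h in at (0::real). P h" "0 < d" for P and d :: real
    using that unfolding frequently_def eventually_at by (auto simp: dist_real_def)
  have "negligible (E \<alpha> \<beta> k)" if "0 < \<alpha>" "\<alpha> < \<beta>" for \<alpha> \<beta> k
  proof (rule oscillating_slopes_negligible[OF bij \<open>0 < c\<close> low up that])
    show "bounded (E \<alpha> \<beta> k)" by (auto simp: bounded_iff E_def)
  next
    fix x d assume "x \<in> E \<alpha> \<beta> k" "0 < (d::real)"
    then obtain h where h: "h \<noteq> 0" "\<bar>h\<bar> < d" "Q x h < \<alpha>" using small[of "\<lambda>h. Q x h < \<alpha>" d] by (auto simp: E_def)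
    then obtain a b where "a < b" "a \<le> x" "x \<le> b" "b - a < d" "s b - s a = Q x h * (b - a)"
      using interval by blast
    then show "\<exists>a b. a < b \<and> a \<le> x \<and> x \<le> b \<and> b - a < d \<and> s b - s a \<le> \<alpha> * (b - a)"
      using h by (intro exI[of _ a] exI[of _ b]) (auto intro!: mult_right_mono)
  next
    fix x d assume "x \<in> E \<alpha> \<beta> k" "0 < (d::real)"
    then obtain h where h: "h \<noteq> 0" "\<bar>h\<bar> < d" "\<beta> < Q x h" using small[of "\<lambda>h. \<beta> < Q x h" d] by (auto simp: E_def)
    then obtain a b where "a < b" "a \<le> x" "x \<le> b" "b - a < d" "s b - s a = Q x h * (b - a)"
      using interval by blast
    then show "\<exists>a b. a < b \<and> a \<le> x \<and> x \<le> b \<and> b - a < d \<and> \<beta> * (b - a) \<le> s b - s a"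
      using h by (intro exI[of _ a] exI[of _ b]) (auto intro!: mult_right_mono)
  qed
  then have "negligible (\<Union>(\<alpha>, \<beta>, k)\<in>{(\<alpha>::rat, \<beta>::rat, k::nat). 0 < \<alpha> \<and> \<alpha> < \<beta>}. E (of_rat \<alpha>) (of_rat \<beta>) k)"
    by (intro negligible_countable_Union countable_image)
       (auto simp: of_rat_less intro!: countable_subset[OF subset_UNIV] uncountable_def)
  moreover have "{x. \<not> s differentiable (at x)} \<subseteq>
      (\<Union>(\<alpha>, \<beta>, k)\<in>{(\<alpha>::rat, \<beta>::rat, k::nat). 0 < \<alpha> \<and> \<alpha> < \<beta>}. E (of_rat \<alpha>) (of_rat \<beta>) k)"
  proof
    fix x assume "x \<in> {x. \<not> s differentiable (at x)}"
    then have nd: "\<not> s differentiable (at x)" by simp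
    define q where "q = (\<lambda>h. ereal (Q x h))"
    have ev: "\<forall>\<^sub>F h in at 0. ereal c \<le> q h \<and> q h \<le> ereal C"
      using Q_bd by (auto simp: q_def eventually_at_filter)
    have lo: "ereal c \<le> Liminf (at 0) q" using ev by (intro Liminf_bounded) (auto elim: eventually_mono)
    have hi: "Limsup (at 0) q \<le> ereal C" using ev by (intro Limsup_bounded) (auto elim: eventually_mono)
    have le: "Liminf (at 0) q \<le> Limsup (at 0) q" by (intro Liminf_le_Limsup) simp
    have "Liminf (at 0) q \<noteq> Limsup (at 0) q"
    proof
      assume eq: "Liminf (at 0) q = Limsup (at 0) q"
      define A where "A = Limsup (at 0) q"
      have "ereal c \<le> A" "A \<le> ereal C" using lo hi eq by (simp_all add: A_def)
      then obtain D where "A = ereal D" by (cases A) auto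
      then have D: "Liminf (at 0) q = ereal D" using eq A_def by simp
      have "(q \<longlongrightarrow> ereal D) (at 0)" using D eq by (intro Liminf_eq_Limsup) auto
      then have "(Q x \<longlongrightarrow> D) (at 0)" by (simp add: q_def)
      then have "(s has_real_derivative D) (at x)" by (simp add: DERIV_def Q_def)
      then show False using nd real_differentiable_def by blast
    qed
    then have lt: "Liminf (at 0) q < Limsup (at 0) q" using le by simp
    obtain \<beta>' where \<beta>': "Liminf (at 0) q < ereal (of_rat \<beta>')" "ereal (of_rat \<beta>') < Limsup (at 0) q"
      using ereal_dense3[OF lt] by (auto)
    obtain \<alpha>' where \<alpha>': "Liminf (at 0) q < ereal (of_rat \<alpha>')" "ereal (of_rat \<alpha>') < ereal (of_rat \<beta>')"
      using ereal_dense3[OF \<beta>'(1)] by (auto)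
    have "0 < (of_rat \<alpha>' :: real)" using lo \<alpha>'(1) \<open>0 < c\<close>
      by (metis ereal_less_eq(3) less_ereal.simps(1) order.strict_trans1 order.strict_trans)
    moreover have "\<exists>\<^sub>F h in at 0. Q x h < of_rat \<alpha>'"
    proof (rule ccontr)
      assume "\<not> ?thesis"
      then have "\<forall>\<^sub>F h in at 0. ereal (of_rat \<alpha>') \<le> q h" by (simp add: not_frequently q_def not_less)
      then have "ereal (of_rat \<alpha>') \<le> Liminf (at 0) q" by (rule Liminf_bounded)
      then show False using \<alpha>' by simp
    qed
    moreover have "\<exists>\<^sub>F h in at 0. of_rat \<beta>' < Q x h"
    proof (rule ccontr)
      assume "\<not> ?thesis"
      then have "\<forall>\<^sub>F h in at 0. q h \<le> ereal (of_rat \<beta>')" by (simp add: not_frequently q_def not_less)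
      then have "Limsup (at 0) q \<le> ereal (of_rat \<beta>')" by (rule Limsup_bounded)
      then show False using \<beta>' by simp
    qed
    moreover obtain k :: nat where "\<bar>x\<bar> \<le> real k" using real_arch_simple by blast
    ultimately have "x \<in> E (of_rat \<alpha>') (of_rat \<beta>') k" "0 < \<alpha>'" "\<alpha>' < \<beta>'"
      using \<alpha>'(2) by (auto simp: E_def of_rat_less)
    then show "x \<in> (\<Union>(\<alpha>, \<beta>, k)\<in>{(\<alpha>::rat, \<beta>::rat, k::nat). 0 < \<alpha> \<and> \<alpha> < \<beta>}. E (of_rat \<alpha>) (of_rat \<beta>) k)"
      by blast
  qed
  ultimately show ?thesis by (rule negligible_subset)
qed

section \<open>Polar decomposition of radial measures\<close>

text \<open>The uniform law on the unit sphere, as the law of the direction of a random point of the ball.\<close>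

definition angular_measure :: "'a::euclidean_space measure" where
  "angular_measure = distr (uniform_measure lborel (cball 0 1)) borel sgn"

lemma borel_measurable_sgn [measurable]:
  "(sgn :: 'a::euclidean_space \<Rightarrow> 'a) \<in> borel_measurable borel"
  unfolding sgn_div_norm[abs_def] by measurable

lemma sgn_vimage_borel [measurable]:
  "A \<in> sets borel \<Longrightarrow> (sgn :: 'a::euclidean_space \<Rightarrow> 'a) -` A \<in> sets borel"
  using measurable_sets_borel[OF borel_measurable_sgn, of A] by simp

lemma norm_vimage_borel [measurable]:
  "B \<in> sets borel \<Longrightarrow> (norm :: 'a::euclidean_space \<Rightarrow> real) -` B \<in> sets borel"
  by (rule measurable_sets_borel[OF borel_measurable_norm]) simp

lemma unit_ball_measure:
  "0 < emeasure lborel (cball (0::'a::euclidean_space) 1)"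
  "emeasure lborel (cball (0::'a::euclidean_space) 1) < \<infinity>"
proof -
  have "emeasure lborel (cball (0::'a) 1) = ennreal (measure lborel (cball (0::'a) 1))"
    by (intro emeasure_eq_ennreal_measure) (use emeasure_bounded_finite[of "cball (0::'a) 1"] in auto)
  moreover have "0 < measure lborel (cball (0::'a) 1)" using content_cball_pos[of 1 "0::'a"] by simp
  ultimately show "0 < emeasure lborel (cball (0::'a) 1)" by simp
  show "emeasure lborel (cball (0::'a) 1) < \<infinity>" using emeasure_bounded_finite[of "cball (0::'a) 1"] by simp
qed

lemma prob_space_angular_measure: "prob_space (angular_measure :: 'a::euclidean_space measure)"
  unfolding angular_measure_def
  by (intro prob_space.prob_space_distr prob_space_uniform_measure)
     (use unit_ball_measure[where 'a='a] in auto)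

lemma sets_angular_measure [simp, measurable_cong]: "sets angular_measure = sets borel"
  by (simp add: angular_measure_def)

lemma emeasure_angular_measure:
  assumes [measurable]: "A \<in> sets borel"
  shows "emeasure (angular_measure :: 'a::euclidean_space measure) A
    * emeasure lborel (cball (0::'a) 1) = emeasure lborel {x \<in> cball 0 1. sgn x \<in> A}"
proof -
  have "emeasure (angular_measure :: 'a measure) A
      = emeasure lborel (cball (0::'a) 1 \<inter> sgn -` A) / emeasure lborel (cball (0::'a) 1)"
    unfolding angular_measure_def
    by (subst emeasure_distr) (auto simp: sgn_vimage_borel intro!: emeasure_uniform_measure)
  moreover have "cball 0 1 \<inter> sgn -` A = {x \<in> cball 0 1. sgn x \<in> A}" by auto
  ultimately show ?thesis
    using unit_ball_measure[where 'a='a]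
    by (simp add: ennreal_divide_times ennreal_mult_divide_eq flip: ennreal_times_divide)
qed

lemma cball_0_1_eq: "cball 0 1 = {x::'a::euclidean_space. norm x \<le> 1}"
  by auto

lemma emeasure_lborel_cone_cball:
  assumes [measurable]: "A \<in> sets borel" and "0 < t"
  shows "emeasure lborel {x::'a::euclidean_space. norm x \<le> t \<and> sgn x \<in> A}
    = ennreal (t ^ DIM('a)) * emeasure lborel {x \<in> cball 0 1. sgn x \<in> A}"
proof -
  have "emeasure lborel {x::'a. norm x \<le> t \<and> sgn x \<in> A} =
    emeasure (density (distr lborel borel (\<lambda>x::'a. 0 + t *\<^sub>R x)) (\<lambda>_. \<bar>t\<bar>^DIM('a))) {x::'a. norm x \<le> t \<and> sgn x \<in> A}"
    using lborel_affine[of t "0::'a"] \<open>0 < t\<close> by simp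
  also have "\<dots> = ennreal (t ^ DIM('a)) * emeasure lborel ((\<lambda>x. 0 + t *\<^sub>R x) -` {x::'a. norm x \<le> t \<and> sgn x \<in> A})"
    using \<open>0 < t\<close> by (simp add: emeasure_density_const emeasure_distr)
  also have "(\<lambda>x. 0 + t *\<^sub>R x) -` {x::'a. norm x \<le> t \<and> sgn x \<in> A} = {x \<in> cball 0 1. sgn x \<in> A}"
    using \<open>0 < t\<close> by (auto simp: sgn_scaleR)
  finally show ?thesis .
qed

lemma emeasure_lborel_cone_cball_nonpos: "emeasure lborel {x::'a::euclidean_space. norm x \<le> t \<and> sgn x \<in> A} = 0"
  if "t \<le> 0"
proof -
  have "emeasure lborel {x::'a. norm x \<le> t \<and> sgn x \<in> A} \<le> emeasure lborel {0::'a}"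
    using that by (intro emeasure_mono) (auto dest: order.trans)
  then show ?thesis by simp
qed

text \<open>Direction and norm are independent for Lebesgue measure. Both sides are measures in \<open>B\<close>, and on the
  half-lines \<open>{..t}\<close> they agree by scaling.\<close>

lemma emeasure_lborel_radial_cone:
  assumes [measurable]: "A \<in> sets borel" "B \<in> sets borel"
  shows "emeasure lborel {x::'a::euclidean_space. norm x \<in> B \<and> sgn x \<in> A}
    = emeasure angular_measure A * emeasure lborel {x::'a. norm x \<in> B}"
proof -
  define a where "a = emeasure (angular_measure :: 'a measure) A"
  define M where "M = distr (density lborel (indicator {x::'a. sgn x \<in> A})) borel norm"
  define N where "N = scale_measure a (distr lborel borel (norm :: 'a \<Rightarrow> real))"
  have M: "emeasure M B = emeasure lborel {x::'a. norm x \<in> B \<and> sgn x \<in> A}" if [measurable]: "B \<in> sets borel" for B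
  proof -
    have "emeasure M B = (\<integral>\<^sup>+x. indicator {x::'a. sgn x \<in> A} x * indicator (norm -` B) x \<partial>lborel)"
      unfolding M_def by (simp add: emeasure_distr emeasure_density norm_vimage_borel)
    also have "\<dots> = (\<integral>\<^sup>+x. indicator {x::'a. norm x \<in> B \<and> sgn x \<in> A} x \<partial>lborel)"
      by (intro nn_integral_cong) (auto simp: indicator_def)
    finally show ?thesis by simp
  qed
  have N: "emeasure N B = a * emeasure lborel {x::'a. norm x \<in> B}" if [measurable]: "B \<in> sets borel" for B
    unfolding N_def by (simp add: emeasure_distr vimage_def)
  have eq: "emeasure M {..t} = emeasure N {..t}" for t
  proof (cases "0 < t")
    case True
    have "emeasure N {..t} = ennreal (t ^ DIM('a)) * (a * emeasure lborel (cball (0::'a) 1))"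
      using emeasure_lborel_cone_cball[of "UNIV :: 'a set" t] True
      by (simp add: N ac_simps cball_0_1_eq)
    then show ?thesis
      using emeasure_lborel_cone_cball[of A t] True
      by (simp add: M a_def emeasure_angular_measure)
  next
    case False
    then show ?thesis using emeasure_lborel_cone_cball_nonpos[of t A] emeasure_lborel_cone_cball_nonpos[of t "UNIV :: 'a set"] by (simp add: M N)
  qed
  have "a \<le> 1"
    unfolding a_def using prob_space.emeasure_le_1[OF prob_space_angular_measure] by blast
  have "M = N"
  proof (rule measure_eqI_generator_eq)
    show "Int_stable (range (\<lambda>t::real. {..t}))" by (auto simp: Int_stable_def)
    show "range (\<lambda>i::nat. {..real i}) \<subseteq> range (\<lambda>t::real. {..t})" by auto
    show "(\<Union>i::nat. {..real i}) = UNIV" using real_arch_simple by auto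
    show "emeasure M {..real i} \<noteq> \<infinity>" for i
    proof -
      have "emeasure M {..real i} \<le> emeasure lborel (cball (0::'a) (real i))"
        unfolding M[of "{..real i}", simplified] by (intro emeasure_mono) auto
      then show ?thesis using emeasure_bounded_finite[of "cball (0::'a) (real i)"] by (auto simp: top_unique)
    qed
    show "sets M = sigma_sets UNIV (range (\<lambda>t::real. {..t}))" "sets N = sigma_sets UNIV (range (\<lambda>t::real. {..t}))"
      by (simp_all add: M_def N_def borel_eq_atMost)
  qed (use eq in auto)
  then show ?thesis using M[of B] N[of B] by (simp add: a_def)
qed

text \<open>A radial Lebesgue set differs by a null set from a radial Borel set: it contains, up to a null set, a
  countable union of compact sets, whose norms form a Borel set of radii.\<close>

lemma emeasure_lebesgue_radial_cone:
  fixes E :: "'a::euclidean_space set"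
  assumes [measurable]: "A \<in> sets borel" and E: "E \<in> sets lebesgue"
    and radial: "\<And>x y. norm x = norm y \<Longrightarrow> x \<in> E \<Longrightarrow> y \<in> E"
  shows "emeasure lebesgue {x \<in> E. sgn x \<in> A} = emeasure angular_measure A * emeasure lebesgue E"
proof -
  obtain C T where CT: "fsigma C" "T \<in> null_sets lebesgue" "C \<union> T = E" "disjnt C T"
    using lebesgue_set_almost_fsigma[OF E] .
  obtain F :: "nat \<Rightarrow> 'a set" where F: "range F \<subseteq> Collect compact" "C = \<Union>(F ` UNIV)"
    using CT(1) unfolding fsigma_Union_compact by blast
  define B where "B = (\<Union>i. norm ` F i)"
  have "norm ` F i \<in> sets borel" for i
  proof -
    have "compact (F i)" using F by auto
    then have "compact (norm ` F i)" by (intro compact_continuous_image continuous_intros)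
    then show ?thesis by (intro borel_closed compact_imp_closed)
  qed
  then have [measurable]: "B \<in> sets borel" unfolding B_def by auto
  have sub: "x \<in> E" if "norm x \<in> B" for x
  proof -
    obtain i y where y: "y \<in> F i" "norm x = norm y" using \<open>norm x \<in> B\<close> by (auto simp: B_def)
    then have "y \<in> E" using CT(3) F(2) by auto
    then show ?thesis using radial y(2) by metis
  qed
  have diff: "norm x \<in> B" if "x \<in> E" "x \<notin> T" for x
  proof -
    have "x \<in> C" using that CT(3) by auto
    then show ?thesis by (auto simp: B_def F(2))
  qed
  have ae: "AE x in lebesgue. x \<in> E \<longleftrightarrow> norm x \<in> B"
    using AE_not_in[OF CT(2)] by eventually_elim (use sub diff in auto)
  have S: "{x. sgn x \<in> A} \<in> sets (lebesgue :: 'a measure)"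
    by (intro sets_completionI_sets) measurable
  have E1: "{x. norm x \<in> B \<and> sgn x \<in> A} \<in> sets (lebesgue :: 'a measure)"
    by (intro sets_completionI_sets) measurable
  have E2: "{x. norm x \<in> B} \<in> sets (lebesgue :: 'a measure)"
    by (intro sets_completionI_sets) measurable
  have E3: "{x \<in> E. sgn x \<in> A} \<in> sets lebesgue"
    using sets.Int[OF E S] by (simp add: Int_def)
  have "AE x in lebesgue. x \<in> {x \<in> E. sgn x \<in> A} \<longleftrightarrow> x \<in> {x. norm x \<in> B \<and> sgn x \<in> A}"
    using ae by eventually_elim simp
  then have "emeasure lebesgue {x \<in> E. sgn x \<in> A} = emeasure lebesgue {x. norm x \<in> B \<and> sgn x \<in> A}"
    by (rule emeasure_eq_AE[OF _ E3 E1])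
  also have "\<dots> = emeasure lborel {x::'a. norm x \<in> B \<and> sgn x \<in> A}" by simp
  also have "\<dots> = emeasure angular_measure A * emeasure lborel {x::'a. norm x \<in> B}"
    by (rule emeasure_lborel_radial_cone) auto
  also have "emeasure lborel {x::'a. norm x \<in> B} = emeasure lebesgue {x::'a. norm x \<in> B}" by simp
  also have "\<dots> = emeasure lebesgue E"
  proof (rule emeasure_eq_AE[OF _ E2 E])
    show "AE x in lebesgue. x \<in> {x. norm x \<in> B} \<longleftrightarrow> x \<in> E" using ae by eventually_elim simp
  qed
  finally show ?thesis .
qed

text \<open>A radial Lebesgue measurable \<open>h\<close> is a function of the norm, but that function of the radius need not be
  Borel. It is measurable for the \<sigma>-algebra \<open>R\<close> of those sets of radii whose preimage under the norm is
  Lebesgue measurable, and this is enough to transport the identity for sets to integrals.\<close>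

lemma nn_integral_radial_cone:
  fixes h :: "'a::euclidean_space \<Rightarrow> ennreal"
  assumes [measurable]: "A \<in> sets borel" and h: "h \<in> borel_measurable lebesgue"
    and radial: "radially_symmetric h"
  shows "(\<integral>\<^sup>+x. h x * indicator A (sgn x) \<partial>lebesgue) = emeasure angular_measure A * (\<integral>\<^sup>+x. h x \<partial>lebesgue)"
proof -
  define R where "R = sigma UNIV {K::real set. (norm :: 'a \<Rightarrow> real) -` K \<in> sets lebesgue}"
  have "sigma_algebra UNIV {K::real set. (norm :: 'a \<Rightarrow> real) -` K \<in> sets lebesgue}"
    unfolding sigma_algebra_iff2
  proof (intro conjI ballI allI impI)
    fix K :: "real set" assume "K \<in> {K. (norm :: 'a \<Rightarrow> real) -` K \<in> sets lebesgue}"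
    then have "space lebesgue - (norm :: 'a \<Rightarrow> real) -` K \<in> sets lebesgue" by (intro sets.Diff sets.top) auto
    moreover have "(norm :: 'a \<Rightarrow> real) -` (UNIV - K) = space lebesgue - norm -` K" by auto
    ultimately show "UNIV - K \<in> {K. (norm :: 'a \<Rightarrow> real) -` K \<in> sets lebesgue}" by (simp only: mem_Collect_eq)
  qed (auto simp: vimage_Union vimage_UN)
  then have sets_R: "sets R = {K. (norm :: 'a \<Rightarrow> real) -` K \<in> sets lebesgue}"
    by (simp add: R_def sigma_algebra.sigma_sets_eq)
  have space_R: "space R = UNIV" by (simp add: R_def)
  have norm_R: "(norm :: 'a \<Rightarrow> real) \<in> measurable lebesgue R"
    by (rule measurableI) (auto simp: space_R sets_R)
  obtain e :: 'a where "e \<in> Basis" using nonempty_Basis ex_in_conv by metis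
  then have e: "norm e = 1" by simp
  define \<eta> where "\<eta> = (\<lambda>r. h (r *\<^sub>R e))"
  have h_eq: "h x = \<eta> (norm x)" for x
    using radial[unfolded radially_symmetric_def, rule_format, of x "norm x *\<^sub>R e"] e
    by (simp add: \<eta>_def)
  have \<eta>: "\<eta> \<in> borel_measurable R"
  proof (rule measurableI)
    fix B :: "ennreal set" assume "B \<in> sets borel"
    then have "h -` B \<inter> space lebesgue \<in> sets lebesgue" using h by (rule measurable_sets[rotated])
    moreover have "(norm :: 'a \<Rightarrow> real) -` (\<eta> -` B) = h -` B" by (auto simp: h_eq)
    ultimately show "\<eta> -` B \<inter> space R \<in> sets R" by (simp add: sets_R space_R)
  qed simp
  define I where "I = (\<lambda>x::'a. indicator A (sgn x) :: ennreal)"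
  have I: "I \<in> borel_measurable lebesgue"
    unfolding I_def by (intro measurable_completion) simp
  have "distr (density lebesgue I) R norm = scale_measure (emeasure angular_measure A) (distr lebesgue R (norm :: 'a \<Rightarrow> real))"
  proof (rule measure_eqI)
    fix K assume "K \<in> sets (distr (density lebesgue I) R norm)"
    then have K: "(norm :: 'a \<Rightarrow> real) -` K \<in> sets lebesgue" "K \<in> sets R" by (auto simp: sets_R)
    have "emeasure (distr (density lebesgue I) R norm) K = (\<integral>\<^sup>+x. I x * indicator (norm -` K) x \<partial>lebesgue)"
      using norm_R K I by (simp add: emeasure_distr emeasure_density)
    also have "\<dots> = (\<integral>\<^sup>+x. indicator {x \<in> norm -` K. sgn x \<in> A} x \<partial>lebesgue)"
      by (intro nn_integral_cong) (auto simp: indicator_def I_def)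
    also have "\<dots> = emeasure lebesgue {x \<in> (norm :: 'a \<Rightarrow> real) -` K. sgn x \<in> A}"
    proof (rule nn_integral_indicator)
      have "{x. sgn x \<in> A} \<in> sets (lebesgue :: 'a measure)"
        by (intro sets_completionI_sets) measurable
      from sets.Int[OF K(1) this] show "{x \<in> (norm :: 'a \<Rightarrow> real) -` K. sgn x \<in> A} \<in> sets lebesgue"
        by (simp add: Int_def)
    qed
    also have "\<dots> = emeasure angular_measure A * emeasure lebesgue ((norm :: 'a \<Rightarrow> real) -` K)"
      by (rule emeasure_lebesgue_radial_cone) (use K in auto)
    finally show "emeasure (distr (density lebesgue I) R norm) K
      = emeasure (scale_measure (emeasure angular_measure A) (distr lebesgue R (norm :: 'a \<Rightarrow> real))) K"
      using norm_R K by (simp add: emeasure_distr)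
  qed simp
  note distr_eq = this
  have "(\<integral>\<^sup>+x. h x * indicator A (sgn x) \<partial>lebesgue) = (\<integral>\<^sup>+x. I x * h x \<partial>lebesgue)"
    by (simp add: I_def mult.commute)
  also have "\<dots> = (\<integral>\<^sup>+x. h x \<partial>density lebesgue I)"
    by (rule nn_integral_density[symmetric]) (fact I h)+
  also have "\<dots> = (\<integral>\<^sup>+x. \<eta> (norm (x::'a)) \<partial>density lebesgue I)"
    by (simp only: h_eq)
  also have "\<dots> = (\<integral>\<^sup>+r. \<eta> r \<partial>distr (density lebesgue I) R (norm :: 'a \<Rightarrow> real))"
    using norm_R \<eta> by (intro nn_integral_distr[symmetric]) simp_all
  also have "\<dots> = emeasure angular_measure A * (\<integral>\<^sup>+r. \<eta> r \<partial>distr lebesgue R (norm :: 'a \<Rightarrow> real))"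
    unfolding distr_eq using \<eta> by (intro nn_integral_scale_measure) simp
  also have "(\<integral>\<^sup>+r. \<eta> r \<partial>distr lebesgue R (norm :: 'a \<Rightarrow> real)) = (\<integral>\<^sup>+x. \<eta> (norm (x::'a)) \<partial>lebesgue)"
    using norm_R \<eta> by (intro nn_integral_distr) simp_all
  also have "\<dots> = (\<integral>\<^sup>+x. h x \<partial>lebesgue)"
    by (simp only: h_eq)
  finally show ?thesis .
qed

lemma sets_borel_density [simp, measurable_cong]: "sets (borel_density h) = sets borel"
  and space_borel_density [simp]: "space (borel_density h) = UNIV"
  by (simp_all add: borel_density_def)

lemma emeasure_borel_density:
  assumes h: "h \<in> borel_measurable lebesgue" and "A \<in> sets borel"
  shows "emeasure (borel_density h) A = (\<integral>\<^sup>+x. h x * indicator A x \<partial>lebesgue)"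
proof -
  have "(\<lambda>x. x) \<in> measurable (density lebesgue h) borel"
    by (simp add: measurable_completion)
  then show ?thesis using assms unfolding borel_density_def
    by (simp add: emeasure_distr emeasure_density)
qed

lemma nn_integral_borel_density:
  assumes h: "h \<in> borel_measurable lebesgue" and "g \<in> borel_measurable borel"
  shows "(\<integral>\<^sup>+x. g x \<partial>borel_density h) = (\<integral>\<^sup>+x. h x * g x \<partial>lebesgue)"
proof -
  have "(\<lambda>x. x) \<in> measurable (density lebesgue h) borel"
    by (simp add: measurable_completion)
  then show ?thesis using assms unfolding borel_density_def
    by (simp add: nn_integral_distr nn_integral_density measurable_completion)
qed

lemma radial_polar_independence:
  fixes h :: "'a::euclidean_space \<Rightarrow> ennreal" and s :: "real \<Rightarrow> real"
  assumes h: "h \<in> borel_measurable lebesgue" "radially_symmetric h"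
    and prob: "prob_space (borel_density h)" and [measurable]: "s \<in> borel_measurable borel"
  shows "distr (borel_density h) borel (\<lambda>x. s (norm x)) \<Otimes>\<^sub>M angular_measure
    = distr (borel_density h) (borel \<Otimes>\<^sub>M borel) (\<lambda>x. (s (norm x), sgn x))"
proof (rule pair_measure_eqI)
  interpret prob_space "borel_density h" by fact
  interpret D: prob_space "distr (borel_density h) borel (\<lambda>x. s (norm x))" by (rule prob_space_distr) simp
  interpret S: prob_space "angular_measure :: 'a measure" by (rule prob_space_angular_measure)
  show "sigma_finite_measure (distr (borel_density h) borel (\<lambda>x. s (norm x)))" by unfold_locales
  show "sigma_finite_measure (angular_measure :: 'a measure)" by unfold_locales
  fix B A assume "B \<in> sets (distr (borel_density h) borel (\<lambda>x. s (norm x)))" "A \<in> sets (angular_measure :: 'a measure)"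
  then have [measurable]: "B \<in> sets borel" "A \<in> sets borel" by auto
  define g where "g = (\<lambda>x. h x * indicator B (s (norm x)))"
  have g: "g \<in> borel_measurable lebesgue" "radially_symmetric g"
  proof -
    show "g \<in> borel_measurable lebesgue"
      unfolding g_def by (intro borel_measurable_times_ennreal h(1) measurable_completion) simp
    show "radially_symmetric g"
      unfolding radially_symmetric_def g_def
    proof (intro allI impI)
      fix x y :: 'a assume "norm x = norm y"
      moreover from this have "h x = h y" using h(2) unfolding radially_symmetric_def by blast
      ultimately show "h x * indicator B (s (norm x)) = h y * indicator B (s (norm y))" by simp
    qed
  qed
  have "emeasure (distr (borel_density h) (borel \<Otimes>\<^sub>M borel) (\<lambda>x. (s (norm x), sgn x))) (B \<times> A)
      = emeasure (borel_density h) {x. s (norm x) \<in> B \<and> sgn x \<in> A}"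
    by (subst emeasure_distr) (auto intro!: arg_cong[where f="emeasure _"])
  also have "\<dots> = (\<integral>\<^sup>+x. h x * indicator {x. s (norm x) \<in> B \<and> sgn x \<in> A} x \<partial>lebesgue)"
    using h by (intro emeasure_borel_density) auto
  also have "\<dots> = (\<integral>\<^sup>+x. g x * indicator A (sgn x) \<partial>lebesgue)"
    by (intro nn_integral_cong) (auto simp: g_def indicator_def)
  also have "\<dots> = emeasure angular_measure A * (\<integral>\<^sup>+x. g x \<partial>lebesgue)"
    using g by (intro nn_integral_radial_cone) auto
  also have "(\<integral>\<^sup>+x. g x \<partial>lebesgue) = (\<integral>\<^sup>+x. h x * indicator {x. s (norm x) \<in> B} x \<partial>lebesgue)"
    by (intro nn_integral_cong) (auto simp: g_def indicator_def)
  also have "\<dots> = emeasure (borel_density h) {x. s (norm x) \<in> B}"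
    using h by (intro emeasure_borel_density[symmetric]) auto
  also have "\<dots> = emeasure (distr (borel_density h) borel (\<lambda>x. s (norm x))) B"
    by (subst emeasure_distr) (auto intro!: arg_cong[where f="emeasure _"])
  finally show "emeasure (distr (borel_density h) borel (\<lambda>x. s (norm x))) B * emeasure angular_measure A
     = emeasure (distr (borel_density h) (borel \<Otimes>\<^sub>M borel) (\<lambda>x. (s (norm x), sgn x))) (B \<times> A)"
    by (simp add: mult.commute)
next
  show "sets (distr (borel_density h) borel (\<lambda>x. s (norm x)) \<Otimes>\<^sub>M angular_measure)
    = sets (distr (borel_density h) (borel \<Otimes>\<^sub>M borel) (\<lambda>x. (s (norm x), sgn x)))"
    unfolding sets_distr by (intro sets_pair_measure_cong) auto
qed

lemma norm_scaleR_sgn: "norm x *\<^sub>R sgn x = (x::'a::real_normed_vector)"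
  by (cases "x = 0") (auto simp: sgn_div_norm)

text \<open>A radial law is determined by the law of the norm, by independence of the direction. So a map that keeps
  directions and moves the law of the norm correctly moves the whole measure correctly.\<close>

lemma radial_pushforward:
  fixes g h :: "'a::euclidean_space \<Rightarrow> ennreal" and s :: "real \<Rightarrow> real"
  assumes h: "h \<in> borel_measurable lebesgue" "radially_symmetric h" "prob_space (borel_density h)"
    and g: "g \<in> borel_measurable lebesgue" "radially_symmetric g" "prob_space (borel_density g)"
    and s [measurable]: "s \<in> borel_measurable borel"
    and eq: "distr (borel_density h) borel (\<lambda>x. s (norm x)) = distr (borel_density g) borel norm"
  shows "distr (borel_density h) borel (\<lambda>x. s (norm x) *\<^sub>R sgn x) = borel_density g"
proof -
  have "distr (borel_density h) borel (\<lambda>x. s (norm x) *\<^sub>R sgn x)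
      = distr (distr (borel_density h) (borel \<Otimes>\<^sub>M borel) (\<lambda>x. (s (norm x), sgn x))) borel (\<lambda>(r, y). r *\<^sub>R y)"
    by (subst distr_distr) (auto simp: comp_def)
  also have "\<dots> = distr (distr (borel_density g) borel norm \<Otimes>\<^sub>M angular_measure) borel (\<lambda>(r, y). r *\<^sub>R y)"
    by (simp add: radial_polar_independence[OF h s, symmetric] eq)
  also have "\<dots> = distr (distr (borel_density g) (borel \<Otimes>\<^sub>M borel) (\<lambda>x. (norm x, sgn x))) borel (\<lambda>(r, y). r *\<^sub>R y)"
    by (simp add: radial_polar_independence[OF g, of "\<lambda>r. r", simplified])
  also have "\<dots> = distr (borel_density g) borel (\<lambda>x. x)"
    by (subst distr_distr) (auto simp: comp_def norm_scaleR_sgn)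
  also have "\<dots> = borel_density g" by (intro distr_id2) simp
  finally show ?thesis .
qed

text \<open>Integration of radial functions in polar coordinates; it shows that null sets of radii give
  null sets of points.\<close>

lemma distr_lborel_norm:
  "distr lborel borel (norm :: 'a::euclidean_space \<Rightarrow> real) =
    density lborel (\<lambda>r. ennreal (real DIM('a) * measure lborel (cball (0::'a) 1) * r ^ (DIM('a) - 1)) * indicator {0..} r)"
    (is "?M = ?N")
proof -
  define n where "n = DIM('a)"
  define \<omega> where "\<omega> = measure lborel (cball (0::'a) 1)"
  have n: "0 < n" by (simp add: n_def)
  have \<omega>: "emeasure lborel (cball (0::'a) 1) = ennreal \<omega>" "0 \<le> \<omega>"
    unfolding \<omega>_def using unit_ball_measure(2)[where 'a='a]
    by (auto simp: emeasure_eq_ennreal_measure less_top[symmetric])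
  have M: "emeasure ?M {..t} = (if 0 < t then ennreal (\<omega> * t ^ n) else 0)" for t
  proof -
    have "emeasure ?M {..t} = emeasure lborel {x::'a. norm x \<le> t}"
      by (simp add: emeasure_distr vimage_def)
    then show ?thesis
      using emeasure_lborel_cone_cball[of "UNIV :: 'a set" t] emeasure_lborel_cone_cball_nonpos[of t "UNIV :: 'a set"] \<omega>[unfolded cball_0_1_eq]
      by (auto simp: n_def[symmetric] ennreal_mult mult.commute)
  qed
  have N: "emeasure ?N {..t} = (if 0 < t then ennreal (\<omega> * t ^ n) else 0)" for t
  proof (cases "0 < t")
    case True
    have "emeasure ?N {..t} = (\<integral>\<^sup>+r. ennreal (real n * \<omega> * r ^ (n - 1)) * indicator {0..} r * indicator {..t} r \<partial>lborel)"
      by (simp add: emeasure_density n_def \<omega>_def)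
    also have "\<dots> = (\<integral>\<^sup>+r. ennreal (real n * \<omega> * r ^ (n - 1)) * indicator {0..t} r \<partial>lborel)"
      by (intro nn_integral_cong) (auto simp: indicator_def)
    also have "\<dots> = ennreal (\<omega> * t ^ n - \<omega> * 0 ^ n)"
      using True \<omega> by (intro nn_integral_FTC_Icc) (auto intro!: derivative_eq_intros)
    finally show ?thesis using True by (simp only: zero_power[OF n] mult_zero_right diff_zero if_True)
  next
    case False
    have "emeasure ?N {..t} = (\<integral>\<^sup>+r. ennreal (real n * \<omega> * r ^ (n - 1)) * indicator {0..} r * indicator {..t} r \<partial>lborel)"
      by (simp add: emeasure_density n_def \<omega>_def)
    also have "\<dots> \<le> (\<integral>\<^sup>+r. \<infinity> * indicator {0::real} r \<partial>lborel)"
      using False by (intro nn_integral_mono) (auto simp: indicator_def)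
    also have "\<dots> = 0" by (subst nn_integral_cmult_indicator) auto
    finally have "emeasure ?N {..t} = 0" by (simp only: le_zero_eq)
    then show ?thesis using False by (simp only: if_False)
  qed
  show ?thesis
  proof (rule measure_eqI_generator_eq)
    show "Int_stable (range (\<lambda>t::real. {..t}))" by (auto simp: Int_stable_def)
    show "range (\<lambda>i::nat. {..real i}) \<subseteq> range (\<lambda>t::real. {..t})" by auto
    show "(\<Union>i::nat. {..real i}) = UNIV" using real_arch_simple by auto
    show "emeasure ?M {..real i} \<noteq> \<infinity>" for i by (simp add: M)
    show "sets ?M = sigma_sets UNIV (range (\<lambda>t::real. {..t}))" "sets ?N = sigma_sets UNIV (range (\<lambda>t::real. {..t}))"
      by (simp_all add: borel_eq_atMost)
    show "emeasure ?M X = emeasure ?N X" if "X \<in> range (\<lambda>t::real. {..t})" for X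
      using that M N by auto
  qed auto
qed

lemma AE_norm_lebesgue:
  assumes "negligible N"
  shows "AE x in lebesgue. norm (x::'a::euclidean_space) \<notin> N"
proof -
  have "AE r in lborel. r \<notin> N"
    using assms unfolding negligible_iff_null_sets
    by (metis AE_completion_iff AE_not_in)
  then obtain N' where N': "N' \<in> null_sets lborel" "N \<subseteq> N'"
    by (auto elim!: AE_E simp: null_sets_def)
  then have [measurable]: "N' \<in> sets borel" by auto
  have "AE r in lborel. r \<notin> N'" using N' by (rule_tac AE_not_in)
  then have "AE r in distr lborel borel (norm :: 'a \<Rightarrow> real). r \<notin> N'"
    unfolding distr_lborel_norm by (subst AE_density) auto
  then have "AE x in lborel. norm (x::'a) \<notin> N'" by (subst (asm) AE_distr_iff) auto
  then show ?thesis using N' by (auto intro: AE_completion elim!: eventually_mono)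
qed

section \<open>Optimality of radial maps\<close>

text \<open>The profile is extended to all of \<open>\<real>\<close>, so that it has an inverse and an antiderivative without any
  restriction on the argument.\<close>

locale bilipschitz_profile =
  fixes s :: "real \<Rightarrow> real" and c C :: real
  assumes bij: "bij s" and c_pos: "0 < c" and zero: "s 0 = 0"
    and low: "a \<le> b \<Longrightarrow> c * (b - a) \<le> s b - s a"
    and up: "a \<le> b \<Longrightarrow> s b - s a \<le> C * (b - a)"
begin

lemma strict: "a < b \<Longrightarrow> s a < s b"
  using low[of a b] c_pos by (smt (verit) mult_pos_pos)

lemma le_iff: "s a \<le> s b \<longleftrightarrow> a \<le> b"
  using strict[of a b] strict[of b a] by (cases a b rule: linorder_cases) auto

lemma C_pos: "0 < C"
  using up[of 0 1] strict[of 0 1] by auto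

lemma dist_le: "\<bar>s a - s b\<bar> \<le> C * \<bar>a - b\<bar>"
  using up[of a b] up[of b a] le_iff[of a b] le_iff[of b a] by (cases "a \<le> b") auto

lemma abs_le: "\<bar>s r\<bar> \<le> C * \<bar>r\<bar>"
  using dist_le[of r 0] zero by simp

lemma nonneg: "0 \<le> r \<Longrightarrow> 0 \<le> s r"
  using le_iff[of 0 r] zero by simp

lemma continuous: "continuous_on UNIV s"
proof -
  have "C-lipschitz_on UNIV s"
    using dist_le C_pos by (intro lipschitz_onI) (auto simp: dist_real_def)
  then show ?thesis by (rule lipschitz_on_continuous_on)
qed

definition t :: "real \<Rightarrow> real" where "t = inv s"

lemma s_t [simp]: "s (t y) = y" and t_s [simp]: "t (s r) = r"
  using bij by (auto simp: t_def bij_def surj_f_inv_f)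

lemma t_le_iff: "t a \<le> t b \<longleftrightarrow> a \<le> b"
  using le_iff[of "t a" "t b"] by simp

lemma t_abs: "c * \<bar>t y\<bar> \<le> \<bar>y\<bar>"
  using low[of 0 "t y"] low[of "t y" 0] zero t_le_iff[of y 0] t_le_iff[of 0 y]
  by (cases "0 \<le> t y") (auto simp: zero)

definition \<Phi> :: "real \<Rightarrow> real" where
  "\<Phi> = (SOME \<Phi>. \<Phi> 0 = 0 \<and> (\<forall>r. (\<Phi> has_real_derivative s r) (at r)))"

lemma \<Phi>: "\<Phi> 0 = 0" "(\<Phi> has_real_derivative s r) (at r)"
proof -
  have "isCont s x" for x using continuous by (simp add: continuous_on_eq_continuous_at)
  then obtain F where F: "\<And>x. (F has_vector_derivative s x) (at x)"
    using einterval_antiderivative[of "-\<infinity>" \<infinity> s] by auto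
  then have "((\<lambda>r. F r - F 0) has_real_derivative s r) (at r)" for r
    using DERIV_diff[of F "s r" r UNIV "\<lambda>_. F 0" 0]
    by (simp add: has_real_derivative_iff_has_vector_derivative)
  then have "\<exists>\<Phi>. \<Phi> 0 = 0 \<and> (\<forall>r. (\<Phi> has_real_derivative s r) (at r))"
    by (intro exI[of _ "\<lambda>r. F r - F 0"]) auto
  from someI_ex[OF this] show "\<Phi> 0 = 0" "(\<Phi> has_real_derivative s r) (at r)"
    by (auto simp: \<Phi>_def)
qed

text \<open>The Legendre conjugate of \<open>\<Phi>\<close>: the supremum of \<open>r y - \<Phi> r\<close> is attained where \<open>s r = y\<close>.\<close>

definition \<Psi> :: "real \<Rightarrow> real" where "\<Psi> y = y * t y - \<Phi> (t y)"

text \<open>The function \<open>r \<mapsto> \<Phi> r - y r\<close> has the strictly increasing derivative \<open>s r - y\<close>, hence a strict minimum at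
  \<open>t y\<close>.\<close>

lemma young_strict: assumes "s r \<noteq> y" shows "r * y < \<Phi> r + \<Psi> y"
proof -
  define D where "D = (\<lambda>x. \<Phi> x - y * x)"
  have D: "(D has_real_derivative s x - y) (at x)" for x
    unfolding D_def by (rule derivative_eq_intros \<Phi> refl | simp)+
  consider "t y < r" | "r < t y" using assms by (metis linorder_neqE s_t)
  then have "D (t y) < D r"
  proof cases
    case 1
    obtain z where z: "t y < z" "z < r" "D r - D (t y) = (r - t y) * (s z - y)"
      using MVT2[OF 1, of D "\<lambda>x. s x - y"] D by auto
    then show ?thesis using strict[of "t y" z] 1 by (smt (verit) mult_pos_pos s_t)
  next
    case 2
    obtain z where z: "r < z" "z < t y" "D (t y) - D r = (t y - r) * (s z - y)"
      using MVT2[OF 2, of D "\<lambda>x. s x - y"] D by auto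
    then show ?thesis using strict[of z "t y"] 2 by (smt (verit) mult_pos_neg s_t)
  qed
  then show ?thesis by (simp add: D_def \<Psi>_def algebra_simps)
qed

lemma young_eq: "r * s r = \<Phi> r + \<Psi> (s r)"
  by (simp add: \<Psi>_def algebra_simps)

lemma young: "r * y \<le> \<Phi> r + \<Psi> y"
  using young_strict[of r y] young_eq[of r] by (cases "s r = y") auto

lemma \<Phi>_abs: "\<bar>\<Phi> r\<bar> \<le> C * r\<^sup>2"
proof -
  have "\<exists>z. \<bar>z\<bar> \<le> \<bar>r\<bar> \<and> \<Phi> r = r * s z"
  proof (cases r "0::real" rule: linorder_cases)
    case less
    then obtain z where "r < z" "z < 0" "\<Phi> 0 - \<Phi> r = (0 - r) * s z"
      using MVT2[OF less, of \<Phi> s] \<Phi> by auto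
    then show ?thesis using \<Phi> by (intro exI[of _ z]) auto
  next
    case equal then show ?thesis using \<Phi> by auto
  next
    case greater
    then obtain z where "0 < z" "z < r" "\<Phi> r - \<Phi> 0 = (r - 0) * s z"
      using MVT2[OF greater, of \<Phi> s] \<Phi> by auto
    then show ?thesis using \<Phi> by (intro exI[of _ z]) auto
  qed
  then obtain z where z: "\<bar>z\<bar> \<le> \<bar>r\<bar>" "\<Phi> r = r * s z" by blast
  have "\<bar>\<Phi> r\<bar> \<le> \<bar>r\<bar> * (C * \<bar>z\<bar>)" using z(2) abs_le[of z] by (simp add: abs_mult mult_left_mono)
  also have "\<dots> \<le> \<bar>r\<bar> * (C * \<bar>r\<bar>)" using z C_pos by (intro mult_left_mono) auto
  finally show ?thesis by (simp add: power2_eq_square ac_simps flip: abs_mult)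
qed

lemma \<Psi>_abs: "\<bar>\<Psi> y\<bar> \<le> (1 / c + C / c\<^sup>2) * y\<^sup>2"
proof -
  have t: "\<bar>t y\<bar> \<le> \<bar>y\<bar> / c" using t_abs[of y] c_pos by (simp add: field_simps)
  have "\<bar>\<Psi> y\<bar> \<le> \<bar>y\<bar> * \<bar>t y\<bar> + \<bar>\<Phi> (t y)\<bar>"
    unfolding \<Psi>_def by (metis abs_mult abs_triangle_ineq4)
  also have "\<dots> \<le> \<bar>y\<bar> * (\<bar>y\<bar> / c) + C * (\<bar>y\<bar> / c)\<^sup>2"
  proof (intro add_mono mult_left_mono t)
    have "\<bar>\<Phi> (t y)\<bar> \<le> C * \<bar>t y\<bar>\<^sup>2" using \<Phi>_abs[of "t y"] by simp
    also have "\<dots> \<le> C * (\<bar>y\<bar> / c)\<^sup>2" using t C_pos by (intro mult_left_mono power_mono) auto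
    finally show "\<bar>\<Phi> (t y)\<bar> \<le> C * (\<bar>y\<bar> / c)\<^sup>2" .
  qed simp
  also have "\<dots> = (1 / c + C / c\<^sup>2) * y\<^sup>2"
    by (simp add: power2_eq_square power_divide algebra_simps flip: abs_mult)
  finally show ?thesis .
qed

lemma \<Phi>_measurable [measurable]: "\<Phi> \<in> borel_measurable borel"
  using \<Phi>(2) by (intro borel_measurable_continuous_onI) (meson DERIV_isCont continuous_at_imp_continuous_on)

lemma s_measurable [measurable]: "s \<in> borel_measurable borel"
  using continuous by (rule borel_measurable_continuous_onI)

lemma t_measurable [measurable]: "t \<in> borel_measurable borel"
  by (rule borel_measurable_mono) (simp add: mono_def t_le_iff)

lemma \<Psi>_measurable [measurable]: "\<Psi> \<in> borel_measurable borel"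
  unfolding \<Psi>_def[abs_def] by measurable

definition T :: "'a::euclidean_space \<Rightarrow> 'a" where "T x = s (norm x) *\<^sub>R sgn x"

text \<open>The slack in Young's inequality for the radial potentials \<open>\<Phi> |x|\<close> and \<open>\<Psi> |y|\<close>. It vanishes exactly on the graph
  of \<open>T\<close>, which makes the pair a certificate of optimality.\<close>

definition gap :: "'a::euclidean_space \<Rightarrow> 'a \<Rightarrow> real" where
  "gap x y = \<Phi> (norm x) + \<Psi> (norm y) - x \<bullet> y"

lemma gap_nonneg: "0 \<le> gap x y"
  using young[of "norm x" "norm y"] norm_cauchy_schwarz[of x y] by (simp add: gap_def)

text \<open>Equality forces \<open>|y| = s |x|\<close> in Young's inequality and \<open>x \<bullet> y = |x| |y|\<close> in the Cauchy-Schwarz inequality,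
  that is, \<open>y\<close> points in the direction of \<open>x\<close>.\<close>

lemma gap_zero_iff: "gap x y = 0 \<longleftrightarrow> y = T x"
proof
  assume "gap x y = 0"
  then have eq: "x \<bullet> y = \<Phi> (norm x) + \<Psi> (norm y)" by (simp add: gap_def)
  then have "s (norm x) = norm y"
    using young_strict[of "norm x" "norm y"] norm_cauchy_schwarz[of x y] by fastforce
  moreover have "x \<bullet> y = norm x * norm y"
    using eq young[of "norm x" "norm y"] norm_cauchy_schwarz[of x y] by linarith
  then have "norm x *\<^sub>R y = norm y *\<^sub>R x" by (simp add: norm_cauchy_schwarz_eq)
  ultimately show "y = T x"
  proof (cases "x = 0")
    case True
    then show ?thesis using \<open>s (norm x) = norm y\<close> zero by (simp add: T_def)
  next
    case False
    have "y = (1 / norm x) *\<^sub>R (norm x *\<^sub>R y)" using False by simp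
    also have "\<dots> = T x" using \<open>norm x *\<^sub>R y = norm y *\<^sub>R x\<close> \<open>s (norm x) = norm y\<close>
      by (simp add: T_def sgn_div_norm field_simps)
    finally show ?thesis .
  qed
next
  assume y: "y = T x"
  show "gap x y = 0"
  proof (cases "x = 0")
    case True
    have "\<Psi> 0 = 0" using young_eq[of 0] zero \<Phi> by simp
    then show ?thesis using True y zero \<Phi> by (simp add: gap_def T_def)
  next
    case False
    have "norm y = s (norm x)" using y False nonneg[of "norm x"] by (simp add: T_def norm_sgn)
    moreover have "x \<bullet> y = norm x * s (norm x)"
      using y False by (simp add: T_def sgn_div_norm dot_square_norm power2_eq_square)
    ultimately show ?thesis using young_eq[of "norm x"] by (simp add: gap_def)
  qed
qed

lemma T_measurable: "T \<in> borel_measurable borel"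
  unfolding T_def[abs_def] sgn_div_norm[abs_def] by measurable

lemma norm_T: "norm (T x) \<le> C * norm x"
  using abs_le[of "norm x"] C_pos by (cases "x = 0") (auto simp: T_def norm_sgn zero)

text \<open>For a map \<open>S\<close> with the prescribed image measure, \<open>|x - S x|\<^sup>2\<close> is the sum of a function of \<open>x\<close>, a function of \<open>S x\<close>
  and twice the gap. The first two have integrals that depend only on \<open>\<mu>\<close> and \<open>\<nu>\<close>, so the cost of \<open>S\<close> is a
  constant plus twice the integral of a nonnegative function that vanishes only where \<open>S x = T x\<close>.\<close>

theorem the_optimal_transport_T:
  fixes \<mu> :: "'a::euclidean_space measure"
  assumes sets [measurable_cong]: "sets \<mu> = sets borel" and moment: "integrable \<mu> (\<lambda>x. (norm x)\<^sup>2)"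
    and push: "distr \<mu> borel T = \<nu>"
  shows "the_optimal_transport \<mu> \<nu> T"
proof -
  note [measurable] = T_measurable
  have T_sq: "integrable \<mu> (\<lambda>x. (norm (T x))\<^sup>2)"
  proof (rule Bochner_Integration.integrable_bound)
    show "integrable \<mu> (\<lambda>x. C\<^sup>2 * (norm x)\<^sup>2)" using moment by simp
    show "AE x in \<mu>. norm ((norm (T x))\<^sup>2) \<le> norm (C\<^sup>2 * (norm x)\<^sup>2)"
      using power_mono[OF norm_T norm_ge_zero, of _ 2] by (auto simp: power_mult_distrib)
  qed measurable
  have \<nu>_sq: "integrable \<nu> (\<lambda>y. (norm y)\<^sup>2)"
    unfolding push[symmetric] using T_sq by (subst integrable_distr_eq) auto
  have sets_\<nu>: "sets \<nu> = sets borel" unfolding push[symmetric] by simp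
  define A where "A = (\<lambda>x::'a. (norm x)\<^sup>2 - 2 * \<Phi> (norm x))"
  define B where "B = (\<lambda>y::'a. (norm y)\<^sup>2 - 2 * \<Psi> (norm y))"
  have [measurable]: "A \<in> borel_measurable borel" "B \<in> borel_measurable borel"
    unfolding A_def B_def by measurable
  have A: "integrable \<mu> A"
  proof (rule Bochner_Integration.integrable_bound)
    show "integrable \<mu> (\<lambda>x. (1 + 2 * C) * (norm x)\<^sup>2)" using moment by simp
    show "AE x in \<mu>. norm (A x) \<le> norm ((1 + 2 * C) * (norm x)\<^sup>2)"
    proof (rule AE_I2)
      fix x show "norm (A x) \<le> norm ((1 + 2 * C) * (norm x)\<^sup>2)"
      proof -
        have "norm (A x) \<le> (norm x)\<^sup>2 + 2 * (C * (norm x)\<^sup>2)"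
          using \<Phi>_abs[of "norm x"] zero_le_power2[of "norm x"] unfolding A_def real_norm_def by linarith
        also have "\<dots> = (1 + 2 * C) * (norm x)\<^sup>2" by (simp add: algebra_simps)
        finally show ?thesis using C_pos by simp
      qed
    qed
  qed measurable
  have B: "integrable \<nu> B"
  proof (rule Bochner_Integration.integrable_bound)
    define k where "k = 1 / c + C / c\<^sup>2"
    have k: "0 \<le> k" using c_pos C_pos by (simp add: k_def)
    show "integrable \<nu> (\<lambda>x. (1 + 2 * k) * (norm x)\<^sup>2)" using \<nu>_sq by simp
    show "AE x in \<nu>. norm (B x) \<le> norm ((1 + 2 * k) * (norm x)\<^sup>2)"
    proof (rule AE_I2)
      fix x show "norm (B x) \<le> norm ((1 + 2 * k) * (norm x)\<^sup>2)"
      proof -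
        have "norm (B x) \<le> (norm x)\<^sup>2 + 2 * (k * (norm x)\<^sup>2)"
          using \<Psi>_abs[of "norm x"] zero_le_power2[of "norm x"]
          unfolding B_def real_norm_def k_def by linarith
        also have "\<dots> = (1 + 2 * k) * (norm x)\<^sup>2" by (simp add: algebra_simps)
        finally show ?thesis using k by simp
      qed
    qed
  qed (simp add: measurable_cong_sets[OF sets_\<nu> refl])
  have cost: "integrable \<mu> (\<lambda>x. gap x (S x))"
      "transport_cost \<mu> S = ennreal (integral\<^sup>L \<mu> A + integral\<^sup>L \<nu> B + 2 * (\<integral>x. gap x (S x) \<partial>\<mu>))"
      "0 \<le> integral\<^sup>L \<mu> A + integral\<^sup>L \<nu> B + 2 * (\<integral>x. gap x (S x) \<partial>\<mu>)"
    if S: "transport_map \<mu> \<nu> S" for S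
  proof -
    have [measurable]: "S \<in> borel_measurable borel" and S_push: "distr \<mu> borel S = \<nu>"
      using S by (auto simp: transport_map_def)
    have S_meas: "S \<in> measurable \<mu> borel" by measurable
    have BS: "integrable \<mu> (\<lambda>x. B (S x))" "(\<integral>x. B (S x) \<partial>\<mu>) = integral\<^sup>L \<nu> B"
      using B integrable_distr_eq[OF S_meas, of B] integral_distr[OF S_meas, of B] by (auto simp: S_push)
    have SS: "integrable \<mu> (\<lambda>x. (norm (S x))\<^sup>2)"
      using \<nu>_sq integrable_distr_eq[OF S_meas, of "\<lambda>y. (norm y)\<^sup>2"] by (auto simp: S_push)
    have cost_int: "integrable \<mu> (\<lambda>x. (norm (x - S x))\<^sup>2)"
    proof (rule Bochner_Integration.integrable_bound)
      show "integrable \<mu> (\<lambda>x. 2 * (norm x)\<^sup>2 + 2 * (norm (S x))\<^sup>2)" using moment SS by simp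
      show "AE x in \<mu>. norm ((norm (x - S x))\<^sup>2) \<le> norm (2 * (norm x)\<^sup>2 + 2 * (norm (S x))\<^sup>2)"
      proof (rule AE_I2)
        fix x
        have "(norm (x - S x))\<^sup>2 + (norm (x + S x))\<^sup>2 = 2 * (norm x)\<^sup>2 + 2 * (norm (S x))\<^sup>2"
          by (simp add: power2_norm_eq_inner algebra_simps inner_commute)
        then have "(norm (x - S x))\<^sup>2 \<le> 2 * (norm x)\<^sup>2 + 2 * (norm (S x))\<^sup>2"
          by (smt (verit) zero_le_power2)
        then show "norm ((norm (x - S x))\<^sup>2) \<le> norm (2 * (norm x)\<^sup>2 + 2 * (norm (S x))\<^sup>2)" by simp
      qed
    qed measurable
    have eq: "(norm (x - S x))\<^sup>2 = A x + B (S x) + 2 * gap x (S x)" for x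
      by (simp add: A_def B_def gap_def power2_norm_eq_inner algebra_simps inner_commute)
    have "integrable \<mu> (\<lambda>x. ((norm (x - S x))\<^sup>2 - A x - B (S x)) / 2)"
      using cost_int A BS by simp
    moreover have "(\<lambda>x. ((norm (x - S x))\<^sup>2 - A x - B (S x)) / 2) = (\<lambda>x. gap x (S x))"
      by (simp add: eq)
    ultimately show gap: "integrable \<mu> (\<lambda>x. gap x (S x))" by simp
    have int_eq: "(\<integral>x. (norm (x - S x))\<^sup>2 \<partial>\<mu>) = integral\<^sup>L \<mu> A + integral\<^sup>L \<nu> B + 2 * (\<integral>x. gap x (S x) \<partial>\<mu>)"
      using A BS gap by (simp add: eq)
    have "transport_cost \<mu> S = ennreal (\<integral>x. (norm (x - S x))\<^sup>2 \<partial>\<mu>)"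
      unfolding transport_cost_def using cost_int by (intro nn_integral_eq_integral) auto
    then show "transport_cost \<mu> S = ennreal (integral\<^sup>L \<mu> A + integral\<^sup>L \<nu> B + 2 * (\<integral>x. gap x (S x) \<partial>\<mu>))"
      by (simp add: int_eq)
    have "0 \<le> (\<integral>x. (norm (x - S x))\<^sup>2 \<partial>\<mu>)" by simp
    then show "0 \<le> integral\<^sup>L \<mu> A + integral\<^sup>L \<nu> B + 2 * (\<integral>x. gap x (S x) \<partial>\<mu>)" by (simp add: int_eq)
  qed
  have T_map: "transport_map \<mu> \<nu> T" using push by (simp add: transport_map_def)
  have gap_T: "(\<integral>x. gap x (T x) \<partial>\<mu>) = 0" by (simp add: gap_zero_iff[THEN iffD2, OF refl])
  have gap_S: "0 \<le> (\<integral>x. gap x (S x) \<partial>\<mu>)" for S by (simp add: gap_nonneg)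
  have "optimal_map \<mu> \<nu> T"
    unfolding optimal_map_def
  proof (intro conjI allI impI T_map)
    fix S assume S: "transport_map \<mu> \<nu> S"
    show "transport_cost \<mu> T \<le> transport_cost \<mu> S"
      unfolding cost(2)[OF S] cost(2)[OF T_map] gap_T using gap_S[of S] by (intro ennreal_leI) simp
  qed
  moreover have "AE x in \<mu>. S x = T x" if "optimal_map \<mu> \<nu> S" for S
  proof -
    have S: "transport_map \<mu> \<nu> S" and "transport_cost \<mu> S \<le> transport_cost \<mu> T"
      using that T_map by (auto simp: optimal_map_def)
    then have "(\<integral>x. gap x (S x) \<partial>\<mu>) \<le> 0"
      unfolding cost(2)[OF S] cost(2)[OF T_map] gap_T using cost(3)[OF T_map] unfolding gap_T
      by (subst (asm) ennreal_le_iff) auto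
    then have "(\<integral>x. gap x (S x) \<partial>\<mu>) = 0" using gap_S[of S] by simp
    then have "AE x in \<mu>. gap x (S x) = 0"
      using integral_nonneg_eq_0_iff_AE[OF cost(1)[OF S]] gap_nonneg by auto
    then show ?thesis by (simp add: gap_zero_iff)
  qed
  ultimately show ?thesis by (simp add: the_optimal_transport_def)
qed

end

section \<open>Radial log-concave densities\<close>

text \<open>If the increments of \<open>F\<close> from \<open>x\<close> are those of \<open>P\<close> weighted by \<open>w x\<close>, up to an error controlled by the
  variation of \<open>w\<close>, then \<open>F' = w P'\<close> at \<open>x\<close>. This gives the density of \<open>F\<close> from bounds on annuli alone.\<close>

lemma has_real_derivative_weighted_increment:
  fixes F P w :: "real \<Rightarrow> real"
  assumes P: "(P has_real_derivative P') (at x)" and w: "isCont w x"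
    and bound: "\<forall>\<^sub>F y in at x. \<bar>F y - F x - w x * (P y - P x)\<bar> \<le> \<bar>w y - w x\<bar> * \<bar>P y - P x\<bar>"
  shows "(F has_real_derivative w x * P') (at x)"
proof -
  define Q where "Q = (\<lambda>y. (P y - P x) / (y - x))"
  have Q: "(Q \<longlongrightarrow> P') (at x)" using P unfolding has_field_derivative_iff Q_def by simp
  have "((\<lambda>y. w y - w x) \<longlongrightarrow> 0) (at x)" using w by (simp add: isCont_def LIM_zero_iff)
  then have "((\<lambda>y. \<bar>w y - w x\<bar> * \<bar>Q y\<bar>) \<longlongrightarrow> \<bar>0\<bar> * \<bar>P'\<bar>) (at x)"
    by (intro tendsto_mult tendsto_rabs Q)
  then have null: "((\<lambda>y. \<bar>w y - w x\<bar> * \<bar>Q y\<bar>) \<longlongrightarrow> 0) (at x)" by simp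
  have "\<forall>\<^sub>F y in at x. norm ((F y - F x) / (y - x) - w x * Q y) \<le> \<bar>w y - w x\<bar> * \<bar>Q y\<bar>"
    using bound
  proof eventually_elim
    case (elim y)
    have "(F y - F x) / (y - x) - w x * Q y = (F y - F x - w x * (P y - P x)) / (y - x)"
      by (simp add: Q_def diff_divide_distrib[symmetric])
    then show ?case using elim by (simp add: Q_def abs_divide divide_right_mono)
  qed
  then have "((\<lambda>y. (F y - F x) / (y - x) - w x * Q y) \<longlongrightarrow> 0) (at x)"
    using null by (rule Lim_null_comparison)
  from tendsto_add[OF this tendsto_mult[OF tendsto_const[of "w x"] Q]]
  show ?thesis unfolding has_field_derivative_iff by simp
qed

text \<open>The radial situation in dimension \<open>n\<close>: \<open>w r\<close> is \<open>e\<^sup>-\<^sup>v\<^sup>(\<^sup>r\<^sup>)\<close>, zero where \<open>v\<close> is infinite, and \<open>g\<close> is a radial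
  density comparable with \<open>h\<close>.\<close>

locale radial_log_concave_density =
  fixes w :: "real \<Rightarrow> real" and h g :: "'a::euclidean_space \<Rightarrow> ennreal" and l u :: real
  assumes w_nonneg: "0 \<le> w r"
    and w_antimono: "0 \<le> a \<Longrightarrow> a \<le> b \<Longrightarrow> w b \<le> w a"
    and w_log_concave: "0 \<le> a \<Longrightarrow> 0 \<le> b \<Longrightarrow> 0 < w a \<Longrightarrow> 0 < w b \<Longrightarrow> 0 < t \<Longrightarrow> t < 1 \<Longrightarrow>
      (1 - t) * ln (w a) + t * ln (w b) \<le> ln (w ((1 - t) * a + t * b))"
    and w_measurable [measurable]: "w \<in> borel_measurable borel"
    and h_eq: "h x = ennreal (w (norm x))"
    and prob_h: "prob_space (borel_density h)"
    and g_measurable: "g \<in> borel_measurable lebesgue" and g_radial: "radially_symmetric g"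
    and prob_g: "prob_space (borel_density g)"
    and l_pos: "0 < l" and u_nonneg: "0 \<le> u"
    and g_ge: "AE x in lebesgue. ennreal l * h x \<le> g x"
    and g_le: "AE x in lebesgue. g x \<le> ennreal u * h x"
begin

abbreviation "\<mu> \<equiv> borel_density h"
abbreviation "\<nu> \<equiv> borel_density g"

sublocale \<mu>: prob_space \<mu> by (rule prob_h)
sublocale \<nu>: prob_space \<nu> by (rule prob_g)

lemma h_measurable: "h \<in> borel_measurable lebesgue"
proof -
  have "h = (\<lambda>x. ennreal (w (norm x)))" using h_eq by auto
  then show ?thesis by (simp add: measurable_completion)
qed

lemma h_radial: "radially_symmetric h"
  by (simp add: radially_symmetric_def h_eq)

lemma density_comparison:
  assumes A: "A \<in> sets borel"
  shows "l * measure \<mu> A \<le> measure \<nu> A" "measure \<nu> A \<le> u * measure \<mu> A"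
proof -
  have A': "A \<in> sets lebesgue" using A by (intro sets_completionI_sets) simp
  have hA: "(\<lambda>x. h x * indicator A x) \<in> borel_measurable lebesgue"
    using h_measurable A' by measurable
  have "ennreal l * emeasure \<mu> A = (\<integral>\<^sup>+x. ennreal l * (h x * indicator A x) \<partial>lebesgue)"
    using hA by (simp add: emeasure_borel_density[OF h_measurable A] nn_integral_cmult)
  also have "\<dots> \<le> (\<integral>\<^sup>+x. g x * indicator A x \<partial>lebesgue)"
    using g_ge by (intro nn_integral_mono_AE) (auto elim!: eventually_mono simp: indicator_def)
  also have "\<dots> = emeasure \<nu> A" by (rule emeasure_borel_density[OF g_measurable A, symmetric])
  finally have "ennreal (l * measure \<mu> A) \<le> ennreal (measure \<nu> A)"
    using l_pos by (simp add: \<mu>.emeasure_eq_measure \<nu>.emeasure_eq_measure ennreal_mult)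
  then show "l * measure \<mu> A \<le> measure \<nu> A" by (simp add: ennreal_le_iff)
  have "emeasure \<nu> A = (\<integral>\<^sup>+x. g x * indicator A x \<partial>lebesgue)" by (rule emeasure_borel_density[OF g_measurable A])
  also have "\<dots> \<le> (\<integral>\<^sup>+x. ennreal u * (h x * indicator A x) \<partial>lebesgue)"
    using g_le by (intro nn_integral_mono_AE) (auto elim!: eventually_mono simp: indicator_def)
  also have "\<dots> = ennreal u * emeasure \<mu> A"
    using hA by (simp add: emeasure_borel_density[OF h_measurable A] nn_integral_cmult)
  finally have "ennreal (measure \<nu> A) \<le> ennreal (u * measure \<mu> A)"
    using u_nonneg by (simp add: \<mu>.emeasure_eq_measure \<nu>.emeasure_eq_measure ennreal_mult)
  then show "measure \<nu> A \<le> u * measure \<mu> A" using u_nonneg by (simp add: ennreal_le_iff)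
qed

text \<open>The interior of the set of radii with positive density.\<close>

definition I :: "real set" where "I = {r. 0 < r \<and> (\<exists>r'>r. 0 < w r')}"
definition \<omega> :: real where "\<omega> = measure lborel (cball (0::'a) 1)"
text \<open>The volume of the ball of radius \<open>r\<close>.\<close>

definition P :: "real \<Rightarrow> real" where "P r = \<omega> * r ^ DIM('a)"
definition f :: "real \<Rightarrow> real" where "f r = w r * (\<omega> * (real DIM('a) * r ^ (DIM('a) - 1)))"
definition F :: "real \<Rightarrow> real" where "F r = measure \<mu> (cball 0 r)"
definition G :: "real \<Rightarrow> real" where "G r = measure \<nu> (cball 0 r)"

lemma \<omega>_pos: "0 < \<omega>"
  using content_cball_pos[of 1 "0::'a"] by (simp add: \<omega>_def)

lemma P_0 [simp]: "P 0 = 0"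
  by (simp add: P_def zero_power[OF DIM_positive])

lemma emeasure_cball_0: "0 \<le> r \<Longrightarrow> emeasure lborel (cball (0::'a) r) = ennreal (P r)"
proof -
  assume r: "0 \<le> r"
  have \<omega>: "emeasure lborel (cball (0::'a) 1) = ennreal \<omega>"
    unfolding \<omega>_def using unit_ball_measure(2)[where 'a='a]
    by (auto simp: emeasure_eq_ennreal_measure less_top[symmetric])
  show ?thesis
  proof (cases "r = 0")
    case True then show ?thesis by simp
  next
    case False
    have "emeasure lborel {x::'a. norm x \<le> r \<and> sgn x \<in> UNIV}
        = ennreal (r ^ DIM('a)) * emeasure lborel {x::'a \<in> cball 0 1. sgn x \<in> UNIV}"
      using r False by (intro emeasure_lborel_cone_cball) auto
    moreover have "{x::'a. norm x \<le> r \<and> sgn x \<in> UNIV} = cball 0 r" by auto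
    moreover have "{x::'a \<in> cball 0 1. sgn x \<in> UNIV} = cball 0 1" by auto
    ultimately show ?thesis
      using r \<omega>_pos by (simp add: \<omega> P_def ennreal_mult[symmetric] mult.commute)
  qed
qed

lemma P_mono: "0 \<le> a \<Longrightarrow> a \<le> b \<Longrightarrow> P a \<le> P b"
  unfolding P_def using \<omega>_pos by (intro mult_left_mono power_mono) auto

lemma emeasure_annulus:
  assumes "0 \<le> a" "a \<le> b"
  shows "emeasure lborel (cball (0::'a) b - cball 0 a) = ennreal (P b - P a)"
proof -
  have "emeasure lborel (cball (0::'a) b - cball 0 a) = emeasure lborel (cball (0::'a) b) - emeasure lborel (cball (0::'a) a)"
    using assms by (intro emeasure_Diff) (auto simp: emeasure_cball_0)
  also have "\<dots> = ennreal (P b - P a)"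
    using assms P_mono[of 0 a] by (simp add: emeasure_cball_0 ennreal_minus)
  finally show ?thesis .
qed

lemma F_diff: assumes "0 \<le> a" "a \<le> b" shows "F b - F a = measure \<mu> (cball 0 b - cball 0 a)"
  unfolding F_def using assms by (intro \<mu>.finite_measure_Diff[symmetric]) auto

lemma G_diff: assumes "0 \<le> a" "a \<le> b" shows "G b - G a = measure \<nu> (cball 0 b - cball 0 a)"
  unfolding G_def using assms by (intro \<nu>.finite_measure_Diff[symmetric]) auto

text \<open>On an annulus the decreasing density lies between its values on the two bounding spheres.\<close>

lemma F_increment:
  assumes "0 \<le> a" "a \<le> b"
  shows "w b * (P b - P a) \<le> F b - F a" "F b - F a \<le> w a * (P b - P a)"
proof -
  define A where "A = cball (0::'a) b - cball 0 a"
  have A: "A \<in> sets borel" by (simp add: A_def)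
  have P: "0 \<le> P b - P a" using P_mono assms by simp
  have eq: "emeasure \<mu> A = (\<integral>\<^sup>+x. ennreal (w (norm x)) * indicator A x \<partial>lborel)"
    using emeasure_borel_density[OF h_measurable A] by (simp add: h_eq nn_integral_completion A)
  have "ennreal (w b * (P b - P a)) = (\<integral>\<^sup>+x. ennreal (w b) * indicator A x \<partial>lborel)"
    using A P w_nonneg emeasure_annulus[OF assms] by (simp add: A_def ennreal_mult nn_integral_cmult_indicator)
  also have "\<dots> \<le> emeasure \<mu> A"
    unfolding eq using assms by (intro nn_integral_mono) (auto simp: A_def indicator_def intro!: ennreal_leI w_antimono)
  finally have "ennreal (w b * (P b - P a)) \<le> ennreal (F b - F a)"
    using assms by (simp add: F_diff \<mu>.emeasure_eq_measure A_def)
  then show "w b * (P b - P a) \<le> F b - F a"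
    using F_diff[OF assms] by (simp add: ennreal_le_iff)
  have "emeasure \<mu> A \<le> (\<integral>\<^sup>+x. ennreal (w a) * indicator A x \<partial>lborel)"
    unfolding eq using assms by (intro nn_integral_mono) (auto simp: A_def indicator_def intro!: ennreal_leI w_antimono)
  also have "\<dots> = ennreal (w a * (P b - P a))"
    using A P w_nonneg emeasure_annulus[OF assms] by (simp add: A_def ennreal_mult nn_integral_cmult_indicator)
  finally have "ennreal (F b - F a) \<le> ennreal (w a * (P b - P a))"
    using assms by (simp add: F_diff \<mu>.emeasure_eq_measure A_def)
  then show "F b - F a \<le> w a * (P b - P a)"
    using P w_nonneg[of a] by (simp add: ennreal_le_iff)
qed

lemma F_0: "F 0 = 0"
proof -
  have "emeasure \<mu> {0} = (\<integral>\<^sup>+x. h x * indicator {0} x \<partial>lebesgue)"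
    by (rule emeasure_borel_density[OF h_measurable]) simp
  also have "\<dots> = (\<integral>\<^sup>+x. 0 \<partial>(lebesgue :: 'a measure))"
  proof (rule nn_integral_cong_AE)
    have "AE x in lebesgue. x \<noteq> (0::'a)" by (intro AE_completion AE_lborel_singleton)
    then show "AE x in lebesgue. h x * indicator {0} x = 0" by eventually_elim simp
  qed
  finally show ?thesis by (simp add: F_def \<mu>.emeasure_eq_measure)
qed

lemma G_le_F: "G r \<le> u * F r" and G_ge_F: "l * F r \<le> G r"
  using density_comparison[of "cball 0 r"] by (auto simp: F_def G_def)

lemma G_0: "G 0 = 0"
  using G_le_F[of 0] F_0 by (simp add: G_def measure_le_0_iff)

lemma GF_increment:
  assumes "0 \<le> a" "a \<le> b"
  shows "l * (F b - F a) \<le> G b - G a" "G b - G a \<le> u * (F b - F a)"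
  using density_comparison[of "cball 0 b - cball 0 a"] assms by (auto simp: F_diff G_diff)

lemma F_tail: "1 - F r = measure \<mu> (UNIV - cball 0 r)"
  using \<mu>.prob_compl[of "cball 0 r"] by (simp add: F_def)

lemma G_tail: "1 - G r = measure \<nu> (UNIV - cball 0 r)"
  using \<nu>.prob_compl[of "cball 0 r"] by (simp add: G_def)

lemma G_tail_le: "1 - G r \<le> u * (1 - F r)"
  unfolding F_tail G_tail by (intro density_comparison) auto

lemma F_mono0: "a \<le> b \<Longrightarrow> F a \<le> F b"
  unfolding F_def by (intro \<mu>.finite_measure_mono) auto

lemma G_mono0: "a \<le> b \<Longrightarrow> G a \<le> G b"
  unfolding G_def by (intro \<nu>.finite_measure_mono) auto

lemma w_0_pos: "0 < w 0" and I_ne: "I \<noteq> {}"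
proof -
  have *: "\<exists>r>0. 0 < w r"
  proof (rule ccontr)
    assume "\<not> ?thesis"
    then have wz: "w r = 0" if "0 < r" for r using that w_nonneg[of r] by force
    have "AE x in lebesgue. x \<noteq> (0::'a)" by (intro AE_completion AE_lborel_singleton)
    then have "AE x in lebesgue. h x = 0"
      by eventually_elim (simp add: h_eq wz)
    then have "(\<integral>\<^sup>+x. h x * indicator UNIV x \<partial>lebesgue) = (\<integral>\<^sup>+x. 0 \<partial>(lebesgue :: 'a measure))"
      by (intro nn_integral_cong_AE) (auto elim!: eventually_mono)
    then have "emeasure \<mu> UNIV = 0"
      using emeasure_borel_density[OF h_measurable, of UNIV] by simp
    then show False using \<mu>.emeasure_space_1 by simp
  qed
  then obtain r where r: "0 < r" "0 < w r" by blast
  then show "0 < w 0" using w_antimono[of 0 r] by simp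
  have "r / 2 \<in> I" using r by (auto simp: I_def intro!: exI[of _ r])
  then show "I \<noteq> {}" by blast
qed

lemma I_pos: "r \<in> I \<Longrightarrow> 0 < r"
  by (simp add: I_def)

lemma w_pos: "r \<in> I \<Longrightarrow> 0 < w r"
proof -
  assume "r \<in> I"
  then obtain r' where "0 < r" "r < r'" "0 < w r'" by (auto simp: I_def)
  then show "0 < w r" using w_antimono[of r r'] by simp
qed

lemma I_down: "d \<in> I \<Longrightarrow> 0 < r \<Longrightarrow> r \<le> d \<Longrightarrow> r \<in> I"
  by (auto simp: I_def intro: order.strict_trans1)

lemma I_open: "open I"
proof (subst open_subopen, intro ballI)
  fix r assume "r \<in> I"
  then obtain r' where r': "0 < r" "r < r'" "0 < w r'" by (auto simp: I_def)
  then show "\<exists>T. open T \<and> r \<in> T \<and> T \<subseteq> I"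
    by (intro exI[of _ "{0<..<r'}"]) (auto simp: I_def)
qed

lemma I_convex: "convex I"
proof -
  have "c \<in> I" if "a \<in> I" "b \<in> I" "a \<le> c" "c \<le> b" for a b c
    using I_down[of b c] that by (auto simp: I_def)
  then have "is_interval I" unfolding is_interval_1 by blast
  then show ?thesis by (simp add: is_interval_convex)
qed

lemma w_continuous: "continuous_on I w"
proof -
  have "convex_on I (\<lambda>r. - ln (w r))"
  proof (rule convex_onI[OF _ I_convex])
    fix t a b :: real assume "0 < t" "t < 1" "a \<in> I" "b \<in> I"
    then show "- ln (w ((1 - t) *\<^sub>R a + t *\<^sub>R b)) \<le> (1 - t) * - ln (w a) + t * - ln (w b)"
      using w_log_concave[OF less_imp_le less_imp_le w_pos w_pos, of a b t] I_pos[of a] I_pos[of b]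
      by simp
  qed
  then have "continuous_on I (\<lambda>r. - ln (w r))" by (intro convex_on_continuous I_open)
  then have "continuous_on I (\<lambda>r. exp (- (- ln (w r))))"
    by (rule continuous_on_exp[OF continuous_on_minus])
  then show ?thesis by (rule continuous_on_eq) (simp add: w_pos)
qed

lemma w_four_point:
  assumes "0 < a" "a \<le> x" "a \<le> y" "a + d = x + y" "d \<in> I"
  shows "w a * w d \<le> w x * w y"
proof (cases "x = a \<or> y = a")
  case True
  then have "(x = a \<and> y = d) \<or> (x = d \<and> y = a)" using assms(4) by auto
  then show ?thesis by (auto simp: mult.commute)
next
  case False
  then have lt: "a < x" "a < y" "x < d" "y < d" using assms by auto
  define t where "t = (x - a) / (d - a)"
  have t: "0 < t" "t < 1" using lt by (auto simp: t_def field_simps)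
  have td: "t * (d - a) = x - a" using lt by (simp add: t_def)
  have x: "(1 - t) * a + t * d = x" using td by (simp add: algebra_simps)
  have y: "(1 - (1 - t)) * a + (1 - t) * d = y" using td assms(4) by (simp add: algebra_simps)
  have in_I: "a \<in> I" "x \<in> I" "y \<in> I" using I_down[OF assms(5)] lt assms(1) by auto
  note pos = w_pos[OF in_I(1)] w_pos[OF in_I(2)] w_pos[OF in_I(3)] w_pos[OF assms(5)]
  have "(1 - t) * ln (w a) + t * ln (w d) \<le> ln (w x)"
    using w_log_concave[of a d t] t pos lt assms(1) unfolding x by auto
  moreover have "(1 - (1 - t)) * ln (w a) + (1 - t) * ln (w d) \<le> ln (w y)"
    using w_log_concave[of a d "1 - t"] t pos lt assms(1) unfolding y by auto
  ultimately have "ln (w a) + ln (w d) \<le> ln (w x) + ln (w y)" by (simp add: algebra_simps)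
  then have "ln (w a * w d) \<le> ln (w x * w y)" using pos by (simp add: ln_mult)
  then show ?thesis using pos by (simp add: ln_le_cancel_iff)
qed

text \<open>Both factors are log-concave: \<open>w\<close> by hypothesis, and the power of \<open>r\<close> because \<open>a d \<le> x y\<close>.\<close>

lemma f_four_point:
  assumes "0 < a" "a \<le> x" "a \<le> y" "a + d = x + y" "d \<in> I"
  shows "f a * f d \<le> f x * f y"
proof -
  define k where "k = DIM('a) - 1"
  define K where "K = (\<omega> * real DIM('a))\<^sup>2"
  have "0 \<le> (x - a) * (y - a)" using assms by simp
  also have "\<dots> = x * y - a * d" using assms(4) proof -
    have "a * d = a * (x + y - a)" using assms(4) by simp
    then show ?thesis by (simp add: algebra_simps)
  qed
  finally have "a * d \<le> x * y" by simp
  then have "(a * d) ^ k \<le> (x * y) ^ k" using assms I_def by (intro power_mono) auto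
  then have "(w a * w d) * (a * d) ^ k \<le> (w x * w y) * (x * y) ^ k"
    by (rule mult_mono[OF w_four_point[OF assms]]) (use w_nonneg assms in \<open>auto simp: I_def\<close>)
  then have "K * ((w a * w d) * (a * d) ^ k) \<le> K * ((w x * w y) * (x * y) ^ k)"
    by (rule mult_left_mono) (simp add: K_def)
  then show ?thesis by (simp add: f_def K_def k_def power2_eq_square power_mult_distrib ac_simps)
qed

lemma F_deriv: assumes r: "r \<in> I" shows "(F has_real_derivative f r) (at r)"
proof -
  have "(P has_real_derivative \<omega> * (real DIM('a) * r ^ (DIM('a) - 1))) (at r)"
    unfolding P_def by (auto intro!: derivative_eq_intros)
  moreover have "isCont w r" using w_continuous I_open r by (simp add: continuous_on_eq_continuous_at)
  moreover have "\<forall>\<^sub>F y in at r. \<bar>F y - F r - w r * (P y - P r)\<bar> \<le> \<bar>w y - w r\<bar> * \<bar>P y - P r\<bar>"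
  proof -
    have "0 < r" using r by (simp add: I_def)
    then have "\<forall>\<^sub>F y in at r. 0 < y" using eventually_at_in_open'[of "{0<..}" r] by simp
    then show ?thesis
    proof eventually_elim
      case (elim y)
      show ?case
      proof (cases "r \<le> y")
        case True
        have "w y * (P y - P r) \<le> F y - F r" "F y - F r \<le> w r * (P y - P r)" "w y \<le> w r" "P r \<le> P y"
          using F_increment[of r y] w_antimono[of r y] P_mono[of r y] True \<open>0 < r\<close> by auto
        moreover from this have "0 \<le> (w r - w y) * (P y - P r)" by (intro mult_nonneg_nonneg) auto
        ultimately have "\<bar>F y - F r - w r * (P y - P r)\<bar> \<le> (w r - w y) * (P y - P r)"
          unfolding abs_le_iff by (simp add: algebra_simps)
        then show ?thesis using \<open>w y \<le> w r\<close> \<open>P r \<le> P y\<close> by simp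
      next
        case False
        have "w r * (P r - P y) \<le> F r - F y" "F r - F y \<le> w y * (P r - P y)" "w r \<le> w y" "P y \<le> P r"
          using F_increment[of y r] w_antimono[of y r] P_mono[of y r] False elim by auto
        moreover from this have "0 \<le> (w y - w r) * (P r - P y)" by (intro mult_nonneg_nonneg) auto
        ultimately have "\<bar>F y - F r - w r * (P y - P r)\<bar> \<le> (w y - w r) * (P r - P y)"
          unfolding abs_le_iff by (simp add: algebra_simps)
        then show ?thesis using \<open>w r \<le> w y\<close> \<open>P y \<le> P r\<close> by simp
      qed
    qed
  qed
  ultimately show ?thesis
    unfolding f_def by (rule has_real_derivative_weighted_increment)
qed

lemma I_small: assumes "0 < d" obtains r where "r \<in> I" "r < d"
proof -
  obtain r where r: "r \<in> I" using I_ne by auto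
  show thesis
  proof (rule that)
    show "min r (d / 2) \<in> I" using assms I_pos[OF r] by (intro I_down[OF r]) simp_all
    show "min r (d / 2) < d" using assms by simp
  qed
qed

lemma F_bot: assumes "0 < e" shows "\<exists>r\<in>I. F r < e"
proof -
  have "isCont (\<lambda>r. w 0 * P r) 0" unfolding P_def by (intro continuous_intros)
  then have "((\<lambda>r. w 0 * P r) \<longlongrightarrow> 0) (at 0)" by (simp add: isCont_def P_def zero_power[OF DIM_positive])
  then have "\<forall>\<^sub>F r in at 0. w 0 * P r < e" using assms by (rule order_tendstoD)
  then obtain d where d: "0 < d" "\<And>r. r \<noteq> 0 \<Longrightarrow> \<bar>r\<bar> < d \<Longrightarrow> w 0 * P r < e"
    unfolding eventually_at by (auto simp: dist_real_def)
  obtain r where r: "r \<in> I" "r < d" using I_small d by blast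
  then have "F r \<le> w 0 * P r" using F_increment(2)[of 0 r] F_0 by (simp add: I_def)
  then show ?thesis using r d(2)[of r] by (intro bexI[of _ r]) (auto simp: I_def)
qed

text \<open>If the support is bounded with radius \<open>z\<close>, the boundary sphere carries no mass: just beyond \<open>z\<close> the density
  vanishes, and the mass of a thin annulus around radius \<open>z\<close> is at most \<open>w 0\<close> times its volume.\<close>

lemma F_top: assumes "0 < e" shows "\<exists>r\<in>I. 1 - e < F r"
proof -
  have "(\<lambda>k. measure \<mu> (cball 0 (real k))) \<longlonglongrightarrow> measure \<mu> (\<Union>k. cball 0 (real k))"
    by (rule \<mu>.finite_Lim_measure_incseq) (auto simp: incseq_def)
  moreover have "(\<Union>k. cball (0::'a) (real k)) = UNIV" using real_arch_simple by auto
  moreover have "measure \<mu> UNIV = 1" using \<mu>.prob_space by simp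
  ultimately have "(\<lambda>k. F (real k)) \<longlonglongrightarrow> 1" by (simp add: F_def)
  then have "\<forall>\<^sub>F k in sequentially. 1 - e / 2 < F (real k)" using assms by (intro order_tendstoD) auto
  then obtain k where k: "1 - e / 2 < F (real k)" by (auto simp: eventually_sequentially)
  show ?thesis
  proof (cases "real k \<in> I")
    case True then show ?thesis using k assms by (intro bexI[of _ "real k"]) auto
  next
    case False
    show ?thesis
    proof (cases "\<exists>r\<in>I. real k \<le> r")
      case True
      then obtain r where "r \<in> I" "F (real k) \<le> F r" using F_mono0 by blast
      then show ?thesis using k assms by (intro bexI[of _ r]) auto
    next
      case nb: False
      define z where "z = Sup I"
      have bdd: "bdd_above I" using nb by (intro bdd_aboveI[of _ "real k"]) auto
      have z: "r \<le> z" if "r \<in> I" for r using that bdd by (auto simp: z_def intro: cSup_upper)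
      have z0: "0 < z" using I_ne z by (force simp: I_def)
      have w0: "w r = 0" if "z < r" for r
      proof (rule ccontr)
        assume "w r \<noteq> 0"
        then have "(z + r) / 2 \<in> I" using w_nonneg[of r] that z0 by (auto simp: I_def intro!: exI[of _ r])
        then show False using z[of "(z + r) / 2"] that by simp
      qed
      have "isCont (\<lambda>r. w 0 * P r) z" unfolding P_def by (intro continuous_intros)
      then obtain d where d: "0 < d" "\<And>r. \<bar>r - z\<bar> < d \<Longrightarrow> \<bar>w 0 * P r - w 0 * P z\<bar> < e / 4"
        using assms unfolding continuous_at_eps_delta dist_real_def
        by (metis divide_pos_pos zero_less_numeral)
      obtain r where r: "r \<in> I" "z - d < r" using less_cSupE[of "z - d" I] d(1) I_ne by (auto simp: z_def)
      \<comment> \<open>A radius just outside the support, where the density vanishes.\<close>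
      define z' where "z' = z + d / 2"
      have "F (real k) \<le> F z'"
      proof (cases "real k \<le> z'")
        case False
        then show ?thesis using F_increment(2)[of z' "real k"] w0[of z'] z0 d(1) by (simp add: z'_def)
      qed (rule F_mono0)
      moreover have "F z' - F r \<le> w r * (P z' - P r)"
        using F_increment(2)[of r z'] r z[of r] d(1) by (auto simp: z'_def I_def)
      moreover have "w r * (P z' - P r) \<le> w 0 * (P z' - P r)"
        using r z[of r] d(1) P_mono[of r z'] w_antimono[of 0 r] by (intro mult_right_mono) (auto simp: z'_def I_def)
      moreover have "w 0 * (P z' - P r) < e / 2"
      proof -
        have "\<bar>w 0 * P z' - w 0 * P z\<bar> < e / 4" using d by (simp add: z'_def)
        moreover have "\<bar>w 0 * P r - w 0 * P z\<bar> < e / 4" using d(2)[of r] r z[of r] by simp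
        ultimately show ?thesis unfolding right_diff_distrib by linarith
      qed
      ultimately show ?thesis using k r by (intro bexI[of _ r]) auto
    qed
  qed
qed

lemma G_bot: assumes "0 < e" shows "\<exists>r\<in>I. G r < e"
proof -
  obtain r where r: "r \<in> I" "F r < e / (u + 1)" using F_bot[of "e / (u + 1)"] assms u_nonneg by auto
  have "G r \<le> u * F r" by (rule G_le_F)
  also have "\<dots> \<le> (u + 1) * F r" using u_nonneg by (intro mult_right_mono) (auto simp: F_def)
  also have "\<dots> < e" using r(2) u_nonneg by (simp add: field_simps)
  finally show ?thesis using r by blast
qed

lemma G_top: assumes "0 < e" shows "\<exists>r\<in>I. 1 - e < G r"
proof -
  obtain r where r: "r \<in> I" "1 - e / (u + 1) < F r" using F_top[of "e / (u + 1)"] assms u_nonneg by auto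
  have "1 - G r \<le> u * (1 - F r)" by (rule G_tail_le)
  also have "\<dots> \<le> (u + 1) * (1 - F r)" using u_nonneg \<mu>.prob_le_1 by (intro mult_right_mono) (auto simp: F_def)
  also have "\<dots> < e" using r(2) u_nonneg by (simp add: field_simps)
  finally show ?thesis using r by (intro bexI[of _ r]) auto
qed

sublocale profile: transport_profile I f F G l u
proof
  show "open I" by (rule I_open)
  show "0 < r" if "r \<in> I" for r using that by (rule I_pos)
  show "r \<in> I" if "d \<in> I" "0 < r" "r \<le> d" for d r using I_down that .
  show "0 < f r" if "r \<in> I" for r using w_pos[OF that] I_pos[OF that] \<omega>_pos by (simp add: f_def)
  show "continuous_on I f" unfolding f_def by (intro continuous_intros w_continuous)
  show "f a * f d \<le> f x * f y" if "0 < a" "a \<le> x" "a \<le> y" "a + d = x + y" "d \<in> I" for a x y d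
    using f_four_point that .
  show "(F has_real_derivative f r) (at r)" if "r \<in> I" for r using F_deriv that .
  show "0 \<le> F r \<and> F r \<le> 1" for r by (simp add: F_def)
  show "0 \<le> G r \<and> G r \<le> 1" for r by (simp add: G_def)
  show "l * (F b - F a) \<le> G b - G a" "G b - G a \<le> u * (F b - F a)" if "a \<in> I" "b \<in> I" "a \<le> b" for a b
    using GF_increment[of a b] I_pos[OF that(1)] that(3) by auto
qed (fact F_bot F_top G_bot G_top l_pos)+

end

section \<open>The transport profile of two radial densities\<close>

context radial_log_concave_density
begin

text \<open>Outside the support the profile is continued by the identity, which keeps the bounds because
  \<open>l / u \<le> 1 \<le> u / l\<close>.\<close>

definition S :: "real \<Rightarrow> real" where "S r = (if r \<in> I then profile.profile r else r)"

lemma S_I: "r \<in> I \<Longrightarrow> S r = profile.profile r" and S_not_I: "r \<notin> I \<Longrightarrow> S r = r"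
  by (simp_all add: S_def)

lemma S_in_I: "r \<in> I \<Longrightarrow> S r \<in> I"
  using profile.profile(1) by (simp add: S_def)

lemma l_le_u: "l \<le> u"
proof -
  obtain r where r: "r \<in> I" using I_ne by auto
  have "l * F r \<le> u * F r" using G_ge_F[of r] G_le_F[of r] by simp
  then show ?thesis using profile.F_interior(1)[OF r] by simp
qed

lemma const_le_1: "l / u \<le> 1" and one_le_const: "1 \<le> u / l"
  using l_le_u l_pos by simp_all

lemma const_pos: "0 < l / u" "0 < u / l"
  using l_le_u l_pos by simp_all

lemma bij_S: "bij S"
proof -
  have "bij_betw S I I"
    unfolding bij_betw_def
  proof
    show "inj_on S I"
    proof (rule inj_onI)
      fix a b assume "a \<in> I" "b \<in> I" "S a = S b"
      then show "a = b"
        using profile.profile_strict[of a b] profile.profile_strict[of b a]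
        by (cases a b rule: linorder_cases) (auto simp: S_I)
    qed
    show "S ` I = I"
    proof
      show "S ` I \<subseteq> I" using S_in_I by auto
      show "I \<subseteq> S ` I"
      proof
        fix t assume "t \<in> I"
        then obtain r where "r \<in> I" "profile.profile r = t" by (rule profile.profile_onto)
        then show "t \<in> S ` I" using S_I by force
      qed
    qed
  qed
  moreover have "bij_betw S (- I) (- I)"
    by (rule bij_betwI[of _ _ _ "\<lambda>x. x"]) (auto simp: S_not_I)
  ultimately have "bij_betw S (I \<union> - I) (I \<union> - I)" by (rule bij_betw_combine) auto
  then show ?thesis by simp
qed

lemma S_bounds_I:
  assumes "a \<in> I" "b \<in> I" "a \<le> b"
  shows "(l / u) * (b - a) \<le> S b - S a" "S b - S a \<le> (u / l) * (b - a)"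
  using profile.profile_lower[OF assms] profile.profile_upper[OF assms] assms by (simp_all add: S_I)

text \<open>The bounds at the left end \<open>0\<close>, where the profile tends to \<open>0\<close>.\<close>

lemma S_bounds_0:
  assumes b: "b \<in> I"
  shows "(l / u) * b \<le> S b" "S b \<le> (u / l) * b"
proof -
  show "(l / u) * b \<le> S b"
  proof (rule field_le_epsilon)
    fix e :: real assume "0 < e"
    obtain a where a: "a \<in> I" "a < min e b" using I_small[of "min e b"] \<open>0 < e\<close> I_pos[OF b] by auto
    have "(l / u) * b = (l / u) * (b - a) + (l / u) * a" by (simp only: distrib_left[symmetric] diff_add_cancel)
    also have "\<dots> \<le> (S b - S a) + 1 * a"
      using a b const_le_1 I_pos[OF a(1)] by (intro add_mono mult_right_mono S_bounds_I) auto
    also have "\<dots> \<le> S b + e" using a I_pos[OF S_in_I[OF a(1)]] by simp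
    finally show "(l / u) * b \<le> S b + e" .
  qed
  show "S b \<le> (u / l) * b"
  proof (rule field_le_epsilon)
    fix e :: real assume "0 < e"
    obtain t where t: "t \<in> I" "t < min e (S b)"
      using I_small[of "min e (S b)"] \<open>0 < e\<close> I_pos[OF S_in_I[OF b]] by auto
    obtain a where a: "a \<in> I" "profile.profile a = t" using profile.profile_onto[OF t(1)] by blast
    have "a \<le> b"
    proof (rule ccontr)
      assume "\<not> a \<le> b"
      then have "S b \<le> t" using profile.profile_mono[of b a] a b by (simp add: S_I)
      then show False using t by simp
    qed
    then have "S b - S a \<le> (u / l) * (b - a)" using a b by (intro S_bounds_I)
    also have "\<dots> \<le> (u / l) * b" using const_pos I_pos[OF a(1)] by (intro mult_left_mono) auto
    finally show "S b \<le> (u / l) * b + e" using a t by (simp add: S_I)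
  qed
qed

text \<open>The bounds across the right end \<open>z\<close> of \<open>I\<close>, where the profile tends to \<open>z\<close>: its values on \<open>I\<close> have
  supremum \<open>z\<close> because it maps \<open>I\<close> onto \<open>I\<close>.\<close>

lemma S_bounds_top:
  assumes a: "a \<in> I" and b: "b \<notin> I" and "a \<le> b"
  shows "(l / u) * (b - a) \<le> b - S a" "b - S a \<le> (u / l) * (b - a)"
proof -
  have less: "r < b" if "r \<in> I" for r
    using I_down[OF that, of b] b \<open>a \<le> b\<close> I_pos[OF a] by force
  define z where "z = Sup I"
  have z: "r \<le> z" if "r \<in> I" for r
    unfolding z_def using that by (intro cSup_upper bdd_aboveI[of _ b]) (auto intro: less_imp_le less)
  have zb: "z \<le> b" unfolding z_def using I_ne by (intro cSup_least) (auto intro: less_imp_le less)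
  have "z \<le> a + (z - S a) / (l / u)"
    unfolding z_def
  proof (rule cSup_least[OF I_ne], fold z_def)
    fix r assume r: "r \<in> I"
    show "r \<le> a + (z - S a) / (l / u)"
    proof (cases "a \<le> r")
      case True
      have "(l / u) * (r - a) \<le> z - S a" using S_bounds_I(1)[OF a r True] z[OF S_in_I[OF r]] by simp
      then have "r - a \<le> (z - S a) / (l / u)" using const_pos by (subst pos_le_divide_eq) (auto simp: mult.commute)
      then show ?thesis by simp
    next
      case False
      moreover have "0 \<le> (z - S a) / (l / u)"
        using const_pos z[OF S_in_I[OF a]] by (intro divide_nonneg_pos) auto
      ultimately show ?thesis by simp
    qed
  qed
  then have "z - a \<le> (z - S a) / (l / u)" by simp
  then have "(l / u) * (z - a) \<le> z - S a" using const_pos by (subst (asm) pos_le_divide_eq) (auto simp: mult.commute)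
  moreover have "(l / u) * (b - z) \<le> 1 * (b - z)" using zb const_le_1 by (intro mult_right_mono) auto
  ultimately show "(l / u) * (b - a) \<le> b - S a" by (simp add: right_diff_distrib)
  have "z \<le> S a + (u / l) * (z - a)"
    unfolding z_def
  proof (rule cSup_least[OF I_ne], fold z_def)
    fix t assume "t \<in> I"
    then obtain r where r: "r \<in> I" "profile.profile r = t" by (rule profile.profile_onto)
    show "t \<le> S a + (u / l) * (z - a)"
    proof (cases "a \<le> r")
      case True
      have "t - S a \<le> (u / l) * (r - a)" using S_bounds_I(2)[OF a r(1) True] r by (simp add: S_I)
      also have "\<dots> \<le> (u / l) * (z - a)" using const_pos z[OF r(1)] by (intro mult_left_mono) auto
      finally show ?thesis by simp
    next
      case False
      then have "t \<le> S a" using profile.profile_mono[of r a] r a by (simp add: S_I)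
      moreover have "0 \<le> (u / l) * (z - a)" using const_pos z[OF a] by (intro mult_nonneg_nonneg) auto
      ultimately show ?thesis by simp
    qed
  qed
  moreover have "1 * (b - z) \<le> (u / l) * (b - z)" using zb one_le_const by (intro mult_right_mono) auto
  ultimately show "b - S a \<le> (u / l) * (b - a)" by (simp add: right_diff_distrib)
qed

sublocale transport: bilipschitz_profile S "l / u" "u / l"
proof
  show "bij S" by (rule bij_S)
  show "0 < l / u" by (rule const_pos)
  show "S 0 = 0" by (simp add: S_def I_def)
  have trivial: "(l / u) * x \<le> x" "x \<le> (u / l) * x" if "0 \<le> x" for x
    using mult_right_mono[OF const_le_1 that] mult_right_mono[OF one_le_const that] by simp_all
  have "(l / u) * (b - a) \<le> S b - S a \<and> S b - S a \<le> (u / l) * (b - a)" if "a \<le> b" for a b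
  proof (cases "a \<in> I"; cases "b \<in> I")
    assume "a \<in> I" "b \<in> I"
    then show ?thesis using S_bounds_I that by blast
  next
    assume "a \<in> I" "b \<notin> I"
    then show ?thesis using S_bounds_top that by (simp add: S_not_I)
  next
    assume ab: "a \<notin> I" "b \<in> I"
    then have "a \<le> 0" using I_down[of b a] that by force
    then show ?thesis using S_bounds_0[OF ab(2)] trivial[of "- a"] ab by (simp add: S_not_I right_diff_distrib)
  next
    assume "a \<notin> I" "b \<notin> I"
    then show ?thesis using trivial[of "b - a"] that by (simp add: S_not_I)
  qed
  then show "(l / u) * (b - a) \<le> S b - S a" "S b - S a \<le> (u / l) * (b - a)" if "a \<le> b" for a b
    using that by auto
qed

lemma G_S: assumes "0 \<le> r" shows "G (S r) = F r"
proof (cases "r \<in> I")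
  case True
  then show ?thesis using profile.profile(2) by (simp add: S_I)
next
  case False
  show ?thesis
  proof (cases "r = 0")
    case True
    then show ?thesis using False by (simp add: S_not_I F_0 G_0)
  next
    case nz: False
    have less: "r' < r" if "r' \<in> I" for r' using I_down[OF that, of r] False nz assms by force
    have "1 \<le> F r"
    proof (rule field_le_epsilon)
      fix e :: real assume "0 < e"
      then obtain r' where "r' \<in> I" "1 - e < F r'" using F_top by blast
      then show "1 \<le> F r + e" using F_mono0[OF less_imp_le[OF less]] by force
    qed
    moreover have "1 \<le> G r"
    proof (rule field_le_epsilon)
      fix e :: real assume "0 < e"
      then obtain r' where "r' \<in> I" "1 - e < G r'" using G_top by blast
      then show "1 \<le> G r + e" using G_mono0[OF less_imp_le[OF less]] by force
    qed
    moreover have "F r \<le> 1" "G r \<le> 1" by (simp_all add: F_def G_def)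
    ultimately show ?thesis using False by (simp add: S_not_I)
  qed
qed

text \<open>The distribution functions agree: the event \<open>S |x| \<le> S r\<close> is the ball of radius \<open>r\<close>, and \<open>G (S r) = F r\<close>.\<close>

lemma radial_laws_match: "distr \<mu> borel (\<lambda>x. S (norm x)) = distr \<nu> borel norm"
proof (rule cdf_unique')
  have meas: "(\<lambda>x. S (norm x)) \<in> measurable \<mu> borel" by measurable
  interpret A: prob_space "distr \<mu> borel (\<lambda>x. S (norm x))" by (rule \<mu>.prob_space_distr[OF meas])
  interpret B: prob_space "distr \<nu> borel norm" by (rule \<nu>.prob_space_distr) simp
  show "finite_borel_measure (distr \<mu> borel (\<lambda>x. S (norm x)))" by unfold_locales simp
  show "finite_borel_measure (distr \<nu> borel norm)" by unfold_locales simp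
  show "cdf (distr \<mu> borel (\<lambda>x. S (norm x))) = cdf (distr \<nu> borel norm)"
  proof
    fix t
    have L: "cdf (distr \<mu> borel (\<lambda>x. S (norm x))) t = measure \<mu> {x. S (norm x) \<le> t}"
      unfolding cdf_def by (subst measure_distr[OF meas]) (auto simp: vimage_def)
    have R: "cdf (distr \<nu> borel norm) t = measure \<nu> {x. norm x \<le> t}"
      unfolding cdf_def by (subst measure_distr) (auto simp: vimage_def)
    show "cdf (distr \<mu> borel (\<lambda>x. S (norm x))) t = cdf (distr \<nu> borel norm) t"
    proof (cases "0 \<le> t")
      case True
      obtain r where r: "S r = t" using transport.s_t by blast
      have "0 \<le> r" using transport.le_iff[of 0 r] transport.zero r True by simp
      have "{x. S (norm x) \<le> t} = cball (0::'a) r" using transport.le_iff r by auto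
      moreover have "{x. norm x \<le> t} = cball (0::'a) t" by auto
      ultimately show ?thesis using G_S[OF \<open>0 \<le> r\<close>] r by (simp only: L R F_def G_def)
    next
      case False
      have "\<not> S (norm x) \<le> t" for x :: 'a using transport.nonneg[of "norm x"] False by simp
      moreover have "\<not> norm x \<le> t" for x :: 'a using norm_ge_zero[of x] False by linarith
      ultimately show ?thesis unfolding L R by simp
    qed
  qed
qed

lemma transport_push: "distr \<mu> borel transport.T = \<nu>"
  unfolding transport.T_def[abs_def]
  using h_measurable h_radial prob_h g_measurable g_radial prob_g transport.s_measurable radial_laws_match
  by (rule radial_pushforward)

end

context radial_log_concave_density
begin

text \<open>Unless the support is bounded, \<open>- ln w\<close> is convex and nonconstant, because a constant \<open>w\<close> is not integrable;
  so it grows linearly, with slope at least \<open>\<alpha>\<close> beyond \<open>r1\<close>. Comparison of \<open>w r\<close> with \<open>w (r / 2)\<close> instead of an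
  explicit exponential reduces the second moment to the total mass by scaling.\<close>

lemma w_decay: obtains K where "0 \<le> K" "\<And>r. 0 \<le> r \<Longrightarrow> r\<^sup>2 * w r \<le> K * w (r / 2)"
proof (cases "\<exists>r>0. w r = 0")
  case True
  then obtain r1 where r1: "0 < r1" "w r1 = 0" by blast
  have "r\<^sup>2 * w r \<le> r1\<^sup>2 * w (r / 2)" if "0 \<le> r" for r
  proof (cases "r \<le> r1")
    case True
    then show ?thesis using that w_antimono[of "r / 2" r] w_nonneg by (intro mult_mono power_mono) auto
  next
    case False
    then have "w r = 0" using w_antimono[of r1 r] w_nonneg[of r] r1 by simp
    then show ?thesis using w_nonneg by simp
  qed
  then show thesis using that[of "r1\<^sup>2"] by simp
next
  case False
  then have pos: "0 < w r" if "0 \<le> r" for r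
    using False that w_nonneg[of r] w_0_pos by (metis less_eq_real_def)
  have "\<exists>r>0. w r < w 0"
  proof (rule ccontr)
    assume none: "\<not> (\<exists>r>0. w r < w 0)"
    then have const: "w r = w 0" if "0 \<le> r" for r
      using none w_antimono[of 0 r] that by (metis less_eq_real_def)
    have "emeasure \<mu> UNIV = (\<integral>\<^sup>+x. h x * indicator UNIV x \<partial>lebesgue)"
      by (rule emeasure_borel_density[OF h_measurable]) simp
    also have "\<dots> = (\<integral>\<^sup>+x. ennreal (w 0) * indicator UNIV x \<partial>(lebesgue :: 'a measure))"
      by (intro nn_integral_cong) (simp add: h_eq const[OF norm_ge_zero])
    also have "\<dots> = ennreal (w 0) * emeasure lebesgue (UNIV :: 'a set)"
      by (rule nn_integral_cmult_indicator) simp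
    also have "\<dots> = \<infinity>" using w_0_pos by (simp add: ennreal_mult_top)
    finally show False using \<mu>.emeasure_space_1 by simp
  qed
  then obtain r1 where r1: "0 < r1" "w r1 < w 0" by blast
  \<comment> \<open>The slope of the chord of \<open>- ln w\<close> from \<open>0\<close> to \<open>r1\<close>.\<close>
  define \<alpha> where "\<alpha> = (ln (w 0) - ln (w r1)) / r1"
  have \<alpha>: "0 < \<alpha>" using r1 pos[of r1] w_0_pos by (simp add: \<alpha>_def)
  define K where "K = 8 / \<alpha>\<^sup>2 + 4 * r1\<^sup>2"
  have "r\<^sup>2 * w r \<le> K * w (r / 2)" if r: "0 \<le> r" for r
  proof (cases "r < 2 * r1")
    case True
    have "r\<^sup>2 * w r \<le> (2 * r1)\<^sup>2 * w (r / 2)"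
      using True r w_antimono[of "r / 2" r] w_nonneg by (intro mult_mono power_mono) auto
    also have "\<dots> \<le> K * w (r / 2)" using w_nonneg \<alpha> by (intro mult_right_mono) (auto simp: K_def power_mult_distrib)
    finally show ?thesis .
  next
    case False
    define y where "y = \<alpha> * r / 2"
    have y: "0 \<le> y" using \<alpha> r by (simp add: y_def)
    have "y \<le> ln (w 0) - ln (w (r / 2))"
    proof (cases "r / 2 = r1")
      case True
      then show ?thesis using r1 by (simp add: y_def \<alpha>_def)
    next
      case neq: False
      define t where "t = r1 / (r / 2)"
      have t: "0 < t" "t < 1" "t * (r / 2) = r1" using r1 False neq by (auto simp: t_def field_simps)
      have "(1 - t) * ln (w 0) + t * ln (w (r / 2)) \<le> ln (w ((1 - t) * 0 + t * (r / 2)))"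
        using t pos r by (intro w_log_concave) auto
      then have "ln (w 0) - ln (w r1) \<le> t * (ln (w 0) - ln (w (r / 2)))"
        using t(3) by (simp add: algebra_simps)
      then have "\<alpha> * r1 \<le> t * (ln (w 0) - ln (w (r / 2)))" using r1 by (simp add: \<alpha>_def)
      moreover have "\<alpha> * r1 = t * y" using t(3) by (simp add: y_def algebra_simps flip: t(3))
      ultimately show ?thesis using t(1) by simp
    qed
    moreover have "(1 - 1 / 2) * ln (w 0) + (1 / 2) * ln (w r) \<le> ln (w ((1 - 1 / 2) * 0 + 1 / 2 * r))"
      using pos r by (intro w_log_concave) auto
    then have "ln (w 0) / 2 + ln (w r) / 2 \<le> ln (w (r / 2))" by simp
    ultimately have "ln (w r) \<le> ln (w (r / 2)) - y" by simp
    then have "exp (ln (w r)) \<le> exp (ln (w (r / 2)) - y)" by (simp only: exp_le_cancel_iff)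
    then have wr: "w r \<le> w (r / 2) * exp (- y)" using pos[of r] pos[of "r / 2"] r by (simp add: exp_diff exp_minus field_simps)
    \<comment> \<open>The gain \<open>exp (- y)\<close> absorbs the factor \<open>r\<^sup>2\<close>, since \<open>y\<^sup>2 \<le> 2 exp y\<close>.\<close>
    have "r\<^sup>2 = 4 / \<alpha>\<^sup>2 * y\<^sup>2" using \<alpha> by (simp add: y_def power_mult_distrib power_divide field_simps)
    also have "\<dots> \<le> 4 / \<alpha>\<^sup>2 * (2 * exp y)"
      using exp_lower_Taylor_quadratic[OF y] y by (intro mult_left_mono) auto
    finally have r2: "r\<^sup>2 \<le> 8 / \<alpha>\<^sup>2 * exp y" by simp
    have "r\<^sup>2 * w r \<le> (8 / \<alpha>\<^sup>2 * exp y) * (w (r / 2) * exp (- y))"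
      using r2 wr w_nonneg by (intro mult_mono) auto
    also have "\<dots> = 8 / \<alpha>\<^sup>2 * w (r / 2)" by (simp add: exp_minus field_simps)
    also have "\<dots> \<le> K * w (r / 2)" using w_nonneg by (intro mult_right_mono) (auto simp: K_def)
    finally show ?thesis .
  qed
  then show thesis using that[of K] by (simp add: K_def)
qed

text \<open>Finiteness of the transport costs; the substitution \<open>x \<mapsto> 2 x\<close> turns \<open>w (|x| / 2)\<close> into the density itself.\<close>

lemma second_moment: "integrable \<mu> (\<lambda>x. (norm x)\<^sup>2)"
proof (rule integrableI_bounded)
  show "(\<lambda>x. (norm x)\<^sup>2) \<in> borel_measurable \<mu>" by measurable
  obtain K where K: "0 \<le> K" "\<And>r. 0 \<le> r \<Longrightarrow> r\<^sup>2 * w r \<le> K * w (r / 2)" by (rule w_decay) blast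
  define k where "k = (\<lambda>x::'a. ennreal (w (norm x / 2)))"
  have [measurable]: "k \<in> borel_measurable borel" unfolding k_def by measurable
  have hb: "h \<in> borel_measurable borel"
  proof -
    have "h = (\<lambda>x. ennreal (w (norm x)))" using h_eq by auto
    then show ?thesis by simp
  qed
  have "(\<integral>\<^sup>+x. k x \<partial>lborel) = (\<integral>\<^sup>+x. k x \<partial>density (distr lborel borel (\<lambda>x::'a. 0 + 2 *\<^sub>R x)) (\<lambda>_. ennreal (\<bar>2\<bar> ^ DIM('a))))"
    using lborel_affine[of 2 "0::'a"] by simp
  also have "\<dots> = (\<integral>\<^sup>+x. ennreal (2 ^ DIM('a)) * k x \<partial>distr lborel borel (\<lambda>x::'a. 0 + 2 *\<^sub>R x))"
    by (subst nn_integral_density) auto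
  also have "\<dots> = (\<integral>\<^sup>+x. ennreal (2 ^ DIM('a)) * k (0 + 2 *\<^sub>R x) \<partial>lborel)"
    by (rule nn_integral_distr) auto
  also have "\<dots> = (\<integral>\<^sup>+x. ennreal (2 ^ DIM('a)) * h x \<partial>lborel)"
    by (intro nn_integral_cong) (simp add: k_def h_eq)
  also have "\<dots> = ennreal (2 ^ DIM('a)) * (\<integral>\<^sup>+x. h x \<partial>lborel)"
    using hb by (intro nn_integral_cmult) simp
  also have "(\<integral>\<^sup>+x. h x \<partial>lborel) = emeasure \<mu> UNIV"
    using emeasure_borel_density[OF h_measurable, of UNIV] by (simp add: nn_integral_completion)
  also have "emeasure \<mu> UNIV = 1" using \<mu>.emeasure_space_1 by simp
  finally have k: "(\<integral>\<^sup>+x. k x \<partial>lborel) = ennreal (2 ^ DIM('a))" by simp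
  have "(\<integral>\<^sup>+x. ennreal (norm ((norm x)\<^sup>2)) \<partial>\<mu>) = (\<integral>\<^sup>+x. h x * ennreal (norm ((norm x)\<^sup>2)) \<partial>lebesgue)"
    by (rule nn_integral_borel_density[OF h_measurable]) measurable
  also have "\<dots> = (\<integral>\<^sup>+x. h x * ennreal (norm ((norm x)\<^sup>2)) \<partial>lborel)"
    by (simp add: nn_integral_completion)
  also have "\<dots> \<le> (\<integral>\<^sup>+x. ennreal K * k x \<partial>lborel)"
  proof (rule nn_integral_mono)
    fix x :: 'a
    have "h x * ennreal (norm ((norm x)\<^sup>2)) = ennreal ((norm x)\<^sup>2 * w (norm x))"
      using w_nonneg by (simp add: h_eq ennreal_mult mult.commute)
    also have "\<dots> \<le> ennreal (K * w (norm x / 2))" using K(2) by (intro ennreal_leI) simp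
    finally show "h x * ennreal (norm ((norm x)\<^sup>2)) \<le> ennreal K * k x"
      using K w_nonneg by (simp add: k_def ennreal_mult)
  qed
  also have "\<dots> = ennreal K * (\<integral>\<^sup>+x. k x \<partial>lborel)" by (intro nn_integral_cmult) simp
  also have "\<dots> < \<infinity>" unfolding k using K(1) by (simp add: ennreal_mult[symmetric])
  finally show "(\<integral>\<^sup>+x. ennreal (norm ((norm x)\<^sup>2)) \<partial>\<mu>) < \<infinity>" .
qed

end

section \<open>The Jacobian of a radial map\<close>

lemma real_derivative_between:
  fixes s :: "real \<Rightarrow> real"
  assumes D: "(s has_real_derivative D) (at r)"
    and low: "\<And>a b. a \<le> b \<Longrightarrow> c * (b - a) \<le> s b - s a"
    and up: "\<And>a b. a \<le> b \<Longrightarrow> s b - s a \<le> C * (b - a)"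
  shows "c \<le> D" "D \<le> C"
proof -
  have lim: "((\<lambda>y. (s y - s r) / (y - r)) \<longlongrightarrow> D) (at r)"
    using D by (simp add: has_field_derivative_iff)
  have "c \<le> (s y - s r) / (y - r) \<and> (s y - s r) / (y - r) \<le> C" if "y \<noteq> r" for y
  proof (cases "r < y")
    case True
    then show ?thesis using low[of r y] up[of r y] by (simp add: pos_le_divide_eq pos_divide_le_eq)
  next
    case False
    then have "y < r" using that by simp
    then show ?thesis using low[of y r] up[of y r]
      by (simp add: neg_le_divide_eq neg_divide_le_eq algebra_simps)
  qed
  then have ev: "\<forall>\<^sub>F y in at r. c \<le> (s y - s r) / (y - r)" "\<forall>\<^sub>F y in at r. (s y - s r) / (y - r) \<le> C"
    by (auto simp: eventually_at_filter)
  show "c \<le> D" using lim ev(1) by (rule tendsto_lowerbound) simp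
  show "D \<le> C" using lim ev(2) by (rule tendsto_upperbound) simp
qed

lemma radial_map_has_derivative:
  fixes s :: "real \<Rightarrow> real" and x :: "'a::euclidean_space"
  assumes "x \<noteq> 0" and D: "(s has_real_derivative D) (at (norm x))"
  shows "((\<lambda>y. s (norm y) *\<^sub>R sgn y) has_derivative
    (\<lambda>v. (s (norm x) / norm x) *\<^sub>R v + ((D - s (norm x) / norm x) * (sgn x \<bullet> v)) *\<^sub>R sgn x)) (at x)"
proof -
  define r where "r = norm x"
  have r: "0 < r" using assms(1) by (simp add: r_def)
  define k where "k = (\<lambda>\<rho>. s \<rho> / \<rho>)"
  have k: "(k has_real_derivative (D * r - s r) / (r * r)) (at r)"
    unfolding k_def using r D by (auto simp: r_def intro!: derivative_eq_intros)
  have n: "(norm has_derivative (\<lambda>v. sgn x \<bullet> v)) (at x)"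
    using has_derivative_norm[OF assms(1)] by (simp add: inner_commute)
  have "((\<lambda>y. k (norm y)) has_derivative (\<lambda>v. (D * r - s r) / (r * r) * (sgn x \<bullet> v))) (at x)"
    using has_derivative_compose[OF n, of k "(*) ((D * r - s r) / (r * r))"] k
    by (simp add: has_field_derivative_def r_def)
  from has_derivative_scaleR[OF this has_derivative_ident]
  have der: "((\<lambda>y. k (norm y) *\<^sub>R y) has_derivative
      (\<lambda>v. k (norm x) *\<^sub>R v + ((D * r - s r) / (r * r) * (sgn x \<bullet> v)) *\<^sub>R x)) (at x)" .
  have fun_eq: "(\<lambda>y. k (norm y) *\<^sub>R y) = (\<lambda>y. s (norm y) *\<^sub>R sgn y)"
    by (auto simp: k_def sgn_div_norm divide_inverse)
  have coeff: "((D * r - s r) / (r * r) * a) *\<^sub>R x = ((D - s r / r) * a) *\<^sub>R sgn x" for a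
  proof -
    have "(D * r - s r) / (r * r) = (D - s r / r) / r" using r by (simp add: field_simps)
    then show ?thesis by (simp add: sgn_div_norm r_def divide_inverse ac_simps)
  qed
  show ?thesis using der unfolding fun_eq coeff by (simp add: k_def r_def)
qed

lemma sgn_inner_square_le: "(sgn x \<bullet> v)\<^sup>2 \<le> v \<bullet> (v::'a::real_inner)"
proof -
  have "\<bar>sgn x \<bullet> v\<bar> \<le> norm (sgn x) * norm v" by (rule Cauchy_Schwarz_ineq2)
  also have "\<dots> \<le> 1 * norm v" by (intro mult_right_mono) (auto simp: norm_sgn)
  finally have "\<bar>sgn x \<bullet> v\<bar>\<^sup>2 \<le> (norm v)\<^sup>2" by (intro power_mono) auto
  then show ?thesis by (simp add: power2_norm_eq_inner)
qed

text \<open>The quadratic form of the Jacobian is \<open>k (|v|\<^sup>2 - a\<^sup>2) + D a\<^sup>2\<close>, where \<open>a\<close> is the radial component of \<open>v\<close> and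
  \<open>0 \<le> a\<^sup>2 \<le> |v|\<^sup>2\<close>.\<close>

lemma loewner_le_radial_jacobian:
  fixes x :: "real^'n"
  assumes T': "(T has_derivative (\<lambda>v. k *\<^sub>R v + ((D - k) * (sgn x \<bullet> v)) *\<^sub>R sgn x)) (at x)"
    and bounds: "c \<le> k" "k \<le> C" "c \<le> D" "D \<le> C"
  shows "T differentiable (at x)"
    and "loewner_le (c *\<^sub>R mat 1) (jacobian T (at x))"
    and "loewner_le (jacobian T (at x)) (C *\<^sub>R mat 1)"
proof -
  define L where "L = (\<lambda>v. k *\<^sub>R v + ((D - k) * (sgn x \<bullet> v)) *\<^sub>R sgn x)"
  show diff: "T differentiable (at x)" using T' differentiableI by blast
  have J: "jacobian T (at x) = matrix L"
    using frechet_derivative_at[OF T'] by (simp add: jacobian_def L_def)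
  have lin: "linear L" using T' has_derivative_linear by (auto simp: L_def)
  have "L (axis j 1) $ i = k * (if i = j then 1 else 0) + (D - k) * (sgn x $ j * sgn x $ i)" for i j
    by (simp add: L_def inner_axis) (simp add: axis_def)
  then have sym: "transpose (matrix L) = matrix L"
    by (simp add: vec_eq_iff transpose_def matrix_def mult.commute)
  have app: "matrix L *v v = L v" for v using lin by (simp add: matrix_works)
  have quad: "v \<bullet> L v = k * (v \<bullet> v - (sgn x \<bullet> v)\<^sup>2) + D * (sgn x \<bullet> v)\<^sup>2" for v
    by (simp add: L_def inner_add_right inner_commute power2_eq_square algebra_simps)
  have scal: "v \<bullet> ((a *\<^sub>R mat 1) *v v) = a * (v \<bullet> v - (sgn x \<bullet> v)\<^sup>2) + a * (sgn x \<bullet> v)\<^sup>2" for a and v :: "real^'n"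
    by (simp add: scaleR_matrix_vector_assoc[symmetric] algebra_simps)
  have tm: "transpose (a *\<^sub>R mat 1) = (a *\<^sub>R mat 1 :: real^'n^'n)" for a
    by (simp add: vec_eq_iff transpose_def mat_def)
  show "loewner_le (c *\<^sub>R mat 1) (jacobian T (at x))"
    unfolding J loewner_le_def app quad scal
    using sgn_inner_square_le bounds by (auto simp: sym tm intro!: add_mono mult_right_mono)
  show "loewner_le (jacobian T (at x)) (C *\<^sub>R mat 1)"
    unfolding J loewner_le_def app quad scal
    using sgn_inner_square_le bounds by (auto simp: sym tm intro!: add_mono mult_right_mono)
qed

context bilipschitz_profile
begin

lemma slope_bounds: assumes "0 < r" shows "c \<le> s r / r" "s r / r \<le> C"
  using low[of 0 r] up[of 0 r] zero assms by (auto simp: le_divide_eq divide_le_eq)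

lemma T_has_derivative:
  assumes "x \<noteq> 0" "(s has_real_derivative D) (at (norm x))"
  shows "(T has_derivative
    (\<lambda>v. (s (norm x) / norm x) *\<^sub>R v + ((D - s (norm x) / norm x) * (sgn x \<bullet> v)) *\<^sub>R sgn x)) (at x)"
  using radial_map_has_derivative[OF assms] by (simp add: T_def[abs_def])

text \<open>For points at distances \<open>a, b\<close> from the origin and directions with inner product \<open>p\<close>, the squared distance is
  \<open>(a - b)\<^sup>2 + 2 a b (1 - p)\<close>; the map multiplies each of the two terms by at most \<open>C\<^sup>2\<close>.\<close>

lemma T_lipschitz: "C-lipschitz_on UNIV (T :: 'a::euclidean_space \<Rightarrow> 'a)"
proof (rule lipschitz_onI)
  show "0 \<le> C" using C_pos by simp
  fix x y :: 'a
  define a where "a = norm x" define b where "b = norm y"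
  have ab: "0 \<le> a" "0 \<le> b" by (simp_all add: a_def b_def)
  have sab: "0 \<le> s a" "0 \<le> s b" "s a \<le> C * a" "s b \<le> C * b"
    using nonneg abs_le[of a] abs_le[of b] ab by auto
  define p where "p = sgn x \<bullet> sgn y"
  have p: "p \<le> 1"
  proof -
    have "p \<le> norm (sgn x) * norm (sgn y)" unfolding p_def by (rule norm_cauchy_schwarz)
    also have "\<dots> \<le> 1" by (simp add: norm_sgn)
    finally show ?thesis .
  qed
  have sq: "(norm (\<alpha> *\<^sub>R sgn x - \<beta> *\<^sub>R sgn y))\<^sup>2 = (\<alpha> - \<beta>)\<^sup>2 + 2 * (\<alpha> * \<beta>) * (1 - p)"
    if "x = 0 \<Longrightarrow> \<alpha> = 0" "y = 0 \<Longrightarrow> \<beta> = 0" for \<alpha> \<beta>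
  proof -
    have XY: "\<alpha> * (\<alpha> * (sgn x \<bullet> sgn x)) = \<alpha> * \<alpha>" "\<beta> * (\<beta> * (sgn y \<bullet> sgn y)) = \<beta> * \<beta>"
      using that by (cases "x = 0"; cases "y = 0"; simp add: norm_sgn flip: power2_norm_eq_inner)+
    show ?thesis
      unfolding power2_norm_eq_inner
      by (simp add: XY p_def inner_diff_left inner_diff_right inner_commute power2_eq_square algebra_simps)
  qed
  have "(norm (T x - T y))\<^sup>2 = (s a - s b)\<^sup>2 + 2 * (s a * s b) * (1 - p)"
    unfolding T_def a_def b_def by (rule sq) (auto simp: zero)
  also have "\<dots> \<le> (C * (a - b))\<^sup>2 + 2 * ((C * a) * (C * b)) * (1 - p)"
  proof (intro add_mono mult_right_mono mult_left_mono mult_mono)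
    have "\<bar>s a - s b\<bar> \<le> \<bar>C * (a - b)\<bar>" using dist_le[of a b] C_pos by (simp add: abs_mult)
    then show "(s a - s b)\<^sup>2 \<le> (C * (a - b))\<^sup>2" by (simp add: abs_le_square_iff)
  qed (use sab ab p C_pos in auto)
  also have "\<dots> = C\<^sup>2 * ((a - b)\<^sup>2 + 2 * (a * b) * (1 - p))"
    by (simp add: power2_eq_square algebra_simps)
  also have "(a - b)\<^sup>2 + 2 * (a * b) * (1 - p) = (norm (a *\<^sub>R sgn x - b *\<^sub>R sgn y))\<^sup>2"
    by (rule sq[symmetric]) (auto simp: a_def b_def)
  also have "a *\<^sub>R sgn x - b *\<^sub>R sgn y = x - y"
    by (simp add: a_def b_def norm_scaleR_sgn)
  also have "C\<^sup>2 * (norm (x - y))\<^sup>2 = (C * norm (x - y))\<^sup>2" by (simp add: power_mult_distrib)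
  finally show "dist (T x) (T y) \<le> C * dist x y"
    unfolding dist_norm by (rule power2_le_imp_le) (use C_pos in simp)
qed

end

context bilipschitz_profile
begin

lemma T_jacobian_bounds:
  "AE x in lebesgue. (T :: real^'n \<Rightarrow> real^'n) differentiable (at x) \<and>
    loewner_le (c *\<^sub>R mat 1) (jacobian T (at x)) \<and>
    loewner_le (jacobian T (at x)) (C *\<^sub>R mat 1)"
proof -
  have "AE x in lebesgue. norm (x :: real^'n) \<notin> {r. \<not> s differentiable (at r)}"
    by (rule AE_norm_lebesgue[OF bilipschitz_differentiable_ae[OF bij c_pos low up]])
  moreover have "AE x in lebesgue. x \<noteq> (0 :: real^'n)"
    by (intro AE_completion AE_lborel_singleton)
  ultimately show ?thesis
  proof eventually_elim
    case (elim x)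
    then obtain D where D: "(s has_real_derivative D) (at (norm x))"
      by (auto simp: real_differentiable_def)
    have k: "c \<le> s (norm x) / norm x" "s (norm x) / norm x \<le> C"
      using slope_bounds[of "norm x"] elim by auto
    have Db: "c \<le> D" "D \<le> C" using real_derivative_between[OF D low up] by auto
    show ?case
      using loewner_le_radial_jacobian[OF T_has_derivative[OF _ D] k Db] elim by auto
  qed
qed

end

section \<open>The transport from \<open>e\<^sup>-\<^sup>V dx\<close> to \<open>e\<^sup>-\<^sup>V\<^sup>-\<^sup>q dx\<close>\<close>

lemma AE_le_Linf_norm:
  fixes f :: "'a::euclidean_space \<Rightarrow> real"
  assumes f: "f \<in> borel_measurable lebesgue" and "bounded (range f)"
  shows "AE x in lebesgue. \<bar>f x\<bar> \<le> Linf_norm f"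
proof -
  obtain B where B: "\<And>x. \<bar>f x\<bar> \<le> B" using assms(2) by (auto simp: bounded_iff)
  define E where "E = esssup lebesgue (\<lambda>x. ereal \<bar>f x\<bar>)"
  have "E \<le> ereal B" unfolding E_def using f B by (intro esssup_I) auto
  have "AE x in lebesgue. ereal \<bar>f x\<bar> \<le> E" unfolding E_def by (rule esssup_AE)
  then show ?thesis
  proof eventually_elim
    case (elim x)
    then show ?case using \<open>E \<le> ereal B\<close>
      unfolding Linf_norm_def E_def[symmetric] by (cases E) auto
  qed
qed

lemma radially_symmetricD: "radially_symmetric f \<Longrightarrow> norm x = norm y \<Longrightarrow> f x = f y"
  unfolding radially_symmetric_def by blast

lemma convex_erealD:
  "convex_ereal V \<Longrightarrow> 0 < t \<Longrightarrow> t < 1 \<Longrightarrow>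
    V ((1 - t) *\<^sub>R x + t *\<^sub>R y) \<le> ereal (1 - t) * V x + ereal t * V y"
  by (simp add: convex_ereal_def)

text \<open>A point at distance \<open>|x|\<close> lies on the segment from \<open>- y\<close> to \<open>y\<close>, at whose ends \<open>V\<close> has the same value.\<close>

lemma convex_radial_mono:
  assumes conv: "convex_ereal V" and rad: "radially_symmetric V" and "norm x \<le> norm y"
  shows "V x \<le> V y"
proof (cases "norm x = norm y")
  case True
  then show ?thesis using radially_symmetricD[OF rad True] by simp
next
  case False
  then have lt: "norm x < norm y" using assms(3) by simp
  then have y: "0 < norm y" using norm_ge_zero[of x] by linarith
  define \<theta> where "\<theta> = norm x / norm y"
  \<comment> \<open>The weight that gives \<open>- (1 - t) + t = \<theta>\<close>.\<close>
  define t where "t = (1 + \<theta>) / 2"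
  have \<theta>: "0 \<le> \<theta>" "\<theta> < 1" using lt y by (auto simp: \<theta>_def)
  have t: "t \<in> {0<..<1}" using \<theta> by (simp add: t_def)
  have "(1 - t) *\<^sub>R (- y) + t *\<^sub>R y = (- (1 - t) + t) *\<^sub>R y"
    by (simp only: scaleR_add_left scaleR_minus_left scaleR_minus_right)
  also have "- (1 - t) + t = \<theta>" by (simp add: t_def field_simps)
  finally have eq: "(1 - t) *\<^sub>R (- y) + t *\<^sub>R y = \<theta> *\<^sub>R y" .
  have "norm x = norm (\<theta> *\<^sub>R y)" using \<theta> y by (simp add: \<theta>_def)
  then have "V x = V ((1 - t) *\<^sub>R (- y) + t *\<^sub>R y)"
    unfolding eq by (rule radially_symmetricD[OF rad])
  also have "\<dots> \<le> ereal (1 - t) * V (- y) + ereal t * V y"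
    using conv t unfolding convex_ereal_def by blast
  also have "V (- y) = V y" by (rule radially_symmetricD[OF rad]) simp
  also have "ereal (1 - t) * V y + ereal t * V y = V y"
  proof -
    have "V y \<noteq> -\<infinity>" using conv unfolding convex_ereal_def by blast
    then show ?thesis using t by (cases "V y") (auto simp: algebra_simps)
  qed
  finally show ?thesis .
qed

theorem theorem1p3:
  fixes V :: "real^'n \<Rightarrow> ereal" and q :: "real^'n \<Rightarrow> real"
  assumes "convex_ereal V" and "radially_symmetric V"
    and "q \<in> borel_measurable lebesgue" and "bounded (range q)" and "radially_symmetric q"
    and "borel_density (\<lambda>x. exp_ereal (- V x)) \<in> space (prob_algebra borel)"
    and "borel_density (\<lambda>x. exp_ereal (- V x - ereal (q x))) \<in> space (prob_algebra borel)"
  shows "\<exists>T :: real^'n \<Rightarrow> real^'n.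
    the_optimal_transport (borel_density (\<lambda>x. exp_ereal (- V x)))
      (borel_density (\<lambda>x. exp_ereal (- V x - ereal (q x)))) T \<and>
    (\<exists>L. L-lipschitz_on UNIV T) \<and>
    (AE x in lebesgue. T differentiable (at x) \<and>
      loewner_le
        (exp (- Linf_norm (\<lambda>x. max (q x) 0) - Linf_norm (\<lambda>x. max (- q x) 0)) *\<^sub>R mat 1)
        (jacobian T (at x)) \<and>
      loewner_le
        (jacobian T (at x))
        (exp (Linf_norm (\<lambda>x. max (q x) 0) + Linf_norm (\<lambda>x. max (- q x) 0)) *\<^sub>R mat 1))"
proof -
  define p where "p = Linf_norm (\<lambda>x. max (q x) 0)"
  define m where "m = Linf_norm (\<lambda>x. max (- q x) 0)"
  define e :: "real^'n" where "e = (SOME e. e \<in> Basis)"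
  have e: "norm e = 1" unfolding e_def using SOME_Basis by (rule norm_Basis)
  define w where "w = (\<lambda>r. if V (max 0 r *\<^sub>R e) = \<infinity> then 0 else exp (- real_of_ereal (V (max 0 r *\<^sub>R e))))"
  define h where "h = (\<lambda>x. exp_ereal (- V x))"
  define g where "g = (\<lambda>x. exp_ereal (- V x - ereal (q x)))"
  have V_ninf: "V x \<noteq> -\<infinity>" for x using assms(1) unfolding convex_ereal_def by blast
  have V_norm: "V (norm x *\<^sub>R e) = V x" for x
    using e by (intro radially_symmetricD[OF assms(2)]) simp
  have h_eq: "h x = ennreal (w (norm x))" for x
    using V_ninf[of x] by (cases "V x") (auto simp: h_def w_def V_norm exp_ereal_def)
  have g_eq: "g x = ennreal (w (norm x) * exp (- q x))" for x
    using V_ninf[of x] by (cases "V x") (auto simp: g_def w_def V_norm exp_ereal_def exp_add[symmetric])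
  have w_nonneg: "0 \<le> w r" for r by (simp add: w_def)
  have w_mono: "w b \<le> w a" if "a \<le> b" for a b
  proof -
    have "V (max 0 a *\<^sub>R e) \<le> V (max 0 b *\<^sub>R e)"
      using that e by (intro convex_radial_mono assms) auto
    then show ?thesis using V_ninf[of "max 0 a *\<^sub>R e"] V_ninf[of "max 0 b *\<^sub>R e"]
      by (cases "V (max 0 a *\<^sub>R e)"; cases "V (max 0 b *\<^sub>R e)") (auto simp: w_def)
  qed
  have w_meas: "w \<in> borel_measurable borel"
  proof -
    have "(\<lambda>r. - w r) \<in> borel_measurable borel"
      by (rule borel_measurable_mono) (simp add: mono_def w_mono)
    then show ?thesis by (simp add: borel_measurable_uminus_eq)
  qed
  have g_meas: "g \<in> borel_measurable lebesgue"
  proof -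
    have "(\<lambda>x::real^'n. w (norm x)) \<in> borel_measurable lebesgue"
      using w_meas by (intro measurable_completion) simp
    then have "(\<lambda>x. ennreal (w (norm x) * exp (- q x))) \<in> borel_measurable lebesgue"
      using assms(3) by measurable
    moreover have "g = (\<lambda>x. ennreal (w (norm x) * exp (- q x)))" using g_eq by auto
    ultimately show ?thesis by simp
  qed
  obtain B where B: "\<And>x. \<bar>q x\<bar> \<le> B" using assms(4) by (auto simp: bounded_iff)
  have "AE x in lebesgue. \<bar>max (q x) 0\<bar> \<le> p"
    unfolding p_def
  proof (rule AE_le_Linf_norm)
    show "bounded (range (\<lambda>x. max (q x) 0))"
      unfolding bounded_iff
    proof (intro exI[of _ B] ballI, elim rangeE)
      show "norm y \<le> B" if "y = max (q x) 0" for y x using B[of x] that by auto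
    qed
  qed (use assms(3) in measurable)
  moreover have "AE x in lebesgue. \<bar>max (- q x) 0\<bar> \<le> m"
    unfolding m_def
  proof (rule AE_le_Linf_norm)
    show "bounded (range (\<lambda>x. max (- q x) 0))"
      unfolding bounded_iff
    proof (intro exI[of _ B] ballI, elim rangeE)
      show "norm y \<le> B" if "y = max (- q x) 0" for y x using B[of x] that by auto
    qed
  qed (use assms(3) in measurable)
  ultimately have q_ae: "AE x in lebesgue. q x \<le> p \<and> - m \<le> q x" by eventually_elim auto
  interpret radial_log_concave_density w h g "exp (- p)" "exp m"
  proof (rule radial_log_concave_density.intro)
    show "(1 - t) * ln (w a) + t * ln (w b) \<le> ln (w ((1 - t) * a + t * b))"
      if ab: "0 \<le> a" "0 \<le> b" "0 < w a" "0 < w b" "0 < t" "t < 1" for a b t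
    proof -
      obtain \<alpha> where \<alpha>: "V (a *\<^sub>R e) = ereal \<alpha>"
        using ab V_ninf[of "a *\<^sub>R e"] by (cases "V (a *\<^sub>R e)") (auto simp: w_def max_def)
      obtain \<beta> where \<beta>: "V (b *\<^sub>R e) = ereal \<beta>"
        using ab V_ninf[of "b *\<^sub>R e"] by (cases "V (b *\<^sub>R e)") (auto simp: w_def max_def)
      define c where "c = (1 - t) * a + t * b"
      have c: "0 \<le> c" using ab by (simp add: c_def)
      have "V ((1 - t) *\<^sub>R (a *\<^sub>R e) + t *\<^sub>R (b *\<^sub>R e)) \<le> ereal (1 - t) * V (a *\<^sub>R e) + ereal t * V (b *\<^sub>R e)"
        by (rule convex_erealD[OF assms(1) ab(5,6)])
      moreover have "(1 - t) *\<^sub>R (a *\<^sub>R e) + t *\<^sub>R (b *\<^sub>R e) = c *\<^sub>R e"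
        by (simp add: c_def scaleR_add_left)
      ultimately have "V (c *\<^sub>R e) \<le> ereal ((1 - t) * \<alpha> + t * \<beta>)" by (simp add: \<alpha> \<beta>)
      then obtain \<gamma> where \<gamma>: "V (c *\<^sub>R e) = ereal \<gamma>" "\<gamma> \<le> (1 - t) * \<alpha> + t * \<beta>"
        using V_ninf[of "c *\<^sub>R e"] by (cases "V (c *\<^sub>R e)") auto
      have "w a = exp (- \<alpha>)" "w b = exp (- \<beta>)" "w c = exp (- \<gamma>)"
        using \<alpha> \<beta> \<gamma> ab c by (simp_all add: w_def max_def)
      then show ?thesis using \<gamma>(2) by (simp add: c_def[symmetric])
    qed
    show "radially_symmetric g"
      unfolding radially_symmetric_def
    proof (intro allI impI)
      fix x y :: "real^'n" assume "norm x = norm y"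
      then show "g x = g y" using radially_symmetricD[OF assms(5), of x y] by (simp add: g_eq)
    qed
    show "prob_space (borel_density h)" "prob_space (borel_density g)"
      using assms(6,7) by (auto simp: space_prob_algebra h_def g_def)
    show "AE x in lebesgue. ennreal (exp (- p)) * h x \<le> g x"
      using q_ae
    proof eventually_elim
      case (elim x)
      then have "exp (- p) * w (norm x) \<le> exp (- q x) * w (norm x)"
        by (intro mult_right_mono w_nonneg) simp
      then show ?case using w_nonneg
        by (simp add: h_eq g_eq ennreal_mult[symmetric] mult.commute)
    qed
    show "AE x in lebesgue. g x \<le> ennreal (exp m) * h x"
      using q_ae
    proof eventually_elim
      case (elim x)
      then have "exp (- q x) * w (norm x) \<le> exp m * w (norm x)"
        by (intro mult_right_mono w_nonneg) simp
      then show ?case using w_nonneg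
        by (simp add: h_eq g_eq ennreal_mult[symmetric] mult.commute)
    qed
  qed (use w_nonneg w_mono w_meas h_eq g_meas in auto)
  have c: "exp (- p) / exp m = exp (- p - m)" and C: "exp m / exp (- p) = exp (p + m)"
    by (simp_all add: exp_diff[symmetric] add.commute)
  have "the_optimal_transport (borel_density h) (borel_density g) transport.T"
    by (rule transport.the_optimal_transport_T[OF _ second_moment transport_push]) simp
  moreover have "(exp m / exp (- p))-lipschitz_on UNIV (transport.T :: real^'n \<Rightarrow> real^'n)"
    by (rule transport.T_lipschitz)
  moreover note transport.T_jacobian_bounds[where 'n='n, unfolded c C]
  ultimately show ?thesis
    unfolding p_def[symmetric] m_def[symmetric] h_def[symmetric] g_def[symmetric]
    by (intro exI[of _ transport.T] conjI exI[of _ "exp m / exp (- p)"])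
qed

end
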